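(* Let $T : \mathbb{C}[z_1,\ldots,z_n] \to \mathbb{C}[[z_1,\ldots,z_m]]$ be a linear operator of rank at least two. Then $T$ is a Laguerre--Pólya preserver if and only if $G_T(z,-w) \in \mathscr{LP}_{\beta\oplus\gamma}(\mathbb{C})$ for some $\beta \in \mathbb{R}_+^m$ and $\gamma \in \mathbb{R}_+^n$. Moreover, if $G_T(z,-w) \in \mathscr{LP}_{\beta\oplus\gamma}(\mathbb{C})$ (with $\beta\in\mathbb{R}_+^m$, $\gamma\in\mathbb{R}_+^n$), then (1) for all $\alpha \in \mathbb{R}_+^n$ with $\alpha \le \gamma^{-1}$, $T$ extends to a bounded linear operator $T : \mathcal{F}_\alpha \to \mathcal{F}_\beta$ satisfying, for all $f\in\mathcal{F}_\alpha$, $$\|T(f)\|_\beta \le \|G_T(z,\alpha w)\|_{\beta\oplus\alpha}\,\|f\|_\alpha \quad\text{and}\quad T(f)(z) = \int_{\mathbb{C}^n} f(w)\, G_T(z,\alpha\overline{w})\, d\sigma_\alpha(w);$$ (2) for all $\alpha \in \mathbb{R}_+^n$ with $\alpha \le \gamma^{-1}$, this extension maps $\mathscr{LP}_\alpha(\mathbb{C})$ into $\mathscr{LP}_\beta(\mathbb{C})$.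
   Context: Notation: $\mathbb{N}=\{0,1,2,\ldots\}$, $\mathbb{R}_+^n=(0,\infty)^n$, $H=\{z\in\mathbb{C}:\operatorname{Im} z>0\}$. For vectors, products $\alpha w=(\alpha_1w_1,\ldots,\alpha_nw_n)$, inverses $\gamma^{-1}=(\gamma_1^{-1},\ldots,\gamma_n^{-1})$ and inequalities $\alpha\le\gamma^{-1}$ are componentwise; $\beta\oplus\gamma=(\beta_1,\ldots,\beta_m,\gamma_1,\ldots,\gamma_n)$ is concatenation. For a multi-index $\eta$, $\eta!=\prod\eta_i!$ and $z^\eta=\prod z_i^{\eta_i}$. A polynomial $P\in\mathbb{C}[z_1,\ldots,z_n]$ is stable if $P(z)\ne0$ for all $z\in H^n$. The complex Laguerre--Pólya class $\mathscr{LP}_n(\mathbb{C})$ is the set of entire functions on $\mathbb{C}^n$ that are uniform limits on compact subsets of $\mathbb{C}^n$ of stable polynomials. A linear operator $T:\mathbb{C}[z_1,\ldots,z_n]\to\mathbb{C}[[z_1,\ldots,z_m]]$ (into formal power series) is a Laguerre--Pólya preserver if $T(\mathscr{LP}_n(\mathbb{C})\cap\mathbb{C}[z_1,\ldots,z_n])\subseteq\mathscr{LP}_m(\mathbb{C})$. Its symbol is the formal power series $G_T(z,w)=\sum_{\eta\in\mathbb{N}^n}T(z^\eta)\frac{w^\eta}{\eta!}$ in $z_1,\ldots,z_m,w_1,\ldots,w_n$. For $\beta\in\mathbb{R}_+^n$, the $\beta$-weighted Bargmann--Fock space $\mathcal{F}_\beta$ is the Hilbert space of entire functions $f(z)=\sum_{\eta\in\mathbb{N}^n}a_\eta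 z^\eta$ with $\|f\|_\beta^2=\sum_\eta\frac{\eta!}{\beta^\eta}|a_\eta|^2<\infty$. Equivalently $\|f\|_\beta^2=\int_{\mathbb{C}^n}|f|^2\,d\sigma_\beta$, where $d\sigma_\beta(z)=\frac{\beta_1\cdots\beta_n}{\pi^n}\exp\left(-\sum_{i=1}^n\beta_i|z_i|^2\right)dm(z)$ and $m$ is Lebesgue measure on $\mathbb{C}^n=\mathbb{R}^{2n}$. Put $\mathscr{LP}_\beta(\mathbb{C})=\mathscr{LP}_n(\mathbb{C})\cap\mathcal{F}_\beta$. In particular $\mathscr{LP}_{\beta\oplus\gamma}(\mathbb{C})=\mathscr{LP}_{m+n}(\mathbb{C})\cap\mathcal{F}_{\beta\oplus\gamma}$ for $\beta\in\mathbb{R}_+^m$, $\gamma\in\mathbb{R}_+^n$, the weights $\beta$ going with the $z$-variables and $\gamma$ with the $w$-variables. *)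

theory Defs
  imports "HOL-Analysis.Analysis" "HOL-Library.Poly_Mapping" "HOL-Library.Function_Algebras"
begin

text \<open>
  Variables are indexed by finite types: \<open>'n\<close> stands for \<open>{1,...,n}\<close>, and the sum type
  \<open>'m + 'n\<close> for the \<open>m + n\<close> variables of a symbol, with \<open>Inl\<close> for the variables \<open>z\<close> and
  \<open>Inr\<close> for the variables \<open>w\<close>. Multi-indices are functions \<open>'n \<Rightarrow> nat\<close>; polynomials and formal
  power series are given by their coefficients.
\<close>

type_synonym 'n mpolynomial = "('n \<Rightarrow> nat) \<Rightarrow>\<^sub>0 complex"
type_synonym 'n mseries = "('n \<Rightarrow> nat) \<Rightarrow> complex"

definition mpow :: "'a::comm_monoid_mult ^ 'n \<Rightarrow> ('n::finite \<Rightarrow> nat) \<Rightarrow> 'a"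
  where "mpow z \<eta> = (\<Prod>i\<in>UNIV. (z $ i) ^ \<eta> i)"

definition mfact :: "('n::finite \<Rightarrow> nat) \<Rightarrow> nat"
  where "mfact \<eta> = (\<Prod>i\<in>UNIV. fact (\<eta> i))"

definition vconcat :: "'a ^ 'm \<Rightarrow> 'a ^ 'n \<Rightarrow> 'a ^ ('m::finite + 'n::finite)"  (infixr "\<oplus>\<^sub>v" 65)
  where "\<beta> \<oplus>\<^sub>v \<gamma> = (\<chi> k. case k of Inl i \<Rightarrow> \<beta> $ i | Inr j \<Rightarrow> \<gamma> $ j)"

definition cvec :: "real ^ 'n \<Rightarrow> complex ^ 'n::finite"
  where "cvec \<alpha> = (\<chi> i. complex_of_real (\<alpha> $ i))"

definition cnj_vec :: "complex ^ 'n \<Rightarrow> complex ^ 'n::finite"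
  where "cnj_vec w = (\<chi> i. cnj (w $ i))"

definition pos_vec :: "real ^ 'n::finite \<Rightarrow> bool"
  where "pos_vec \<alpha> \<longleftrightarrow> (\<forall>i. 0 < \<alpha> $ i)"


definition poly_fun :: "'n::finite mpolynomial \<Rightarrow> complex ^ 'n \<Rightarrow> complex"
  where "poly_fun P z = (\<Sum>\<eta>\<in>Poly_Mapping.keys P. Poly_Mapping.lookup P \<eta> * mpow z \<eta>)"

definition series_fun :: "'n::finite mseries \<Rightarrow> complex ^ 'n \<Rightarrow> complex"
  where "series_fun F z = (\<Sum>\<^sub>\<infinity>\<eta>. F \<eta> * mpow z \<eta>)"

definition power_series_of :: "'n::finite mseries \<Rightarrow> (complex ^ 'n \<Rightarrow> complex) \<Rightarrow> bool"
  where "power_series_of F f \<longleftrightarrow> (\<forall>z. ((\<lambda>\<eta>. F \<eta> * mpow z \<eta>) has_sum f z) UNIV)"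

definition taylor_coeffs :: "(complex ^ 'n::finite \<Rightarrow> complex) \<Rightarrow> 'n mseries"
  where "taylor_coeffs f = (THE a. power_series_of a f)"

text \<open>The formal power series that converge everywhere to a member of a class of functions;
  this makes precise when a formal power series ``belongs to'' such a class.\<close>

definition series_in :: "(complex ^ 'n::finite \<Rightarrow> complex) set \<Rightarrow> 'n mseries set"
  where "series_in S = {F. \<exists>f\<in>S. power_series_of F f}"

text \<open>The formal substitution \<open>F(c\<^sub>1 z\<^sub>1, ..., c\<^sub>n z\<^sub>n)\<close>.\<close>

definition rescale :: "complex ^ 'n \<Rightarrow> 'n::finite mseries \<Rightarrow> 'n mseries"
  where "rescale c F = (\<lambda>\<eta>. F \<eta> * mpow c \<eta>)"

text \<open>Holomorphic functions of several variables in the sense of Osgood: continuous, and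
  holomorphic in each variable separately.\<close>

definition entire :: "(complex ^ 'n::finite \<Rightarrow> complex) \<Rightarrow> bool"
  where "entire f \<longleftrightarrow> continuous_on UNIV f \<and>
    (\<forall>z i. (\<lambda>t. f (\<chi> j. if j = i then t else z $ j)) holomorphic_on UNIV)"


definition stable :: "'n::finite mpolynomial \<Rightarrow> bool"
  where "stable P \<longleftrightarrow> (\<forall>z. (\<forall>i. 0 < Im (z $ i)) \<longrightarrow> poly_fun P z \<noteq> 0)"

definition LP :: "(complex ^ 'n::finite \<Rightarrow> complex) set"
  where "LP = {f. entire f \<and>
    (\<exists>P :: nat \<Rightarrow> 'n mpolynomial. (\<forall>k. stable (P k)) \<and>
      (\<forall>K. compact K \<longrightarrow> uniform_limit K (\<lambda>k. poly_fun (P k)) f sequentially))}"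


definition poly_scale :: "complex \<Rightarrow> 'n mpolynomial \<Rightarrow> 'n mpolynomial"
  where "poly_scale c P = Poly_Mapping.map (\<lambda>x. c * x) P"

definition series_scale :: "complex \<Rightarrow> 'm mseries \<Rightarrow> 'm mseries"
  where "series_scale c F = (\<lambda>\<eta>. c * F \<eta>)"

lemma lookup_poly_scale:
  "Poly_Mapping.lookup (poly_scale c P) \<eta> = c * Poly_Mapping.lookup P \<eta>"
  by (simp add: poly_scale_def Poly_Mapping.map.rep_eq when_def)

interpretation mpoly_vs: vector_space "poly_scale :: complex \<Rightarrow> 'n mpolynomial \<Rightarrow> 'n mpolynomial"
  by unfold_locales
     (auto intro!: poly_mapping_eqI simp: lookup_poly_scale lookup_add algebra_simps)

interpretation mseries_vs: vector_space "series_scale :: complex \<Rightarrow> 'm mseries \<Rightarrow> 'm mseries"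
  by unfold_locales (auto simp: series_scale_def fun_eq_iff algebra_simps)

definition linear_operator :: "('n mpolynomial \<Rightarrow> 'm mseries) \<Rightarrow> bool"
  where "linear_operator T \<longleftrightarrow> Vector_Spaces.linear poly_scale series_scale T"

text \<open>The rank is the dimension of the range, possibly infinite. It is compared with \<open>k\<close> through
  independent subsets, because the library's \<open>dim\<close> is 0 on infinite-dimensional spaces.\<close>

definition rank_at_least :: "nat \<Rightarrow> ('n mpolynomial \<Rightarrow> 'm mseries) \<Rightarrow> bool"
  where "rank_at_least k T \<longleftrightarrow>
    (\<exists>B. B \<subseteq> range T \<and> finite B \<and> card B = k \<and> \<not> module.dependent series_scale B)"

definition LP_preserver :: "('n::finite mpolynomial \<Rightarrow> 'm::finite mseries) \<Rightarrow> bool"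
  where "LP_preserver T \<longleftrightarrow> (\<forall>P. poly_fun P \<in> LP \<longrightarrow> T P \<in> series_in LP)"

text \<open>The coefficient of \<open>z\<^sup>\<kappa> w\<^sup>\<eta>\<close> in \<open>G\<^sub>T(z,w)\<close> is that of \<open>z\<^sup>\<kappa>\<close> in \<open>T(z\<^sup>\<eta>)\<close>, divided by \<open>\<eta>!\<close>.\<close>

definition symbol :: "('n::finite mpolynomial \<Rightarrow> 'm::finite mseries) \<Rightarrow> ('m + 'n) mseries"
  where "symbol T = (\<lambda>\<zeta>. T (Poly_Mapping.single (\<zeta> \<circ> Inr) 1) (\<zeta> \<circ> Inl) / of_nat (mfact (\<zeta> \<circ> Inr)))"


definition fock_term :: "real ^ 'n \<Rightarrow> 'n::finite mseries \<Rightarrow> ('n \<Rightarrow> nat) \<Rightarrow> real"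
  where "fock_term \<beta> a \<eta> = real (mfact \<eta>) / mpow \<beta> \<eta> * (cmod (a \<eta>))\<^sup>2"

definition fock :: "real ^ 'n::finite \<Rightarrow> (complex ^ 'n \<Rightarrow> complex) set"
  where "fock \<beta> = {f. entire f \<and> (\<exists>a. power_series_of a f \<and> fock_term \<beta> a summable_on UNIV)}"

text \<open>Only meaningful on members of \<open>fock \<beta>\<close>.\<close>

definition fock_norm :: "real ^ 'n::finite \<Rightarrow> (complex ^ 'n \<Rightarrow> complex) \<Rightarrow> real"
  where "fock_norm \<beta> f = sqrt (\<Sum>\<^sub>\<infinity>\<eta>. fock_term \<beta> (taylor_coeffs f) \<eta>)"

definition LP_fock :: "real ^ 'n::finite \<Rightarrow> (complex ^ 'n \<Rightarrow> complex) set"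
  where "LP_fock \<beta> = LP \<inter> fock \<beta>"

definition gauss_measure :: "real ^ 'n::finite \<Rightarrow> (complex ^ 'n) measure"
  where "gauss_measure \<beta> = density lborel
    (\<lambda>z. ennreal ((\<Prod>i\<in>UNIV. \<beta> $ i) / pi ^ CARD('n) * exp (- (\<Sum>i\<in>UNIV. \<beta> $ i * (cmod (z $ i))\<^sup>2))))"

definition fock_bounded_linear ::
    "real ^ 'n \<Rightarrow> real ^ 'm \<Rightarrow>
     ((complex ^ 'n::finite \<Rightarrow> complex) \<Rightarrow> (complex ^ 'm::finite \<Rightarrow> complex)) \<Rightarrow> bool"
  where "fock_bounded_linear \<alpha> \<beta> S \<longleftrightarrow>
    (\<forall>f\<in>fock \<alpha>. S f \<in> fock \<beta>) \<and>
    (\<forall>f\<in>fock \<alpha>. \<forall>g\<in>fock \<alpha>. S (\<lambda>w. f w + g w) = (\<lambda>z. S f z + S g z)) \<and>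
    (\<forall>c. \<forall>f\<in>fock \<alpha>. S (\<lambda>w. c * f w) = (\<lambda>z. c * S f z)) \<and>
    (\<exists>C. \<forall>f\<in>fock \<alpha>. fock_norm \<beta> (S f) \<le> C * fock_norm \<alpha> f)"

definition extends_operator ::
    "('n::finite mpolynomial \<Rightarrow> 'm::finite mseries) \<Rightarrow>
     ((complex ^ 'n \<Rightarrow> complex) \<Rightarrow> (complex ^ 'm \<Rightarrow> complex)) \<Rightarrow> bool"
  where "extends_operator T S \<longleftrightarrow> (\<forall>P. power_series_of (T P) (S (poly_fun P)))"

end

theory Submission
  imports Defs "HOL-Computational_Algebra.Fundamental_Theorem_Algebra" "HOL-Complex_Analysis.Complex_Analysis" "HOL-Probability.Distributions" "HOL-Library.Real_Mod"
begin

text \<open>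
  If a bivariate polynomial \<open>R\<close> has no zeros in \<open>H \<times> H\<close>, then neither has \<open>R - c \<partial>\<^sub>v\<partial>\<^sub>w R\<close> for \<open>c > 0\<close>.
  Iterating \<open>(1 - \<partial>\<^sub>v\<partial>\<^sub>w/l)\<^sup>l\<close> and letting \<open>l \<rightarrow> \<infinity>\<close> shows that \<open>P(-\<partial>\<^sub>w) G(z,w)\<close> at \<open>w = 0\<close> is stable or
  zero for stable \<open>P\<close> and \<open>G\<close>. With \<open>G = \<Prod>(1 - z\<^sub>i w\<^sub>i/l)\<^sup>l\<close> this says that the multipliers
  \<open>\<Prod> (l choose \<eta>\<^sub>i) \<eta>\<^sub>i! / l^\<eta>\<^sub>i\<close> turn every Laguerre--Polya function into a stable polynomial or zero. These
  multipliers lie in \<open>[0,1]\<close> and tend to 1, so they approximate a Laguerre--Polya function both locally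
  uniformly and in Fock norm.

  If the symbol is Laguerre--Polya, then \<open>T\<close> preserves the class because \<open>T(P)(z) = P(-\<partial>\<^sub>w) G\<^sub>T(z,-w)\<close> at
  \<open>w = 0\<close>. Conversely, a preserver maps \<open>\<Prod>(1 - x\<^sub>i w\<^sub>i/k)\<^sup>k\<close> to a Laguerre--Polya function for every
  \<open>w \<in> H\<^sup>n\<close>; if the image vanished for some \<open>w\<close>, small perturbations would force the rank to be at most
  one. The resulting stable truncations of \<open>G\<^sub>T(z,-w)\<close> satisfy the univariate Szasz inequality on all
  complex lines spanned by positive vectors, which bounds the homogeneous parts on \<open>[1,2]\<close>-boxes; Lagrange
  interpolation turns this into the coefficient bound \<open>C D^|\<eta>| / sqrt(\<eta>!)\<close>, hence into membership in a
  Fock space. The bounds for the extension are Cauchy--Schwarz estimates on coefficients, and the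
  integral formula is the orthogonality of monomials for the Gaussian measure.
\<close>

text \<open>Zero-freeness passes to limits only up to the identically zero function, so each
  limiting step ends in "stable or zero". Excluding zero is the crux of the converse: a linear space
  whose members are all stable or zero has dimension at most one, because two members can be
  combined to vanish at a prescribed point of the half-plane product. The approximants of a
  Laguerre-Polya function may have unbounded degrees and no common majorant, so they cannot be
  compared termwise. The multipliers cure this: for fixed l they cut every series down to exponents
  at most l, where convergence of coefficients already decides. Positive directions v matter twice:
  t v stays in the half-plane product for Im t > 0, and a homogeneous stable polynomial cannot
  vanish at v, since it would then vanish at i v. The second fact bounds the lowest homogeneous part
  from below on a compact box, which is the normalisation at the origin that Szasz's inequality
  needs.\<close>

no_notation fps_nth (infixl "$" 75)

section \<open>Univariate and bivariate polynomials without zeros in the upper half-plane\<close>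

text \<open>Factors with constant term 1 turn the low coefficients into symmetric functions of the
  \<xi>, and the map from x to -1/x keeps the sign of the imaginary part, so half-plane information
  on the roots carries over to the \<xi>.\<close>

lemma poly_factor_at_zero:
  fixes p :: "complex poly"
  assumes "poly p 0 \<noteq> 0"
  shows "\<exists>B. p = smult (coeff p 0) (\<Prod>\<xi>\<in>#B. [:1, \<xi>:]) \<and>
             (\<forall>\<xi>\<in>#B. \<exists>x. poly p x = 0 \<and> x \<noteq> 0 \<and> \<xi> = - inverse x)"
  using assms
proof (induction "degree p" arbitrary: p)
  case 0
  then obtain a where "p = [:a:]" by (metis degree_eq_zeroE)
  then show ?case by (intro exI[of _ "{#}"]) auto
next
  case (Suc n)
  then have "\<not> constant (poly p)" by (simp add: constant_degree)
  from Fundamental_Theorem_Algebra.fundamental_theorem_of_algebra[OF this] obtain x where x: "poly p x = 0" ..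
  then have x0: "x \<noteq> 0" using Suc.prems by auto
  obtain q where q: "p = [:-x, 1:] * q" using x by (auto simp: poly_eq_0_iff_dvd)
  have q0: "poly q 0 \<noteq> 0" using Suc.prems q by auto
  then have "q \<noteq> 0" by auto
  then have "degree p = Suc (degree q)" unfolding q by (subst degree_mult_eq) auto
  then have "n = degree q" using Suc.hyps by simp
  from Suc.hyps(1)[OF this q0] obtain B where B: "q = smult (coeff q 0) (\<Prod>\<xi>\<in>#B. [:1, \<xi>:])"
    "\<forall>\<xi>\<in>#B. \<exists>x. poly q x = 0 \<and> x \<noteq> 0 \<and> \<xi> = - inverse x" by blast
  have c0: "coeff p 0 = - x * coeff q 0" unfolding q by (simp add: coeff_mult)
  have "[:-x, 1:] = smult (-x) [:1, - inverse x:]" using x0 by simp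
  then have "p = smult (coeff p 0) (\<Prod>\<xi>\<in>#add_mset (- inverse x) B. [:1, \<xi>:])"
    by (subst q, subst B(1)) (simp only: c0 mult_smult_left mult_smult_right smult_smult image_mset_add_mset prod_mset.add_mset ac_simps)
  moreover have "\<forall>\<xi>\<in>#add_mset (- inverse x) B. \<exists>x. poly p x = 0 \<and> x \<noteq> 0 \<and> \<xi> = - inverse x"
    using B(2) x x0 q by auto
  ultimately show ?case by blast
qed

lemma deriv_prod_linear_at_zero:
  "poly (\<Prod>\<xi>\<in>#B. [:1, \<xi>::complex:]) 0 = 1"
  "poly (pderiv (\<Prod>\<xi>\<in>#B. [:1, \<xi>:])) 0 = (\<Sum>\<xi>\<in>#B. \<xi>)"
proof -
  show 0: "poly (\<Prod>\<xi>\<in>#B. [:1, \<xi>::complex:]) 0 = 1" for B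
    by (induction B) auto
  show "poly (pderiv (\<Prod>\<xi>\<in>#B. [:1, \<xi>:])) 0 = (\<Sum>\<xi>\<in>#B. \<xi>)"
    by (induction B) (auto simp: pderiv_mult pderiv_pCons pderiv_add pderiv_smult 0)
qed

lemma Im_neg_inverse: "Im (- inverse x) = Im x / (cmod x)\<^sup>2"
  by (simp add: cmod_power2)

lemma Im_sum_mset: "Im (\<Sum>\<xi>\<in>#B. \<xi>) = (\<Sum>\<xi>\<in>#B. Im \<xi>)"
  by (induction B) auto
text \<open>With u moved to the origin the logarithmic derivative is the sum of all -1/(x - u) over
  the roots x. Roots have Im x \<le> 0 < Im u, so each summand has negative imaginary part; the
  first alternative is the empty sum.\<close>

lemma Im_logderiv:
  fixes p :: "complex poly"
  assumes nz: "\<And>z. Im z > 0 \<Longrightarrow> poly p z \<noteq> 0" and u: "Im u > 0"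
  shows "poly (pderiv p) u = 0 \<or> Im (poly (pderiv p) u / poly p u) < 0"
proof -
  define q where "q = pcompose p [:u, 1:]"
  have q: "poly q t = poly p (u + t)" for t by (simp add: q_def poly_pcompose add.commute)
  have q': "poly (pderiv q) t = poly (pderiv p) (u + t)" for t
    by (simp add: q_def pderiv_pcompose poly_pcompose pderiv_pCons add.commute)
  have q0: "poly q 0 \<noteq> 0" using nz[OF u] by (simp add: q)
  from poly_factor_at_zero[OF q0] obtain B where
    B: "q = smult (coeff q 0) (\<Prod>\<xi>\<in>#B. [:1, \<xi>:])"
    "\<forall>\<xi>\<in>#B. \<exists>x. poly q x = 0 \<and> x \<noteq> 0 \<and> \<xi> = - inverse x" by blast
  have neg: "Im \<xi> < 0" if \<xi>B: "\<xi> \<in># B" for \<xi>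
  proof -
    obtain x where x: "poly q x = 0" "x \<noteq> 0" "\<xi> = - inverse x" using B(2) \<xi>B by blast
    have "\<not> Im (u + x) > 0" using x(1) nz by (auto simp: q)
    then have "Im x < 0" using u by simp
    then show ?thesis using x(2) by (simp only: x(3) Im_neg_inverse) (simp add: divide_neg_pos)
  qed
  have c: "coeff q 0 \<noteq> 0" using q0 by (simp add: poly_0_coeff_0)
  have "poly q 0 = coeff q 0" by (simp add: poly_0_coeff_0)
  moreover have "poly (pderiv q) 0 = coeff q 0 * (\<Sum>\<xi>\<in>#B. \<xi>)"
    by (subst B(1)) (simp add: pderiv_smult deriv_prod_linear_at_zero)
  ultimately have e: "poly (pderiv p) u / poly p u = (\<Sum>\<xi>\<in>#B. \<xi>)"
    using c unfolding q q' by simp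
  have "B = {#} \<or> (\<Sum>\<xi>\<in>#B. Im \<xi>) < 0"
    using neg
  proof (induction B)
    case (add x B)
    then have "Im x < 0" "B = {#} \<or> (\<Sum>\<xi>\<in>#B. Im \<xi>) < 0" by auto
    then show ?case by auto
  qed simp
  then show ?thesis using e nz[OF u]
    by (auto simp: Im_sum_mset[simplified])
qed

section \<open>Szasz's inequality\<close>

text \<open>Rests on |x|^2 = Re (x^2) + 2 (Im x)^2. All imaginary parts have the same sign, so the
  sum of their squares is at most the square of their sum; the second conjunct carries that sign
  through the induction.\<close>

lemma szasz_aux:
  fixes B :: "complex multiset"
  assumes "\<forall>\<xi>\<in>#B. Im \<xi> \<le> 0"
  shows "(\<Sum>\<xi>\<in>#B. (cmod \<xi>)\<^sup>2) \<le> Re ((\<Sum>\<xi>\<in>#B. \<xi>\<^sup>2)) + 2 * (Im (\<Sum>\<xi>\<in>#B. \<xi>))\<^sup>2 \<and> Im (\<Sum>\<xi>\<in>#B. \<xi>) \<le> 0"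
  using assms
proof (induction B)
  case (add x B)
  let ?s = "\<Sum>\<xi>\<in>#B. \<xi>"
  have i: "(\<Sum>\<xi>\<in>#B. (cmod \<xi>)\<^sup>2) \<le> Re ((\<Sum>\<xi>\<in>#B. \<xi>\<^sup>2)) + 2 * (Im ?s)\<^sup>2" "Im ?s \<le> 0" "Im x \<le> 0"
    using add by auto
  have "(cmod x)\<^sup>2 = Re (x\<^sup>2) + 2 * (Im x)\<^sup>2" using cmod_power2[of x] by (simp add: power2_eq_square)
  moreover have "Im x * Im ?s \<ge> 0" using i by (simp add: mult_nonpos_nonpos)
  moreover have "(Im (x + ?s))\<^sup>2 = (Im x)\<^sup>2 + 2 * (Im x * Im ?s) + (Im ?s)\<^sup>2"
    by (simp add: power2_eq_square algebra_simps)
  ultimately have "(cmod x)\<^sup>2 + (\<Sum>\<xi>\<in>#B. (cmod \<xi>)\<^sup>2) \<le> Re (x\<^sup>2 + (\<Sum>\<xi>\<in>#B. \<xi>\<^sup>2)) + 2 * (Im (x + ?s))\<^sup>2"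
    using i(1) by simp
  then show ?case using i by simp
qed simp

text \<open>From |1 + \<zeta>|^2 = 1 + 2 Re \<zeta> + |\<zeta>|^2 \<le> exp (2 Re \<zeta> +
  |\<zeta>|^2). Taking norms only after summation leaves |\<Sum> \<xi>| in the linear term rather
  than \<Sum> |\<xi>|, which three coefficients could not control.\<close>

lemma prod_linear_bound:
  fixes B :: "complex multiset"
  shows "cmod (poly (\<Prod>\<xi>\<in>#B. [:1, \<xi>:]) t) \<le> exp (cmod (\<Sum>\<xi>\<in>#B. \<xi>) * cmod t + (\<Sum>\<xi>\<in>#B. (cmod \<xi>)\<^sup>2) / 2 * (cmod t)\<^sup>2)"
proof -
  have one: "cmod (1 + \<zeta>) \<le> exp (Re \<zeta> + (cmod \<zeta>)\<^sup>2 / 2)" for \<zeta>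
  proof (rule power2_le_imp_le)
    have "(cmod (1 + \<zeta>))\<^sup>2 = 1 + (2 * Re \<zeta> + (cmod \<zeta>)\<^sup>2)"
      unfolding cmod_power2 by (simp add: power2_eq_square algebra_simps)
    also have "\<dots> \<le> exp (2 * Re \<zeta> + (cmod \<zeta>)\<^sup>2)" by (rule exp_ge_add_one_self)
    also have "\<dots> = (exp (Re \<zeta> + (cmod \<zeta>)\<^sup>2 / 2))\<^sup>2"
      by (simp add: exp_double[symmetric] algebra_simps)
    finally show "(cmod (1 + \<zeta>))\<^sup>2 \<le> (exp (Re \<zeta> + (cmod \<zeta>)\<^sup>2 / 2))\<^sup>2" .
  qed simp
  have "cmod (poly (\<Prod>\<xi>\<in>#B. [:1, \<xi>:]) t) \<le> exp (Re ((\<Sum>\<xi>\<in>#B. \<xi>) * t) + (\<Sum>\<xi>\<in>#B. (cmod \<xi>)\<^sup>2) / 2 * (cmod t)\<^sup>2)"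
  proof (induction B)
    case (add x B)
    have "cmod (poly (\<Prod>\<xi>\<in>#add_mset x B. [:1, \<xi>:]) t) = cmod (1 + x * t) * cmod (poly (\<Prod>\<xi>\<in>#B. [:1, \<xi>:]) t)"
      unfolding norm_mult[symmetric] by (simp add: algebra_simps)
    also have "\<dots> \<le> exp (Re (x * t) + (cmod (x * t))\<^sup>2 / 2) *
        exp (Re ((\<Sum>\<xi>\<in>#B. \<xi>) * t) + (\<Sum>\<xi>\<in>#B. (cmod \<xi>)\<^sup>2) / 2 * (cmod t)\<^sup>2)"
      by (intro mult_mono one add) auto
    also have "\<dots> = exp (Re ((\<Sum>\<xi>\<in>#add_mset x B. \<xi>) * t) + (\<Sum>\<xi>\<in>#add_mset x B. (cmod \<xi>)\<^sup>2) / 2 * (cmod t)\<^sup>2)"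
      unfolding exp_add[symmetric] by (simp add: norm_mult power_mult_distrib field_simps)
    finally show ?case .
  qed simp
  also have "\<dots> \<le> exp (cmod (\<Sum>\<xi>\<in>#B. \<xi>) * cmod t + (\<Sum>\<xi>\<in>#B. (cmod \<xi>)\<^sup>2) / 2 * (cmod t)\<^sup>2)"
    using complex_Re_le_cmod[of "(\<Sum>\<xi>\<in>#B. \<xi>) * t"] by (simp add: norm_mult)
  finally show ?thesis .
qed

text \<open>The third identity is Newton's formula for the second power sum.\<close>

lemma coeffs_prod_linear:
  fixes B :: "complex multiset"
  shows "coeff (\<Prod>\<xi>\<in>#B. [:1, \<xi>:]) 0 = 1"
    "coeff (\<Prod>\<xi>\<in>#B. [:1, \<xi>:]) 1 = (\<Sum>\<xi>\<in>#B. \<xi>)"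
    "(\<Sum>\<xi>\<in>#B. \<xi>\<^sup>2) = (\<Sum>\<xi>\<in>#B. \<xi>)\<^sup>2 - 2 * coeff (\<Prod>\<xi>\<in>#B. [:1, \<xi>:]) 2"
proof -
  show 0: "coeff (\<Prod>\<xi>\<in>#B. [:1, \<xi>:]) 0 = 1" for B :: "complex multiset"
    by (induction B) auto
  show 1: "coeff (\<Prod>\<xi>\<in>#B. [:1, \<xi>:]) 1 = (\<Sum>\<xi>\<in>#B. \<xi>)" for B :: "complex multiset"
    by (induction B) (auto simp: 0 coeff_pCons algebra_simps split: nat.splits)
  show "(\<Sum>\<xi>\<in>#B. \<xi>\<^sup>2) = (\<Sum>\<xi>\<in>#B. \<xi>)\<^sup>2 - 2 * coeff (\<Prod>\<xi>\<in>#B. [:1, \<xi>:]) 2"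
  proof (induction B)
    case (add x B)
    have "coeff (\<Prod>\<xi>\<in>#add_mset x B. [:1, \<xi>:]) 2 = coeff (\<Prod>\<xi>\<in>#B. [:1, \<xi>:]) 2 + x * (\<Sum>\<xi>\<in>#B. \<xi>)"
      using 1[of B] by (simp add: numeral_2_eq_2)
    then show ?case using add by (simp add: power2_eq_square algebra_simps)
  qed simp
qed

text \<open>The first three coefficients determine \<Sum> \<xi> and \<Sum> \<xi>^2, and the
  half-plane condition upgrades the latter to a bound on \<Sum> |\<xi>|^2. The degree does not occur
  in the bound, so it survives limits of polynomials.\<close>

lemma szasz:
  fixes p :: "complex poly"
  assumes nz: "\<And>z. Im z > 0 \<Longrightarrow> poly p z \<noteq> 0" and c0: "c \<le> cmod (coeff p 0)" "0 < c"
    and b: "cmod (coeff p 0) \<le> b" "cmod (coeff p 1) \<le> b" "cmod (coeff p 2) \<le> b"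
  shows "cmod (poly p t) \<le> b * exp (b / c * cmod t + (3/2 * (b / c)\<^sup>2 + b / c) * (cmod t)\<^sup>2)"
proof -
  have p0: "poly p 0 \<noteq> 0" using c0 by (auto simp: poly_0_coeff_0)
  from poly_factor_at_zero[OF p0] obtain B where
    B: "p = smult (coeff p 0) (\<Prod>\<xi>\<in>#B. [:1, \<xi>:])"
    "\<forall>\<xi>\<in>#B. \<exists>x. poly p x = 0 \<and> x \<noteq> 0 \<and> \<xi> = - inverse x" by blast
  define q where "q = (\<Prod>\<xi>\<in>#B. [:1, \<xi>:])"
  define s where "s = (\<Sum>\<xi>\<in>#B. \<xi>)"
  define a where "a = coeff p 0"
  have pq: "p = smult a q" using B(1) by (simp add: q_def a_def)
  have neg: "\<forall>\<xi>\<in>#B. Im \<xi> \<le> 0"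
  proof
    fix \<xi> assume "\<xi> \<in># B"
    then obtain x where x: "poly p x = 0" "x \<noteq> 0" "\<xi> = - inverse x" using B(2) by blast
    have "Im x \<le> 0" using x(1) nz by (meson not_le)
    then show "Im \<xi> \<le> 0" using x(2) by (simp only: x(3) Im_neg_inverse) (simp add: divide_nonpos_pos)
  qed
  have ca: "c \<le> cmod a" using c0 by (simp add: a_def)
  have a0: "a \<noteq> 0" using ca c0 by auto
  have bc: "cmod x / cmod a \<le> b / c" if "cmod x \<le> b" for x
    using that ca c0 by (intro frac_le) (auto intro: order_trans[of _ "cmod x"])
  have "coeff p 1 = a * s" by (subst pq) (simp only: coeff_smult q_def s_def coeffs_prod_linear)
  then have s: "cmod s \<le> b / c" using bc[OF b(2)] a0 by (simp add: norm_mult)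
  have "coeff p 2 = a * coeff q 2" by (subst pq) simp
  then have q2: "cmod (coeff q 2) \<le> b / c" using bc[OF b(3)] a0 by (simp add: norm_mult)
  have "(\<Sum>\<xi>\<in>#B. (cmod \<xi>)\<^sup>2) \<le> Re (s\<^sup>2 - 2 * coeff q 2) + 2 * (Im s)\<^sup>2"
    using szasz_aux[OF neg] coeffs_prod_linear(3)[of B] by (simp add: s_def q_def)
  also have "\<dots> \<le> cmod (s\<^sup>2 - 2 * coeff q 2) + 2 * (cmod s)\<^sup>2"
    using power_mono[OF abs_Im_le_cmod[of s], of 2] by (intro add_mono mult_left_mono complex_Re_le_cmod) auto
  also have "\<dots> \<le> (cmod s)\<^sup>2 + 2 * cmod (coeff q 2) + 2 * (cmod s)\<^sup>2"
    using norm_triangle_ineq4[of "s\<^sup>2" "2 * coeff q 2"] by (simp add: norm_mult norm_power)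
  also have "\<dots> \<le> 3 * (b/c)\<^sup>2 + 2 * (b/c)"
    using power_mono[OF s norm_ge_zero, of 2] q2 by linarith
  finally have sq: "(\<Sum>\<xi>\<in>#B. (cmod \<xi>)\<^sup>2) / 2 \<le> 3/2 * (b / c)\<^sup>2 + b / c" by argo
  have "cmod (poly p t) = cmod a * cmod (poly q t)" by (subst pq) (simp add: norm_mult)
  also have "\<dots> \<le> b * exp (cmod s * cmod t + (\<Sum>\<xi>\<in>#B. (cmod \<xi>)\<^sup>2) / 2 * (cmod t)\<^sup>2)"
    using prod_linear_bound[of B t] b(1) by (intro mult_mono) (auto simp: a_def q_def s_def order_trans[OF norm_ge_zero b(1)])
  also have "\<dots> \<le> b * exp (b / c * cmod t + (3/2 * (b / c)\<^sup>2 + b / c) * (cmod t)\<^sup>2)"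
    using s sq order_trans[OF norm_ge_zero b(1)]
    by (intro mult_left_mono iffD2[OF exp_le_cancel_iff] add_mono mult_right_mono) simp_all
  finally show ?thesis .
qed

text \<open>
  Bivariate polynomials are lists of monomials (coefficient, exponent of \<open>v\<close>, exponent of \<open>w\<close>);
  \<open>biv_step c\<close> is the operator \<open>1 - c \<partial>\<^sub>v\<partial>\<^sub>w\<close>.
\<close>

definition biv :: "(complex \<times> nat \<times> nat) list \<Rightarrow> complex \<Rightarrow> complex \<Rightarrow> complex" where
  "biv L v w = (\<Sum>(k,a,b)\<leftarrow>L. k * v ^ a * w ^ b)"

definition biv_step :: "complex \<Rightarrow> (complex \<times> nat \<times> nat) list \<Rightarrow> (complex \<times> nat \<times> nat) list" where
  "biv_step c L = L @ map (\<lambda>(k,a,b). (- c * k * of_nat a * of_nat b, a - 1, b - 1)) L"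

text \<open>Sections as univariate polynomials, so that \<open>Im_logderiv\<close> applies; the
  companion \<open>biv_poly2\<close> does the same in v for R + t \<partial>R/\<partial>w.\<close>

lemma biv_poly1: "\<exists>p. (\<forall>w. poly p w = biv L v w) \<and>
    (\<forall>w. poly (pderiv p) w = (\<Sum>(k,a,b)\<leftarrow>L. k * of_nat b * v ^ a * w ^ (b - 1)))"
proof (induction L)
  case (Cons x L)
  obtain k a b where x: "x = (k,a,b)" by (cases x)
  obtain p where p: "\<forall>w. poly p w = biv L v w" "\<forall>w. poly (pderiv p) w = (\<Sum>(k,a,b)\<leftarrow>L. k * of_nat b * v ^ a * w ^ (b - 1))"
    using Cons by blast
  show ?case
    by (rule exI[of _ "monom (k * v ^ a) b + p"])
      (use p in \<open>auto simp: x biv_def poly_monom pderiv_add pderiv_monom mult_ac\<close>)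
qed (auto simp: biv_def intro: exI[of _ 0])

lemma biv_poly2: "\<exists>p. (\<forall>v. poly p v = biv L v w + t * (\<Sum>(k,a,b)\<leftarrow>L. k * of_nat b * v ^ a * w ^ (b - 1))) \<and>
    (\<forall>v. poly (pderiv p) v = (\<Sum>(k,a,b)\<leftarrow>L. k * of_nat a * v ^ (a - 1) * w ^ b) +
        t * (\<Sum>(k,a,b)\<leftarrow>L. k * of_nat a * of_nat b * v ^ (a - 1) * w ^ (b - 1)))"
proof (induction L)
  case (Cons x L)
  obtain k a b where x: "x = (k,a,b)" by (cases x)
  obtain p where p: "\<forall>v. poly p v = biv L v w + t * (\<Sum>(k,a,b)\<leftarrow>L. k * of_nat b * v ^ a * w ^ (b - 1))"
    "\<forall>v. poly (pderiv p) v = (\<Sum>(k,a,b)\<leftarrow>L. k * of_nat a * v ^ (a - 1) * w ^ b) +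
        t * (\<Sum>(k,a,b)\<leftarrow>L. k * of_nat a * of_nat b * v ^ (a - 1) * w ^ (b - 1))"
    using Cons by blast
  show ?case
    by (rule exI[of _ "monom (k * w ^ b + t * k * of_nat b * w ^ (b - 1)) a + p"])
      (use p in \<open>auto simp: x biv_def poly_monom pderiv_add pderiv_monom algebra_simps\<close>)
qed (auto simp: biv_def intro: exI[of _ 0])

text \<open>As s grows, the quotient tends to r / b, which has positive imaginary part when Im b <
  0; for b = 0 its imaginary part grows linearly in s.\<close>

lemma moebius_contradiction:
  assumes r: "(r::real) > 0" and b: "b = 0 \<or> Im b < 0"
    and le: "\<And>s::real. (s::real) > 0 \<Longrightarrow> Im ((a + of_real s * \<i> * of_real r) / (1 + of_real s * \<i> * b)) \<le> 0"
  shows False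
proof (cases "b = 0")
  case True
  have "Im a + s * r \<le> 0" if "s > 0" for s using le[OF that] True by simp
  from this[of "(\<bar>Im a\<bar> + 1) / r"] r show False by (simp split: if_splits)
next
  case False
  then have b: "Im b < 0" using b by simp
  \<comment> \<open>The substitution e = 1/s turns the limit at infinity into continuity at 0, where
    the denominator is \<i> b \<noteq> 0.\<close>
  have lim: "((\<lambda>e::real. Im ((of_real e * a + \<i> * r) / (of_real e + \<i> * b))) \<longlongrightarrow> Im ((of_real 0 * a + \<i> * r) / (of_real 0 + \<i> * b))) (at_right 0)"
    by (intro tendsto_intros) (use False in auto)
  have ev: "\<forall>\<^sub>F e::real in at_right 0. Im ((of_real e * a + \<i> * r) / (of_real e + \<i> * b)) \<le> 0"
  proof -
    have "Im ((of_real e * a + \<i> * r) / (of_real e + \<i> * b)) \<le> 0" if "e > 0" for e :: real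
    proof -
      have "(of_real e * a + \<i> * r) = of_real e * (a + of_real (inverse e) * \<i> * r)"
        "(of_real e + \<i> * b) = of_real e * (1 + of_real (inverse e) * \<i> * b)"
        using that by (simp_all add: field_simps)
      then have "(of_real e * a + \<i> * r) / (of_real e + \<i> * b) = (a + of_real (inverse e) * \<i> * r) / (1 + of_real (inverse e) * \<i> * b)"
        using that by simp
      then show ?thesis using le[of "inverse e"] that by simp
    qed
    then show ?thesis by (auto simp: eventually_at_filter)
  qed
  have "Im ((of_real 0 * a + \<i> * r) / (of_real 0 + \<i> * b)) \<le> 0"
    by (rule tendsto_upperbound[OF lim ev]) simp
  moreover have "(of_real 0 * a + \<i> * r) / (of_real 0 + \<i> * b) = r / b" using False by (simp add: field_simps)
  moreover have "Im (r / b) = - r * Im b / (cmod b)\<^sup>2" by (simp add: Im_divide cmod_power2)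
  moreover have "- r * Im b / (cmod b)\<^sup>2 > 0" using r b False by (intro divide_pos_pos) (auto simp: mult_pos_neg)
  ultimately show False by simp
qed

text \<open>
  For \<open>Im t > 0\<close> also \<open>R + t \<partial>\<^sub>w R\<close> is zero-free, so its logarithmic derivative in \<open>v\<close> has
  nonpositive imaginary part. As a function of \<open>t\<close> this is a Moebius transformation, whose behaviour
  at \<open>t = i\<infinity>\<close> excludes \<open>R = c \<partial>\<^sub>v\<partial>\<^sub>w R\<close>.
\<close>

lemma biv_step_nonzero:
  assumes nz: "\<And>v w. Im v > 0 \<Longrightarrow> Im w > 0 \<Longrightarrow> biv L v w \<noteq> 0" and c: "(c::real) > 0"
    and vw: "Im v > 0" "Im w > 0"
  shows "biv (biv_step (of_real c) L) v w \<noteq> 0"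
proof
  assume z: "biv (biv_step (of_real c) L) v w = 0"
  define Rw where "Rw v = (\<Sum>(k,a,b)\<leftarrow>L. k * of_nat b * v ^ a * w ^ (b - 1))" for v
  define Rv where "Rv = (\<Sum>(k,a,b)\<leftarrow>L. k * of_nat a * v ^ (a - 1) * w ^ b)"
  define Rvw where "Rvw = (\<Sum>(k,a,b)\<leftarrow>L. k * of_nat a * of_nat b * v ^ (a - 1) * w ^ (b - 1))"
  have "biv (biv_step (of_real c) L) v w = biv L v w - c * Rvw"
    unfolding biv_def biv_step_def Rvw_def
    by (induction L) (auto simp: algebra_simps)
  with z have R: "biv L v w = c * Rvw" by simp
  have b: "Rw v = 0 \<or> Im (Rw v / biv L v w) < 0" if v: "Im v > 0" for v
  proof -
    obtain p where p: "\<forall>w. poly p w = biv L v w" "\<forall>w. poly (pderiv p) w = (\<Sum>(k,a,b)\<leftarrow>L. k * of_nat b * v ^ a * w ^ (b - 1))"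
      using biv_poly1 by blast
    show ?thesis using Im_logderiv[of p w] p nz v vw by (auto simp: Rw_def)
  qed
  have R0: "biv L v w \<noteq> 0" using nz vw by blast
  define \<beta> where "\<beta> = Rw v / biv L v w"
  define \<alpha> where "\<alpha> = Rv / biv L v w"
  \<comment> \<open>Logarithmic derivative in v of R + t \<partial>R/\<partial>w with t = \<i> s.
    The constant 1/c is the quotient of the mixed derivative by R under the assumption that the new
    polynomial vanishes.\<close>
  have "Im ((\<alpha> + s * \<i> * of_real (1 / c)) / (1 + s * \<i> * \<beta>)) \<le> 0" if s: "s > 0" for s :: real
  proof -
    obtain p where p: "\<And>v. poly p v = biv L v w + s * \<i> * Rw v"
      "\<And>v'. poly (pderiv p) v' = (\<Sum>(k,a,b)\<leftarrow>L. k * of_nat a * v' ^ (a - 1) * w ^ b) + s * \<i> *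
         (\<Sum>(k,a,b)\<leftarrow>L. k * of_nat a * of_nat b * v' ^ (a - 1) * w ^ (b - 1))"
      using biv_poly2[of L w "s * \<i>"] unfolding Rw_def by blast
    have pv: "poly (pderiv p) v = Rv + s * \<i> * Rvw" by (simp add: p(2) Rv_def Rvw_def)
    \<comment> \<open>A zero would make the w-logarithmic derivative equal to -1/t = \<i>/s,
      contrary to the sign of its imaginary part.\<close>
    have "poly p v \<noteq> 0" if v: "Im v > 0" for v
    proof
      assume "poly p v = 0"
      then have e: "biv L v w + s * \<i> * Rw v = 0" by (simp add: p)
      have nz': "biv L v w \<noteq> 0" using nz v vw by blast
      then have "Rw v \<noteq> 0" using e by auto
      then have i: "Im (Rw v / biv L v w) < 0" using b[OF v] by blast
      have "1 + s * \<i> * (Rw v / biv L v w) = 0" using e nz' by (simp add: field_simps)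
      then have "Re (1 + s * \<i> * (Rw v / biv L v w)) = 0" by simp
      moreover have "Re (1 + s * \<i> * Z) = 1 - s * Im Z" for Z by simp
      ultimately have "1 - s * Im (Rw v / biv L v w) = 0" by metis
      moreover have "s * Im (Rw v / biv L v w) < 0" using s i by (simp add: mult_pos_neg)
      ultimately show False by linarith
    qed
    from Im_logderiv[OF this vw(1)] have "Im (poly (pderiv p) v / poly p v) \<le> 0" by auto
    moreover have "poly (pderiv p) v / poly p v = (\<alpha> + s * \<i> * of_real (1 / c)) / (1 + s * \<i> * \<beta>)"
    proof -
      have "Rv + s * \<i> * Rvw = biv L v w * (\<alpha> + s * \<i> * of_real (1 / c))"
        using R R0 c by (simp add: \<alpha>_def field_simps)
      moreover have "biv L v w + s * \<i> * Rw v = biv L v w * (1 + s * \<i> * \<beta>)"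
        using R0 by (simp add: \<beta>_def field_simps)
      ultimately show ?thesis using R0 by (simp add: pv p(1))
    qed
    ultimately show ?thesis by simp
  qed
  moreover have "\<beta> = 0 \<or> Im \<beta> < 0" using b[OF vw(1)] by (auto simp: \<beta>_def)
  ultimately show False using c by (intro moebius_contradiction[of "1/c" \<beta> \<alpha>]) auto
qed

text \<open>
  The value of \<open>(1 - c \<partial>\<^sub>v\<partial>\<^sub>w)\<^sup>s v\<^sup>a w\<^sup>b\<close> at \<open>v = w = x\<close>. For \<open>s = l\<close>, \<open>c = 1/l\<close>, \<open>x = i/l\<close> it tends to
  \<open>exp (- \<partial>\<^sub>v\<partial>\<^sub>w) v\<^sup>a w\<^sup>b\<close> at the origin.
\<close>

primrec pairing :: "complex \<Rightarrow> complex \<Rightarrow> nat \<Rightarrow> nat \<Rightarrow> nat \<Rightarrow> complex" where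
  "pairing c x 0 a b = x ^ a * x ^ b"
| "pairing c x (Suc s) a b = pairing c x s a b - c * of_nat a * of_nat b * pairing c x s (a - 1) (b - 1)"

lemma pairing_list_nonzero:
  assumes nz: "\<And>v w. Im v > 0 \<Longrightarrow> Im w > 0 \<Longrightarrow> biv L v w \<noteq> 0" and c: "(c::real) > 0" and x: "Im x > 0"
  shows "(\<Sum>(k,a,b)\<leftarrow>L. k * pairing (of_real c) x s a b) \<noteq> 0"
  using nz
proof (induction s arbitrary: L)
  case 0
  from 0[OF x x] show ?case by (simp add: biv_def mult_ac)
next
  case (Suc s)
  have "(\<Sum>(k,a,b)\<leftarrow>L. k * pairing (of_real c) x (Suc s) a b) = (\<Sum>(k,a,b)\<leftarrow>biv_step (of_real c) L. k * pairing (of_real c) x s a b)"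
    unfolding biv_step_def by (induction L) (auto simp: algebra_simps)
  moreover have "(\<Sum>(k,a,b)\<leftarrow>biv_step (of_real c) L. k * pairing (of_real c) x s a b) \<noteq> 0"
    by (intro Suc.IH biv_step_nonzero Suc.prems c)
  ultimately show ?case by simp
qed

lemma pairing_nonzero:
  assumes "finite X" and nz: "\<And>v w. Im v > 0 \<Longrightarrow> Im w > 0 \<Longrightarrow> (\<Sum>y\<in>X. k y * v ^ a y * w ^ b y) \<noteq> 0"
    and c: "(c::real) > 0" and x: "Im x > 0"
  shows "(\<Sum>y\<in>X. k y * pairing (of_real c) x s (a y) (b y)) \<noteq> 0"
proof -
  obtain ys where ys: "set ys = X" "distinct ys" using finite_distinct_list[OF assms(1)] by blast
  define L where "L = map (\<lambda>y. (k y, a y, b y)) ys"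
  have e: "(\<Sum>(k,a,b)\<leftarrow>L. F k a b) = (\<Sum>y\<in>X. F (k y) (a y) (b y))" for F :: "_ \<Rightarrow> _ \<Rightarrow> _ \<Rightarrow> complex"
    unfolding L_def using sum_list_distinct_conv_sum_set[OF ys(2), of "\<lambda>y. F (k y) (a y) (b y)"]
    by (simp add: ys(1) o_def)
  have "biv L v w \<noteq> 0" if "Im v > 0" "Im w > 0" for v w
    using nz[OF that] by (simp add: biv_def e)
  from pairing_list_nonzero[OF this c x] show ?thesis by (simp add: e)
qed

text \<open>Binomial expansion of the s-th power of
  \<open>1 - c \<partial>\<^sub>v\<partial>\<^sub>w\<close>; the j-th derivative of v^a is j! (a
  choose j) v^(a-j). The number of terms depends on a and not on s, so the limit can be taken
  termwise.\<close>

lemma pairing_closed: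
  "pairing c x s a b = (\<Sum>j\<le>a. of_nat (s choose j) * (- c) ^ j * of_nat (a choose j) * of_nat (b choose j) * (fact j)\<^sup>2
      * x ^ (a - j) * x ^ (b - j))"
proof (induction s arbitrary: a b)
  case 0
  have "(\<Sum>j\<le>a. of_nat (0 choose j) * (- c) ^ j * of_nat (a choose j) * of_nat (b choose j) * (fact j)\<^sup>2
      * x ^ (a - j) * x ^ (b - j)) = (\<Sum>j\<in>{0}. of_nat (0 choose j) * (- c) ^ j * of_nat (a choose j) * of_nat (b choose j) * (fact j)\<^sup>2
      * x ^ (a - j) * x ^ (b - j))"
    by (rule sum.mono_neutral_right) auto
  then show ?case by simp
next
  case (Suc s)
  define t where "t s j a b = of_nat (s choose j) * (- c) ^ j * of_nat (a choose j) * of_nat (b choose j) * (fact j)\<^sup>2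
      * x ^ (a - j) * x ^ (b - j)" for s j a b
  have IH: "pairing c x s a b = (\<Sum>j\<le>a. t s j a b)" for a b using Suc by (simp add: t_def)
  show ?case
  proof (cases "a = 0 \<or> b = 0")
    case True
    have "t (Suc s) j a b = t s j a b" for j
      using True by (cases j) (auto simp: t_def)
    moreover have "pairing c x (Suc s) a b = pairing c x s a b" using True by auto
    ultimately show ?thesis by (simp only: IH t_def)
  next
    case False
    then obtain a' b' where ab: "a = Suc a'" "b = Suc b'" by (metis not0_implies_Suc)
    \<comment> \<open>Pascal's rule in s isolates the difference, and (j+1) (a'+1 choose j+1) =
      (a'+1) (a' choose j) absorbs the derivative factors.\<close>
    have step: "t (Suc s) (Suc j) a b = t s (Suc j) a b - c * of_nat a * of_nat b * t s j a' b'" for j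
    proof -
      have 1: "of_nat (Suc j) * of_nat (Suc a' choose Suc j) = (of_nat (Suc a') * of_nat (a' choose j) :: complex)" for a'
        unfolding of_nat_mult[symmetric] by (simp only: Suc_times_binomial)
      have f: "(fact (Suc j) :: complex)\<^sup>2 = of_nat (Suc j) * of_nat (Suc j) * (fact j)\<^sup>2"
        by (simp add: power2_eq_square algebra_simps)
      define X where "X = of_nat (s choose j) * (- c) ^ j * (fact j)\<^sup>2 * x ^ (a' - j) * x ^ (b' - j)"
      have "t (Suc s) (Suc j) a b - t s (Suc j) a b = of_nat (s choose j) * (- c) ^ Suc j * of_nat (a choose Suc j) * of_nat (b choose Suc j) * (fact (Suc j))\<^sup>2
          * x ^ (a - Suc j) * x ^ (b - Suc j)"
        unfolding t_def binomial_Suc_Suc[of s] of_nat_add by (simp only: algebra_simps)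
      also have "\<dots> = - c * (of_nat (Suc j) * of_nat (Suc a' choose Suc j)) * (of_nat (Suc j) * of_nat (Suc b' choose Suc j)) * X"
        unfolding f ab X_def by (simp only: power_Suc diff_Suc_Suc mult_ac)
      also have "\<dots> = - c * of_nat a * of_nat b * t s j a' b'"
        unfolding 1 t_def ab X_def by (simp only: mult_ac)
      finally show ?thesis by (simp add: algebra_simps)
    qed
    have "(\<Sum>j\<le>a. t (Suc s) j a b) = t (Suc s) 0 a b + (\<Sum>j\<le>a'. t (Suc s) (Suc j) a b)"
      unfolding ab by (rule sum.atMost_Suc_shift)
    also have "t (Suc s) 0 a b = t s 0 a b" by (simp add: t_def)
    also have "(\<Sum>j\<le>a'. t (Suc s) (Suc j) a b) = (\<Sum>j\<le>a'. t s (Suc j) a b) - c * of_nat a * of_nat b * (\<Sum>j\<le>a'. t s j a' b')"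
      by (simp add: step sum_subtractf sum_distrib_left)
    also have "t s 0 a b + ((\<Sum>j\<le>a'. t s (Suc j) a b) - c * of_nat a * of_nat b * (\<Sum>j\<le>a'. t s j a' b'))
       = (\<Sum>j\<le>a. t s j a b) - c * of_nat a * of_nat b * (\<Sum>j\<le>a'. t s j a' b')"
      unfolding ab by (simp only: sum.atMost_Suc_shift[of _ a']) simp
    finally show ?thesis by (simp add: IH ab t_def)
  qed
qed

section \<open>Jensen multipliers in one variable\<close>

text \<open>Equals l (l-1) ... (l-j+1) / l^j for l > 0: the j-th coefficient of (1 + x/l)^l divided
  by that of exp x.\<close>

definition mult1 :: "nat \<Rightarrow> nat \<Rightarrow> real" where
  "mult1 l j = real (l choose j) * fact j / real l ^ j"

lemma mult1_prod: "l > 0 \<Longrightarrow> j \<le> l \<Longrightarrow> mult1 l j = (\<Prod>i<j. 1 - real i / real l)"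
proof -
  assume l: "l > 0" "j \<le> l"
  have "real (l choose j) * fact j = (\<Prod>i<j. real l - real i)"
    by (simp add: binomial_gbinomial gbinomial_prod_rev atLeast0LessThan)
  then have "mult1 l j = (\<Prod>i<j. (real l - real i) / real l)"
    by (simp add: mult1_def prod_dividef)
  also have "\<dots> = (\<Prod>i<j. 1 - real i / real l)" using l by (intro prod.cong) (auto simp: field_simps)
  finally show ?thesis .
qed

lemma mult1_range: "0 \<le> mult1 l j" "mult1 l j \<le> 1"
proof -
  show "0 \<le> mult1 l j" by (simp add: mult1_def)
  show "mult1 l j \<le> 1"
  proof (cases "j \<le> l \<and> l > 0")
    case True
    then show ?thesis
      by (subst mult1_prod) (auto intro!: prod_le_1 simp: field_simps)
  next
    case False
    then show ?thesis by (cases "j \<le> l") (auto simp: mult1_def binomial_eq_0)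
  qed
qed

lemma mult1_pos: "j \<le> l \<Longrightarrow> mult1 l j > 0"
  by (cases "l = 0") (auto simp: mult1_def intro!: divide_pos_pos)

lemma mult1_eq_0: "j > l \<Longrightarrow> mult1 l j = 0"
  by (simp add: mult1_def)

lemma mult1_tendsto: "(\<lambda>l. mult1 l j) \<longlonglongrightarrow> 1"
proof -
  have "(\<lambda>l. \<Prod>i<j. 1 - real i / real l) \<longlonglongrightarrow> (\<Prod>i<j. 1 - 0)"
    by (intro tendsto_intros tendsto_divide_0[OF tendsto_const] filterlim_at_top_imp_at_infinity filterlim_real_sequentially)
  moreover have "\<forall>\<^sub>F l in sequentially. (\<Prod>i<j. 1 - real i / real l) = mult1 l j"
    using eventually_ge_at_top[of "Suc j"] by eventually_elim (auto simp: mult1_prod)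
  ultimately show ?thesis by (simp add: filterlim_cong)
qed

text \<open>The binomial weights combine to \<open>mult1 l j\<close> and tend to 1. The evaluation
  point has to stay in the open half-plane, but it tends to 0, so only the term j = a = b
  survives.\<close>

lemma pairing_tendsto:
  "(\<lambda>l. pairing (of_real (1 / real l)) (\<i> / of_nat l) l a b) \<longlonglongrightarrow> (if a = b then (- 1) ^ a * fact a else 0)"
proof -
  have e: "pairing (of_real (1 / real l)) (\<i> / of_nat l) l a b =
      (\<Sum>j\<le>a. of_real (mult1 l j) * (-1) ^ j * of_nat (a choose j) * of_nat (b choose j) * fact j
      * (\<i> / of_nat l) ^ (a - j) * (\<i> / of_nat l) ^ (b - j))" for l
    unfolding pairing_closed mult1_def
    by (intro sum.cong refl) (simp add: power_divide power_minus[of "1 / of_nat l"] power2_eq_square)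
  have z: "(\<lambda>l. \<i> / of_nat l) \<longlonglongrightarrow> 0"
    by (intro tendsto_divide_0[OF tendsto_const] filterlim_at_infinity_imp_norm_at_top tendsto_of_nat)
  have zp: "(\<lambda>l. (\<i> / of_nat l) ^ n) \<longlonglongrightarrow> 0 ^ n" for n
    by (intro tendsto_intros z)
  have "(\<lambda>l. \<Sum>j\<le>a. of_real (mult1 l j) * (-1) ^ j * of_nat (a choose j) * of_nat (b choose j) * fact j
      * (\<i> / of_nat l) ^ (a - j) * (\<i> / of_nat l) ^ (b - j)) \<longlonglongrightarrow>
     (\<Sum>j\<le>a. of_real 1 * (-1) ^ j * of_nat (a choose j) * of_nat (b choose j) * fact j * 0 ^ (a - j) * 0 ^ (b - j))"
    by (intro tendsto_intros mult1_tendsto zp)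
  also have "(\<Sum>j\<le>a. of_real 1 * (-1) ^ j * of_nat (a choose j) * of_nat (b choose j) * fact j * 0 ^ (a - j) * 0 ^ (b - j))
    = (\<Sum>j\<in>{a}. of_real 1 * (-1) ^ j * of_nat (a choose j) * of_nat (b choose j) * fact j * 0 ^ (a - j) * 0 ^ (b - j) :: complex)"
    by (rule sum.mono_neutral_right) auto
  also have "\<dots> = (if a = b then (- 1) ^ a * fact a else 0)"
    by (auto simp: power_0_left)
  finally show ?thesis unfolding e .
qed

section \<open>Everywhere convergent power series\<close>

definition mdeg :: "('n::finite \<Rightarrow> nat) \<Rightarrow> nat" where "mdeg \<eta> = (\<Sum>i\<in>UNIV. \<eta> i)"

lemma norm_mpow: "norm (mpow z \<eta>) = (\<Prod>i\<in>UNIV. cmod (z $ i) ^ \<eta> i)"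
  unfolding mpow_def by (simp add: prod_norm[symmetric] norm_power)

lemma norm_mpow_le:
  assumes "\<And>i. cmod (z $ i) \<le> R"
  shows "norm (mpow z \<eta>) \<le> R ^ mdeg \<eta>"
  unfolding norm_mpow mdeg_def power_sum by (intro prod_mono) (auto intro: power_mono assms)

lemma cmod_nth_le: "cmod (z $ i) \<le> norm z" for z :: "complex ^ 'n::finite"
  by (rule Finite_Cartesian_Product.norm_nth_le)

lemma norm_mpow_norm:
  fixes z :: "complex ^ 'n::finite"
  assumes "norm z \<le> R"
  shows "norm (mpow z \<eta>) \<le> R ^ mdeg \<eta>"
proof (rule norm_mpow_le)
  show "cmod (z $ i) \<le> R" for i using cmod_nth_le[of z i] assms by linarith
qed

lemma has_sum_finite_sum:
  fixes f :: "'i \<Rightarrow> 'a \<Rightarrow> 'b::topological_comm_monoid_add"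
  assumes "finite J" "\<And>j. j \<in> J \<Longrightarrow> (f j has_sum s j) A"
  shows "((\<lambda>x. \<Sum>j\<in>J. f j x) has_sum (\<Sum>j\<in>J. s j)) A"
  using assms by (induction J rule: finite_induct) (auto intro: has_sum_add)

lemma norm_mpow_const: "R \<ge> 0 \<Longrightarrow> norm (mpow (\<chi> i. complex_of_real R) \<eta>) = R ^ mdeg \<eta>"
  by (simp add: norm_mpow mdeg_def power_sum)

text \<open>A criterion on the absolute values of the coefficients alone, hence stable under
  multipliers of modulus at most 1. Equal radii in all variables suffice because the radius is
  arbitrary.\<close>

definition abs_entire :: "'n::finite mseries \<Rightarrow> bool" where
  "abs_entire a \<longleftrightarrow> (\<forall>R\<ge>0. (\<lambda>\<eta>. cmod (a \<eta>) * R ^ mdeg \<eta>) summable_on UNIV)"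

lemma abs_entireD: "abs_entire a \<Longrightarrow> R \<ge> 0 \<Longrightarrow> (\<lambda>\<eta>. cmod (a \<eta>) * R ^ mdeg \<eta>) summable_on UNIV"
  by (simp add: abs_entire_def)

text \<open>\<open>has_sum\<close> is unconditional summation, which for complex families means
  absolute summation; the point (R, ..., R) dominates the polydisc.\<close>

lemma power_series_imp_abs_entire:
  assumes "power_series_of a f"
  shows "abs_entire a"
  unfolding abs_entire_def
proof safe
  fix R :: real assume R: "R \<ge> 0"
  have "(\<lambda>\<eta>. a \<eta> * mpow (\<chi> i. complex_of_real R) \<eta>) summable_on UNIV"
    using assms unfolding power_series_of_def by (blast intro: has_sum_imp_summable)
  then have "(\<lambda>\<eta>. norm (a \<eta> * mpow (\<chi> i. complex_of_real R) \<eta>)) summable_on UNIV"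
    by (simp only: summable_on_iff_abs_summable_on_complex)
  then show "(\<lambda>\<eta>. cmod (a \<eta>) * R ^ mdeg \<eta>) summable_on UNIV"
    by (simp add: norm_mult norm_mpow_const R)
qed

lemma abs_entire_mono:
  assumes "abs_entire a" and "\<And>\<eta>. cmod (b \<eta>) \<le> cmod (a \<eta>)"
  shows "abs_entire b"
  unfolding abs_entire_def
proof safe
  fix R :: real assume R: "R \<ge> 0"
  show "(\<lambda>\<eta>. cmod (b \<eta>) * R ^ mdeg \<eta>) summable_on UNIV"
    by (rule summable_on_comparison_test[OF abs_entireD[OF assms(1) R]])
      (use R assms(2) in \<open>auto intro: mult_right_mono\<close>)
qed

lemma abs_entire_add:
  assumes "abs_entire a" "abs_entire b" shows "abs_entire (\<lambda>\<eta>. a \<eta> + b \<eta>)"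
  unfolding abs_entire_def
proof safe
  fix R :: real assume R: "R \<ge> 0"
  show "(\<lambda>\<eta>. cmod (a \<eta> + b \<eta>) * R ^ mdeg \<eta>) summable_on UNIV"
    by (rule summable_on_comparison_test[OF summable_on_add[OF abs_entireD[OF assms(1) R] abs_entireD[OF assms(2) R]]])
      (use R in \<open>auto simp: distrib_right[symmetric] intro!: mult_right_mono norm_triangle_ineq\<close>)
qed

lemma abs_entire_scale:
  assumes "abs_entire a" shows "abs_entire (\<lambda>\<eta>. c * a \<eta>)"
  using assms unfolding abs_entire_def by (auto simp: norm_mult mult.assoc intro: summable_on_cmult_right)

lemma abs_entire_has_sum:
  assumes "abs_entire a"
  shows "((\<lambda>\<eta>. a \<eta> * mpow z \<eta>) has_sum series_fun a z) UNIV"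
proof -
  have "(\<lambda>\<eta>. cmod (a \<eta>) * norm z ^ mdeg \<eta>) summable_on UNIV"
    using assms by (rule abs_entireD) simp
  then have "(\<lambda>\<eta>. norm (a \<eta> * mpow z \<eta>)) summable_on UNIV"
    by (rule summable_on_comparison_test) (unfold norm_mult, intro mult_left_mono norm_mpow_norm, auto)
  then show ?thesis
    unfolding series_fun_def by (rule has_sum_infsum[OF abs_summable_summable])
qed

lemma abs_entire_power_series: "abs_entire a \<Longrightarrow> power_series_of a (series_fun a)"
  by (simp add: power_series_of_def abs_entire_has_sum)

lemma power_series_eq: "power_series_of a f \<Longrightarrow> f = series_fun a"
  unfolding power_series_of_def series_fun_def by (auto intro!: ext infsumI[symmetric])

lemma abs_entire_finite:
  assumes "finite {\<eta>. a \<eta> \<noteq> 0}"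
  shows "abs_entire a"
  unfolding abs_entire_def
  by (auto intro!: finite_nonzero_values_imp_summable_on finite_subset[OF _ assms])

lemma series_fun_poly: "series_fun (Poly_Mapping.lookup P) = poly_fun P"
proof
  fix z
  have "((\<lambda>\<eta>. Poly_Mapping.lookup P \<eta> * mpow z \<eta>) has_sum poly_fun P z) UNIV"
    unfolding poly_fun_def
    by (rule has_sum_finite_neutralI) (auto simp: in_keys_iff)
  then show "series_fun (Poly_Mapping.lookup P) z = poly_fun P z"
    unfolding series_fun_def by (rule infsumI)
qed

lemma abs_entire_poly: "abs_entire (Poly_Mapping.lookup P)"
  by (rule abs_entire_finite) simp

lemma power_series_poly: "power_series_of (Poly_Mapping.lookup P) (poly_fun P)"
  using abs_entire_power_series[OF abs_entire_poly, of P] by (simp add: series_fun_poly)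

lemma tail_small:
  fixes g :: "'a \<Rightarrow> real"
  assumes g: "g summable_on UNIV" "\<And>x. g x \<ge> 0" and e: "e > 0"
  obtains F where "finite F" "\<And>F'. F \<subseteq> F' \<Longrightarrow> g summable_on (- F') \<and> infsum g (- F') < e"
proof -
  obtain F where F: "finite F" "dist (sum g F) (infsum g UNIV) \<le> e / 2"
    using infsum_finite_approximation[OF g(1), of "e/2"] e by auto
  have s: "g summable_on A" for A using summable_on_subset_banach[OF g(1)] by blast
  have "infsum g (- F') < e" if "F \<subseteq> F'" for F'
  proof -
    have "infsum g (- F') \<le> infsum g (- F)"
      using that g by (intro infsum_mono2 s) auto
    also have "\<dots> = infsum g UNIV - sum g F"
      using infsum_Diff[of g UNIV F] s F(1) by (simp add: Compl_eq_Diff_UNIV)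
    also have "\<dots> \<le> e / 2" using abs_le_D2[OF F(2)[unfolded dist_real_def]] by simp
    finally show ?thesis using e by simp
  qed
  then show ?thesis using that F(1) s by blast
qed

text \<open>Tannery's theorem: a finite set carries all but e/2 of the majorant, and on it the limit
  is a finite sum.\<close>

lemma infsum_dominated:
  fixes h :: "nat \<Rightarrow> 'a \<Rightarrow> real"
  assumes g: "g summable_on UNIV" and h: "\<And>k x. 0 \<le> h k x" "\<And>k x. h k x \<le> g x"
    and lim: "\<And>x. (\<lambda>k. h k x) \<longlonglongrightarrow> 0"
  shows "(\<lambda>k. \<Sum>\<^sub>\<infinity>x. h k x) \<longlonglongrightarrow> 0"
proof (rule LIMSEQ_I)
  fix e :: real assume e: "e > 0"
  have g0: "g x \<ge> 0" for x using h order_trans by blast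
  obtain F where F: "finite F" "\<And>F'. F \<subseteq> F' \<Longrightarrow> g summable_on (- F') \<and> infsum g (- F') < e / 2"
    using tail_small[OF g g0, of "e/2"] e by auto
  have s: "h k summable_on A" for k A
    by (rule summable_on_comparison_test[OF summable_on_subset_banach[OF g]]) (use h in auto)
  have "(\<lambda>k. \<Sum>x\<in>F. h k x) \<longlonglongrightarrow> (\<Sum>x\<in>F. 0)" by (intro tendsto_sum lim)
  then have "(\<lambda>k. \<Sum>x\<in>F. h k x) \<longlonglongrightarrow> 0" by simp
  from LIMSEQ_D[OF this, of "e/2"] e obtain N where N: "\<And>k. k \<ge> N \<Longrightarrow> norm ((\<Sum>x\<in>F. h k x) - 0) < e / 2" by auto
  have "norm ((\<Sum>\<^sub>\<infinity>x. h k x) - 0) < e" if "k \<ge> N" for k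
  proof -
    have "(\<Sum>\<^sub>\<infinity>x. h k x) = (\<Sum>\<^sub>\<infinity>x\<in>F. h k x) + (\<Sum>\<^sub>\<infinity>x\<in>-F. h k x)"
      using infsum_Un_disjoint[OF s[of k F] s[of k "-F"]] by simp
    also have "(\<Sum>\<^sub>\<infinity>x\<in>-F. h k x) \<le> infsum g (- F)"
      using F(2)[of F] by (intro infsum_mono s h) auto
    finally have "(\<Sum>\<^sub>\<infinity>x. h k x) \<le> (\<Sum>x\<in>F. h k x) + infsum g (- F)" using F(1) by simp
    also have "\<dots> < e" using N[OF that] F(2)[of F] by auto
    finally show ?thesis using infsum_nonneg[of UNIV "h k"] h by simp
  qed
  then show "\<exists>N. \<forall>k\<ge>N. norm ((\<Sum>\<^sub>\<infinity>x. h k x) - 0) < e" by blast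
qed

text \<open>Tannery's theorem for |b k \<eta> - b' \<eta>| R^|\<eta>|, a bound uniform over the ball
  of radius R. This is the usual way below from coefficients to locally uniform convergence.\<close>

lemma series_uniform_limit:
  assumes g: "abs_entire g" and b: "\<And>k \<eta>. cmod (b k \<eta>) \<le> cmod (g \<eta>)"
    and lim: "\<And>\<eta>. (\<lambda>k. b k \<eta>) \<longlonglongrightarrow> b' \<eta>" and K: "bounded K"
  shows "uniform_limit K (\<lambda>k. series_fun (b k)) (series_fun b') sequentially"
proof -
  obtain R where R: "R > 0" "\<And>z. z \<in> K \<Longrightarrow> norm z \<le> R" using K bounded_pos by blast
  have b': "cmod (b' \<eta>) \<le> cmod (g \<eta>)" for \<eta>
    by (rule LIMSEQ_le_const2[OF tendsto_norm[OF lim]]) (use b in auto)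
  have ae: "abs_entire (b k)" "abs_entire b'" for k
    using abs_entire_mono[OF g] b b' by blast+
  define h where "h k \<eta> = cmod (b k \<eta> - b' \<eta>) * R ^ mdeg \<eta>" for k \<eta>
  have hg: "h k \<eta> \<le> 2 * (cmod (g \<eta>) * R ^ mdeg \<eta>)" for k \<eta>
  proof -
    have "cmod (b k \<eta> - b' \<eta>) \<le> cmod (g \<eta>) + cmod (g \<eta>)"
      by (rule order_trans[OF norm_triangle_ineq4]) (intro add_mono b b')
    from mult_right_mono[OF this, of "R ^ mdeg \<eta>"] show ?thesis using R by (simp add: h_def)
  qed
  have gs: "(\<lambda>\<eta>. 2 * (cmod (g \<eta>) * R ^ mdeg \<eta>)) summable_on UNIV"
    using abs_entireD[OF g, of R] R by (intro summable_on_cmult_right) auto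
  have h0: "0 \<le> h k \<eta>" for k \<eta> using R by (simp add: h_def)
  have hl: "(\<lambda>k. h k \<eta>) \<longlonglongrightarrow> 0" for \<eta>
  proof -
    have "(\<lambda>k. cmod (b k \<eta> - b' \<eta>) * R ^ mdeg \<eta>) \<longlonglongrightarrow> cmod (b' \<eta> - b' \<eta>) * R ^ mdeg \<eta>"
      by (intro tendsto_intros lim)
    then show ?thesis by (simp add: h_def)
  qed
  have lim0: "(\<lambda>k. \<Sum>\<^sub>\<infinity>\<eta>. h k \<eta>) \<longlonglongrightarrow> 0"
    by (rule infsum_dominated[OF gs h0 hg hl])
  have bd: "dist (series_fun (b k) z) (series_fun b' z) \<le> (\<Sum>\<^sub>\<infinity>\<eta>. h k \<eta>)" if "z \<in> K" for k z
  proof -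
    have "((\<lambda>\<eta>. b k \<eta> * mpow z \<eta> - b' \<eta> * mpow z \<eta>) has_sum (series_fun (b k) z - series_fun b' z)) UNIV"
      using has_sum_add[OF abs_entire_has_sum[OF ae(1)] has_sum_uminusI[OF abs_entire_has_sum[OF ae(2)]], of k z z] by simp
    moreover have "((\<lambda>\<eta>. h k \<eta>) has_sum (\<Sum>\<^sub>\<infinity>\<eta>. h k \<eta>)) UNIV"
      by (intro has_sum_infsum summable_on_comparison_test[OF gs]) (use h0 hg in auto)
    moreover have "norm (b k \<eta> * mpow z \<eta> - b' \<eta> * mpow z \<eta>) \<le> h k \<eta>" for \<eta>
    proof -
      have "norm (mpow z \<eta>) \<le> R ^ mdeg \<eta>"
        using R(2)[OF that] by (rule norm_mpow_norm)
      then show ?thesis unfolding h_def left_diff_distrib[symmetric] norm_mult by (intro mult_left_mono) auto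
    qed
    ultimately show ?thesis unfolding dist_norm by (rule norm_infsum_le)
  qed
  show ?thesis
  proof (rule uniform_limitI)
    fix e :: real assume "e > 0"
    then have "\<forall>\<^sub>F k in sequentially. (\<Sum>\<^sub>\<infinity>\<eta>. h k \<eta>) < e" using lim0 order_tendstoD(2) by blast
    then show "\<forall>\<^sub>F k in sequentially. \<forall>z\<in>K. dist (series_fun (b k) z) (series_fun b' z) < e"
      by eventually_elim (use bd in \<open>auto intro: le_less_trans\<close>)
  qed
qed

lemma finite_bounded_idx: "finite {\<eta>::'n::finite \<Rightarrow> nat. \<forall>i. \<eta> i \<le> l}"
proof -
  have "{\<eta>::'n \<Rightarrow> nat. \<forall>i. \<eta> i \<le> l} = PiE UNIV (\<lambda>_. {..l})" by (auto simp: PiE_UNIV_domain)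
  then show ?thesis by (simp add: finite_PiE)
qed

lemma series_fun_finite:
  assumes "finite S" "\<And>\<eta>. \<eta> \<notin> S \<Longrightarrow> a \<eta> = 0"
  shows "series_fun a z = (\<Sum>\<eta>\<in>S. a \<eta> * mpow z \<eta>)"
  unfolding series_fun_def
  by (rule infsumI, rule has_sum_finite_neutralI) (use assms in auto)

lemma holomorphic_if_coord: "(\<lambda>t. if b then t else c) holomorphic_on S"
  by (cases b) (auto intro: holomorphic_intros)

lemma entire_series:
  assumes "abs_entire (a :: 'n::finite mseries)"
  shows "entire (series_fun a)"
proof -
  \<comment> \<open>Truncation to boxes of exponents: continuity and separate holomorphy are clear
    for the resulting polynomials and pass to locally uniform limits.\<close>
  define b where "b k \<eta> = (if \<forall>i. \<eta> i \<le> k then a \<eta> else 0)" for k :: nat and \<eta>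
  have bl: "(\<lambda>k. b k \<eta>) \<longlonglongrightarrow> a \<eta>" for \<eta>
  proof (rule tendsto_eventually)
    show "\<forall>\<^sub>F k in sequentially. b k \<eta> = a \<eta>"
      using eventually_ge_at_top[of "Max (range \<eta>)"]
      by eventually_elim (auto simp: b_def intro: order_trans[OF Max_ge])
  qed
  have ul: "uniform_limit K (\<lambda>k. series_fun (b k)) (series_fun a) sequentially" if "bounded K" for K
    by (rule series_uniform_limit[OF assms _ bl that]) (simp add: b_def)
  have sb: "series_fun (b k) = (\<lambda>z. \<Sum>\<eta>\<in>{\<eta>. \<forall>i. \<eta> i \<le> k}. a \<eta> * mpow z \<eta>)" for k
  proof
    fix z show "series_fun (b k) z = (\<Sum>\<eta>\<in>{\<eta>. \<forall>i. \<eta> i \<le> k}. a \<eta> * mpow z \<eta>)"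
      by (subst series_fun_finite[OF finite_bounded_idx[of k]]) (auto simp: b_def)
  qed
  have cont: "continuous_on UNIV (series_fun (b k))" for k
    unfolding sb mpow_def by (intro continuous_intros)
  have "isCont (series_fun a) z" for z
  proof -
    have "continuous_on (ball z 1) (series_fun a)"
      by (rule uniform_limit_theorem[OF _ ul[of "ball z 1"]])
        (auto intro!: always_eventually continuous_on_subset[OF cont])
    then show ?thesis by (simp add: continuous_on_eq_continuous_at)
  qed
  then have c: "continuous_on UNIV (series_fun a)" by (simp add: continuous_on_eq_continuous_at)
  have "(\<lambda>t. series_fun a (\<chi> j. if j = i then t else z $ j)) holomorphic_on UNIV" for z i
  proof (rule holomorphic_uniform_sequence[of UNIV "\<lambda>k t. series_fun (b k) (\<chi> j. if j = i then t else z $ j)"])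
    show "(\<lambda>t. series_fun (b k) (\<chi> j. if j = i then t else z $ j)) holomorphic_on UNIV" for k
      unfolding sb mpow_def by (intro holomorphic_intros) (simp add: holomorphic_if_coord)
    fix x :: complex
    have "continuous_on UNIV (\<lambda>t. (\<chi> j. if j = i then t else z $ j))"
      by (intro continuous_on_vec_lambda) (rule holomorphic_on_imp_continuous_on[OF holomorphic_if_coord])
    then have "compact ((\<lambda>t. (\<chi> j. if j = i then t else z $ j)) ` cball x 1)"
      by (rule compact_continuous_image[OF continuous_on_subset]) auto
    from ul[OF compact_imp_bounded[OF this]]
    have "uniform_limit (cball x 1) (\<lambda>k t. series_fun (b k) (\<chi> j. if j = i then t else z $ j))
            (\<lambda>t. series_fun a (\<chi> j. if j = i then t else z $ j)) sequentially"
      by (rule uniform_limit_compose') auto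
    then show "\<exists>d>0. cball x d \<subseteq> UNIV \<and> uniform_limit (cball x d) (\<lambda>k t. series_fun (b k) (\<chi> j. if j = i then t else z $ j))
            (\<lambda>t. series_fun a (\<chi> j. if j = i then t else z $ j)) sequentially"
      by (intro exI[of _ 1]) auto
  qed auto
  then show ?thesis using c by (simp add: entire_def)
qed

lemma power_series_entire: "power_series_of a f \<Longrightarrow> entire f"
  using entire_series[OF power_series_imp_abs_entire] power_series_eq by blast

section \<open>Cauchy estimates and uniqueness of coefficients\<close>

lemma root_of_unity_sum:
  fixes N a b :: nat
  assumes "N > 0"
  defines "x \<equiv> cis (2 * pi / N) ^ a * cnj (cis (2 * pi / N)) ^ b"
  shows "a = b \<Longrightarrow> (\<Sum>j<N. x ^ j) = of_nat N"
    and "a < N \<Longrightarrow> b < N \<Longrightarrow> a \<noteq> b \<Longrightarrow> (\<Sum>j<N. x ^ j) = 0"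
    and "cmod (\<Sum>j<N. x ^ j) \<le> N"
proof -
  have xc: "x = cis (2 * pi * (real a - real b) / N)"
  proof -
    have "x = cis (real a * (2 * pi / real N)) * cis (real b * (- (2 * pi / real N)))"
      unfolding x_def cis_cnj by (simp only: Complex.DeMoivre)
    also have "\<dots> = cis (2 * pi * (real a - real b) / N)"
      unfolding cis_mult by (rule arg_cong[of _ _ cis]) (simp add: algebra_simps diff_divide_distrib)
    finally show ?thesis .
  qed
  show "(\<Sum>j<N. x ^ j) = of_nat N" if "a = b" using that by (simp add: xc)
  show "cmod (\<Sum>j<N. x ^ j) \<le> N"
    by (rule order_trans[OF norm_sum]) (simp add: xc norm_power)
  show "(\<Sum>j<N. x ^ j) = 0" if ab: "a < N" "b < N" "a \<noteq> b"
  proof -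
    have "x ^ N = cis (2 * pi * (real a - real b))" using assms(1) by (simp add: xc Complex.DeMoivre)
    also have "\<dots> = 1"
      unfolding cis_eq_1_iff by (rule exI[of _ "int a - int b"]) simp
    finally have "x ^ N = 1" .
    moreover have "x \<noteq> 1"
    proof
      assume "x = 1"
      then obtain n where "2 * pi * (real a - real b) / N = of_int n * (2 * pi)" unfolding xc cis_eq_1_iff by blast
      then have "2 * pi * (real a - real b) = 2 * pi * (of_int n * N)" using assms(1) by (simp add: field_simps)
      then have "real a - real b = of_int n * N" by (simp only: mult_cancel_left) simp
      then have "real_of_int (int a - int b) = real_of_int (n * int N)" by simp
      then have e: "int a - int b = n * int N" by (simp only: of_int_eq_iff)
      then have "n \<noteq> 0" using ab by auto
      then have "\<bar>n\<bar> \<ge> 1" by simp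
      then have "\<bar>n * int N\<bar> \<ge> int N" by (simp add: abs_mult mult_le_cancel_right1)
      then show False using ab e by linarith
    qed
    ultimately show ?thesis by (simp add: geometric_sum)
  qed
qed

text \<open>
  Averaging \<open>f\<close> over the \<open>N\<close>-th roots of unity in each variable isolates the coefficients with index
  congruent to \<open>\<eta>\<close> modulo \<open>N\<close>.
\<close>

lemma cauchy_estimate:
  fixes a :: "'n::finite mseries"
  assumes ps: "power_series_of a f" and M: "\<And>z. (\<And>i. cmod (z $ i) \<le> 1) \<Longrightarrow> cmod (f z) \<le> M"
  shows "cmod (a \<eta>) \<le> M"
proof (rule field_le_epsilon)
  fix e :: real assume e: "e > 0"
  have "(\<lambda>\<theta>. cmod (a \<theta>) * 1 ^ mdeg \<theta>) summable_on UNIV"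
    by (rule abs_entireD[OF power_series_imp_abs_entire[OF ps]]) simp
  then have g: "(\<lambda>\<theta>. cmod (a \<theta>)) summable_on UNIV" by simp
  obtain F0 where F0: "finite F0" "\<And>F'. F0 \<subseteq> F' \<Longrightarrow> (\<lambda>\<theta>. cmod (a \<theta>)) summable_on (- F') \<and> (\<Sum>\<^sub>\<infinity>\<theta>\<in>-F'. cmod (a \<theta>)) < e"
    using tail_small[OF g _ e] by auto
  define F where "F = insert \<eta> F0"
  have F: "finite F" "\<eta> \<in> F" "(\<lambda>\<theta>. cmod (a \<theta>)) summable_on (- F)" "(\<Sum>\<^sub>\<infinity>\<theta>\<in>-F. cmod (a \<theta>)) < e"
    using F0(1) F0(2)[of F] by (auto simp: F_def)
  \<comment> \<open>Larger than every exponent occurring in F, so distinct indices in F stay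
    incongruent modulo N.\<close>
  define N where "N = Suc (Max ((\<lambda>(\<theta>,i). \<theta> i) ` (F \<times> UNIV)))"
  have N: "\<theta> i < N" if "\<theta> \<in> F" for \<theta> i
    unfolding N_def less_Suc_eq_le by (rule Max_ge) (use that F(1) in auto)
  have N0: "N > 0" by (simp add: N_def)
  define \<omega> where "\<omega> = cis (2 * pi / N)"
  have w1: "cmod \<omega> = 1" by (simp add: \<omega>_def)
  define J where "J = PiE (UNIV::'n set) (\<lambda>_. {..<N})"
  have J: "finite J" "card J = N ^ CARD('n)" by (simp_all add: J_def finite_PiE card_PiE)
  define zz where "zz j = (\<chi> i::'n. \<omega> ^ j i)" for j
  define K where "K \<theta> = (\<Prod>i\<in>UNIV. \<Sum>j<N. (\<omega> ^ \<theta> i * cnj \<omega> ^ \<eta> i) ^ j)" for \<theta> :: "'n \<Rightarrow> nat"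
  have Kdef: "(\<Sum>j\<in>J. mpow (zz j) \<theta> * cnj (mpow (zz j) \<eta>)) = K \<theta>" for \<theta>
  proof -
    have "K \<theta> = (\<Sum>j\<in>J. \<Prod>i\<in>UNIV. (\<omega> ^ \<theta> i * cnj \<omega> ^ \<eta> i) ^ j i)"
      unfolding K_def J_def by (rule prod_sum_PiE) auto
    also have "\<dots> = (\<Sum>j\<in>J. mpow (zz j) \<theta> * cnj (mpow (zz j) \<eta>))"
      by (simp add: mpow_def zz_def prod.distrib[symmetric] power_mult_distrib power_mult[symmetric] mult.commute)
    finally show ?thesis by simp
  qed
  have Ke: "K \<eta> = of_nat N ^ CARD('n)"
    unfolding K_def using root_of_unity_sum(1)[OF N0] by (simp add: \<omega>_def)
  have K0: "K \<theta> = 0" if th: "\<theta> \<in> F" "\<theta> \<noteq> \<eta>" for \<theta>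
  proof -
    obtain i where "\<theta> i \<noteq> \<eta> i" using th(2) by auto
    then have "(\<Sum>j<N. (\<omega> ^ \<theta> i * cnj \<omega> ^ \<eta> i) ^ j) = 0"
      unfolding \<omega>_def by (intro root_of_unity_sum(2) N0 N th F(2))
    then show ?thesis unfolding K_def by (auto intro: prod_zero)
  qed
  have Kb: "cmod (K \<theta>) \<le> real N ^ CARD('n)" for \<theta>
  proof -
    have "cmod (K \<theta>) = (\<Prod>i\<in>UNIV. cmod (\<Sum>j<N. (\<omega> ^ \<theta> i * cnj \<omega> ^ \<eta> i) ^ j))"
      unfolding K_def by (simp add: prod_norm)
    also have "\<dots> \<le> (\<Prod>i\<in>(UNIV::'n set). real N)"
      unfolding \<omega>_def by (intro prod_mono conjI norm_ge_zero root_of_unity_sum(3) N0)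
    finally show ?thesis by simp
  qed
  define S where "S = (\<Sum>j\<in>J. f (zz j) * cnj (mpow (zz j) \<eta>))"
  have z1: "cmod (zz j $ i) = 1" for j i by (simp add: zz_def norm_power w1)
  have Sb: "cmod S \<le> real N ^ CARD('n) * M"
  proof -
    have "cmod S \<le> (\<Sum>j\<in>J. M)"
      unfolding S_def
    proof (rule sum_norm_le)
      fix j assume "j \<in> J"
      have "cmod (f (zz j)) \<le> M" by (rule M) (simp add: z1)
      then show "cmod (f (zz j) * cnj (mpow (zz j) \<eta>)) \<le> M"
        by (simp add: norm_mult norm_mpow z1)
    qed
    then show ?thesis using J by simp
  qed
  have hs: "((\<lambda>\<theta>. a \<theta> * K \<theta>) has_sum S) UNIV"
  proof -
    have "((\<lambda>\<theta>. \<Sum>j\<in>J. a \<theta> * mpow (zz j) \<theta> * cnj (mpow (zz j) \<eta>)) has_sum S) UNIV"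
      unfolding S_def
      by (rule has_sum_finite_sum) (use J(1) ps in \<open>auto simp: power_series_of_def intro!: has_sum_cmult_left\<close>)
    then show ?thesis by (simp add: Kdef[symmetric] sum_distrib_left mult.assoc)
  qed
  have hF: "((\<lambda>\<theta>. a \<theta> * K \<theta>) has_sum (a \<eta> * K \<eta>)) F"
    by (rule has_sum_finiteI[OF F(1)]) (use F K0 in \<open>simp add: sum.remove[of F \<eta>]\<close>)
  have ht: "((\<lambda>\<theta>. a \<theta> * K \<theta>) has_sum (S - a \<eta> * K \<eta>)) (- F)"
    using has_sum_Diff[OF hs hF] by (simp add: Compl_eq_Diff_UNIV)
  \<comment> \<open>Aliasing error: only indices outside F can still interfere with \<eta>, and
    their total mass is below e.\<close>
  have "norm (S - a \<eta> * K \<eta>) \<le> (\<Sum>\<^sub>\<infinity>\<theta>\<in>-F. cmod (a \<theta>)) * real N ^ CARD('n)"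
    by (rule norm_infsum_le[OF ht has_sum_cmult_left[OF has_sum_infsum[OF F(3)]]])
      (auto simp: norm_mult intro: mult_left_mono Kb)
  also have "\<dots> \<le> e * real N ^ CARD('n)" using F(4) by (intro mult_right_mono) auto
  finally have "cmod (a \<eta> * K \<eta>) \<le> real N ^ CARD('n) * M + e * real N ^ CARD('n)"
    using Sb norm_triangle_ineq4[of S "S - a \<eta> * K \<eta>"] by simp
  then have "real N ^ CARD('n) * cmod (a \<eta>) \<le> real N ^ CARD('n) * (M + e)"
    by (simp add: Ke norm_mult norm_power algebra_simps)
  then show "cmod (a \<eta>) \<le> M + e" using N0 by simp
qed

lemma power_series_add:
  "power_series_of a f \<Longrightarrow> power_series_of b g \<Longrightarrow> power_series_of (\<lambda>\<eta>. a \<eta> + b \<eta>) (\<lambda>z. f z + g z)"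
  unfolding power_series_of_def distrib_right by (auto intro: has_sum_add)

lemma power_series_scale:
  "power_series_of a f \<Longrightarrow> power_series_of (\<lambda>\<eta>. c * a \<eta>) (\<lambda>z. c * f z)"
  unfolding power_series_of_def mult.assoc by (auto intro: has_sum_cmult_right)

lemma power_series_diff:
  "power_series_of a f \<Longrightarrow> power_series_of b g \<Longrightarrow> power_series_of (\<lambda>\<eta>. a \<eta> - b \<eta>) (\<lambda>z. f z - g z)"
  using power_series_add[OF _ power_series_scale[of b g "-1"]] by simp

lemma power_series_unique:
  assumes "power_series_of a f" "power_series_of b f"
  shows "a = b"
proof
  fix \<eta>
  have "cmod (a \<eta> - b \<eta>) \<le> 0"
    by (rule cauchy_estimate[OF power_series_diff[OF assms]]) simp
  then show "a \<eta> = b \<eta>" by simp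
qed

lemma taylor_coeffs_eq: "power_series_of a f \<Longrightarrow> taylor_coeffs f = a"
  unfolding taylor_coeffs_def by (rule the_equality) (auto intro: power_series_unique)

lemma coeff_tendsto:
  fixes a :: "nat \<Rightarrow> 'n::finite mseries"
  assumes "\<And>k. power_series_of (a k) (f k)" "power_series_of b g"
    and ul: "\<And>K. compact K \<Longrightarrow> uniform_limit K f g sequentially"
  shows "(\<lambda>k. a k \<eta>) \<longlonglongrightarrow> b \<eta>"
proof (rule tendstoI)
  fix e :: real assume e: "e > 0"
  \<comment> \<open>A ball of radius n contains the closed unit polydisc, because the norm is at
    most the sum of the moduli of the coordinates.\<close>
  have "uniform_limit (cball 0 (real CARD('n))) f g sequentially" by (rule ul) simp
  from uniform_limitD[OF this, of "e/2"] e
  have "\<forall>\<^sub>F k in sequentially. \<forall>z\<in>cball 0 (real CARD('n)). dist (f k z) (g z) < e/2" by simp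
  then show "\<forall>\<^sub>F k in sequentially. dist (a k \<eta>) (b \<eta>) < e"
  proof eventually_elim
    case (elim k)
    have "cmod (a k \<eta> - b \<eta>) \<le> e / 2"
    proof (rule cauchy_estimate[OF power_series_diff[OF assms(1,2)]])
      fix z :: "complex ^ 'n" assume z: "\<And>i. cmod (z $ i) \<le> 1"
      have "norm z \<le> (\<Sum>i\<in>UNIV. cmod (z $ i))" unfolding norm_vec_def by (rule L2_set_le_sum) simp
      also have "\<dots> \<le> (\<Sum>i\<in>(UNIV::'n set). 1)" by (intro sum_mono z)
      finally have "z \<in> cball 0 (real CARD('n))" by simp
      then show "cmod (f k z - g z) \<le> e / 2" using elim by (auto simp: dist_norm intro: less_imp_le)
    qed
    then show ?case using e by (simp add: dist_norm)
  qed
qed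

section \<open>Stability and the Laguerre--Polya class\<close>

lemma lookup_sum: "Poly_Mapping.lookup (\<Sum>x\<in>A. f x) \<eta> = (\<Sum>x\<in>A. Poly_Mapping.lookup (f x) \<eta>)"
  by (induction A rule: infinite_finite_induct) (auto simp: lookup_add)

lemma poly_fun_0 [simp]: "poly_fun 0 = (\<lambda>z. 0)"
  by (simp add: poly_fun_def fun_eq_iff)

lemma poly_fun_eqI: "power_series_of (Poly_Mapping.lookup P) f \<Longrightarrow> poly_fun P = f"
  using power_series_eq[of "Poly_Mapping.lookup P" f] by (simp add: series_fun_poly)

lemma poly_fun_add: "poly_fun (P + Q) z = poly_fun P z + poly_fun Q z"
proof -
  have "poly_fun (P + Q) = (\<lambda>z. poly_fun P z + poly_fun Q z)"
    using power_series_add[OF power_series_poly[of P] power_series_poly[of Q]] by (intro poly_fun_eqI) (simp add: lookup_add[abs_def])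
  then show ?thesis by simp
qed

lemma poly_fun_scale: "poly_fun (poly_scale c P) z = c * poly_fun P z"
proof -
  have "poly_fun (poly_scale c P) = (\<lambda>z. c * poly_fun P z)"
    using power_series_scale[OF power_series_poly[of P], of c] by (intro poly_fun_eqI) (simp add: lookup_poly_scale[abs_def])
  then show ?thesis by simp
qed

lemma poly_fun_sum: "poly_fun (\<Sum>x\<in>A. f x) z = (\<Sum>x\<in>A. poly_fun (f x) z)"
  by (induction A rule: infinite_finite_induct) (auto simp: poly_fun_add)

lemma poly_fun_single: "poly_fun (Poly_Mapping.single \<eta> c) z = c * mpow z \<eta>"
  by (auto simp: poly_fun_def)

lemma poly_fun_line: "\<exists>q. \<forall>t. poly q t = poly_fun P (\<chi> i. z $ i + t * u $ i)"
proof -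
  define q where "q = (\<Sum>\<eta>\<in>Poly_Mapping.keys P. smult (Poly_Mapping.lookup P \<eta>) (\<Prod>i\<in>UNIV. [:z $ i, u $ i:] ^ \<eta> i))"
  have "poly q t = poly_fun P (\<chi> i. z $ i + t * u $ i)" for t
    by (simp add: q_def poly_sum poly_prod poly_power poly_fun_def mpow_def)
  then show ?thesis by blast
qed

text \<open>Every point z reaches the half-plane product along z + t (\<i>, ..., \<i>) for large
  real t, so the restriction to this line has infinitely many zeros.\<close>

lemma poly_eq_0I:
  assumes "\<And>z. (\<forall>i. 0 < Im (z $ i)) \<Longrightarrow> poly_fun P z = 0"
  shows "P = 0"
proof -
  have "poly_fun P z = 0" for z
  proof -
    obtain q where q: "\<And>t. poly q t = poly_fun P (\<chi> i. z $ i + t * (\<chi> i. \<i>) $ i)"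
      using poly_fun_line[of P z "\<chi> i. \<i>"] by blast
    have "poly q (of_real t) = 0" if "t > norm z" for t :: real
      unfolding q
    proof (rule assms, rule allI)
      fix i
      have "\<bar>Im (z $ i)\<bar> \<le> norm z" using abs_Im_le_cmod cmod_nth_le order_trans by blast
      then show "0 < Im ((\<chi> i. z $ i + complex_of_real t * (\<chi> i. \<i>) $ i) $ i)" using that by simp
    qed
    then have "of_real ` {norm z<..} \<subseteq> {t. poly q t = 0}" by auto
    moreover have "infinite (complex_of_real ` {norm z<..})"
      by (simp add: finite_image_iff inj_on_def infinite_Ioi)
    ultimately have "q = 0" using poly_roots_finite finite_subset by blast
    then show ?thesis using q[of 0] by simp
  qed
  then have "poly_fun P = (\<lambda>z. 0)" by auto
  with power_series_poly[of P] have "power_series_of (Poly_Mapping.lookup P) (\<lambda>z. 0)" by simp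
  moreover have "power_series_of (\<lambda>_. 0) (\<lambda>z. 0)" by (simp add: power_series_of_def)
  ultimately have "Poly_Mapping.lookup P = (\<lambda>_. 0)" by (rule power_series_unique)
  then show ?thesis by (intro poly_mapping_eqI) auto
qed

lemma LP_stable: "stable P \<Longrightarrow> poly_fun P \<in> LP"
  using power_series_entire[OF power_series_poly]
  by (auto simp: LP_def intro!: exI[of _ "\<lambda>_. P"] uniform_limit_const)

lemma LP_zero: "(\<lambda>z :: complex ^ 'n::finite. 0) \<in> LP"
proof -
  define P where "P k = Poly_Mapping.single (\<lambda>_::'n. 0::nat) (complex_of_real (inverse (real (Suc k))))" for k
  have f: "poly_fun (P k) = (\<lambda>z. complex_of_real (inverse (real (Suc k))))" for k
    by (auto simp: P_def poly_fun_single mpow_def fun_eq_iff)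
  have "(\<lambda>k. complex_of_real (inverse (real (Suc k)))) \<longlonglongrightarrow> of_real 0"
    by (intro tendsto_of_real LIMSEQ_inverse_real_of_nat)
  then have "uniform_limit K (\<lambda>k. poly_fun (P k)) (\<lambda>z. 0) sequentially" for K
    unfolding f uniform_limit_iff tendsto_iff by (auto elim!: eventually_mono)
  moreover have "stable (P k)" for k by (simp add: stable_def f del: of_nat_Suc)
  moreover have "entire (\<lambda>z. 0)" by (simp add: entire_def)
  ultimately show ?thesis unfolding LP_def by blast
qed

text \<open>Diagonal choice: the k-th polynomial is within 1/(k+1) of \<open>f k\<close> on the ball
  of radius k, and every compact set lies in these balls eventually.\<close>

lemma LP_closed:
  assumes f: "\<And>k. f k \<in> LP" and g: "entire g"
    and ul: "\<And>K. compact K \<Longrightarrow> uniform_limit K f g sequentially"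
  shows "g \<in> LP"
proof -
  have "\<exists>P. stable P \<and> (\<forall>z\<in>cball 0 (real k). dist (poly_fun P z) (f k z) < inverse (real (Suc k)))" for k
  proof -
    obtain P where P: "\<And>j. stable (P j)" "\<And>K. compact K \<Longrightarrow> uniform_limit K (\<lambda>j. poly_fun (P j)) (f k) sequentially"
      using f[of k] by (auto simp: LP_def)
    have "\<forall>\<^sub>F j in sequentially. \<forall>z\<in>cball 0 (real k). dist (poly_fun (P j) z) (f k z) < inverse (real (Suc k))"
      by (rule uniform_limitD[OF P(2)]) auto
    then obtain j where "\<forall>z\<in>cball 0 (real k). dist (poly_fun (P j) z) (f k z) < inverse (real (Suc k))"
      using eventually_happens'[OF sequentially_bot] by blast
    then show ?thesis using P(1) by blast
  qed
  then obtain P where P: "\<And>k. stable (P k)"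
    "\<And>k z. z \<in> cball 0 (real k) \<Longrightarrow> dist (poly_fun (P k) z) (f k z) < inverse (real (Suc k))" by metis
  have "uniform_limit K (\<lambda>k. poly_fun (P k)) g sequentially" if K: "compact K" for K
  proof (rule uniform_limitI)
    fix e :: real assume e: "e > 0"
    obtain R where R: "\<And>z. z \<in> K \<Longrightarrow> norm z \<le> R" using compact_imp_bounded[OF K] bounded_iff by blast
    have 1: "\<forall>\<^sub>F k in sequentially. \<forall>z\<in>K. dist (f k z) (g z) < e / 2"
      using uniform_limitD[OF ul[OF K], of "e/2"] e by simp
    have 2: "\<forall>\<^sub>F k in sequentially. inverse (real (Suc k)) < e / 2"
      using order_tendstoD(2)[OF LIMSEQ_inverse_real_of_nat, of "e/2"] e by simp
    have 3: "\<forall>\<^sub>F k in sequentially. R \<le> real k"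
      using eventually_ge_at_top[of "nat \<lceil>R\<rceil>"] by eventually_elim linarith
    from 1 2 3 show "\<forall>\<^sub>F k in sequentially. \<forall>z\<in>K. dist (poly_fun (P k) z) (g z) < e"
    proof eventually_elim
      case (elim k)
      show ?case
      proof
        fix z assume z: "z \<in> K"
        then have "z \<in> cball 0 (real k)" using R[OF z] elim(3) by simp
        from P(2)[OF this] have "dist (poly_fun (P k) z) (f k z) < e / 2" using elim(2) by simp
        moreover have "dist (f k z) (g z) < e / 2" using elim(1) z by blast
        ultimately show "dist (poly_fun (P k) z) (g z) < e" using dist_triangle[of "poly_fun (P k) z" "g z" "f k z"] by linarith
      qed
    qed
  qed
  then show ?thesis using P(1) g unfolding LP_def by blast
qed

text \<open>One-variable Hurwitz on the complex line through a zero and a non-zero of P in the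
  half-plane product. The admissible parameters form an open convex set, hence a connected one, and
  P is not constant on it.\<close>

lemma LP_poly_stable:
  fixes P :: "'n::finite mpolynomial"
  assumes "poly_fun P \<in> LP"
  shows "stable P \<or> P = 0"
proof (rule ccontr)
  assume *: "\<not> (stable P \<or> P = 0)"
  then obtain z0 where z0: "\<forall>i. 0 < Im (z0 $ i)" "poly_fun P z0 = 0" by (auto simp: stable_def)
  obtain z1 where z1: "\<forall>i. 0 < Im (z1 $ i)" "poly_fun P z1 \<noteq> 0" using * poly_eq_0I by blast
  obtain Q where Q: "\<And>k. stable (Q k)" "\<And>K. compact K \<Longrightarrow> uniform_limit K (\<lambda>k. poly_fun (Q k)) (poly_fun P) sequentially"
    using assms by (auto simp: LP_def)
  define d where "d = z1 - z0"
  define L where "L t = (\<chi> i. z0 $ i + t * d $ i)" for t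
  define S where "S = {t. \<forall>i. 0 < Im (L t $ i)}"
  have L01: "L 0 = z0" "L 1 = z1" by (simp_all add: L_def d_def vec_eq_iff)
  have "S = (\<Inter>i\<in>UNIV. {t. 0 < Im (z0 $ i + t * d $ i)})" by (auto simp: S_def L_def)
  also have "open \<dots>" by (intro open_INT ballI open_Collect_less continuous_intros) auto
  finally have opS: "open S" .
  have "convex S"
  proof (rule convexI)
    fix x y and u v :: real assume xy: "x \<in> S" "y \<in> S" and uv: "0 \<le> u" "0 \<le> v" "u + v = 1"
    have "0 < Im (L (u *\<^sub>R x + v *\<^sub>R y) $ i)" for i
    proof -
      have "Im (L (u *\<^sub>R x + v *\<^sub>R y) $ i) = u * Im (L x $ i) + v * Im (L y $ i)"
      proof -
        have "Im (z0 $ i) = (u + v) * Im (z0 $ i)" using uv by simp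
        then show ?thesis by (simp add: L_def algebra_simps)
      qed
      moreover have "Im (L x $ i) > 0" "Im (L y $ i) > 0" using xy by (auto simp: S_def)
      moreover have "u > 0 \<or> v > 0" using uv by linarith
      ultimately show ?thesis using uv
        by (metis add.commute add_nonneg_pos less_eq_real_def mult_nonneg_nonneg mult_pos_pos)
    qed
    then show "u *\<^sub>R x + v *\<^sub>R y \<in> S" by (simp add: S_def)
  qed
  then have conS: "connected S" by (rule convex_connected)
  have hol: "(\<lambda>t. poly_fun R (L t)) holomorphic_on S" for R :: "'n mpolynomial"
  proof -
    obtain q where q: "\<And>t. poly q t = poly_fun R (L t)" using poly_fun_line[of R z0 d] unfolding L_def by blast
    have "poly q holomorphic_on S" by (intro holomorphic_intros)
    moreover have "poly q = (\<lambda>t. poly_fun R (L t))" using q by auto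
    ultimately show ?thesis by simp
  qed
  have cL: "continuous_on A L" for A
    unfolding L_def by (intro continuous_on_vec_lambda continuous_intros)
  have "poly_fun P (L 0) \<noteq> 0"
  proof (rule Hurwitz_no_zeros[OF opS conS, of "\<lambda>k t. poly_fun (Q k) (L t)" "\<lambda>t. poly_fun P (L t)"])
    show "uniform_limit K (\<lambda>k t. poly_fun (Q k) (L t)) (\<lambda>t. poly_fun P (L t)) sequentially"
      if "compact K" "K \<subseteq> S" for K
      by (rule uniform_limit_compose'[OF Q(2)[OF compact_continuous_image[OF cL that(1)]]]) auto
    show "\<not> (\<lambda>t. poly_fun P (L t)) constant_on S"
    proof
      assume "(\<lambda>t. poly_fun P (L t)) constant_on S"
      moreover have "0 \<in> S" "1 \<in> S" using z0 z1 by (auto simp: S_def L01)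
      ultimately have "poly_fun P (L 0) = poly_fun P (L 1)" unfolding constant_on_def by metis
      then show False using z0 z1 by (simp add: L01)
    qed
    show "poly_fun (Q k) (L t) \<noteq> 0" if "t \<in> S" for k t
      using Q(1)[of k] that by (simp add: stable_def S_def)
    show "0 \<in> S" using z0 by (simp add: S_def L01)
  qed (rule hol)+
  then show False using z0 by (simp add: L01)
qed

lemma LP_poly_iff: "poly_fun P \<in> LP \<longleftrightarrow> stable P \<or> P = 0"
proof
  assume "stable P \<or> P = 0"
  then show "poly_fun P \<in> LP"
  proof
    assume "P = 0"
    then show ?thesis using LP_zero by simp
  qed (rule LP_stable)
qed (rule LP_poly_stable)

lemma finite_support_uniform_limit:
  assumes S: "finite S" and supp: "\<And>k \<eta>. \<eta> \<notin> S \<Longrightarrow> a k \<eta> = 0" and lim: "\<And>\<eta>. (\<lambda>k. a k \<eta>) \<longlonglongrightarrow> b \<eta>" and K: "bounded K"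
  shows "uniform_limit K (\<lambda>k. series_fun (a k)) (series_fun b) sequentially"
proof -
  have "\<exists>B. \<forall>k. cmod (a k \<eta>) \<le> B" for \<eta>
    using convergent_imp_Bseq[OF convergentI[OF lim]] by (auto simp: Bseq_def)
  then obtain B where B: "\<And>k \<eta>. cmod (a k \<eta>) \<le> B \<eta>" by metis
  define g where "g \<eta> = (if \<eta> \<in> S then complex_of_real (B \<eta>) else 0)" for \<eta>
  show ?thesis
  proof (rule series_uniform_limit[of g])
    show "abs_entire g" by (rule abs_entire_finite, rule finite_subset[OF _ S]) (auto simp: g_def)
    show "cmod (a k \<eta>) \<le> cmod (g \<eta>)" for k \<eta>
      using B[of k \<eta>] supp[of \<eta> k] by (auto simp: g_def)
  qed (use lim K in auto)
qed

text \<open>Exponents in a fixed finite set make coefficientwise convergence locally uniform, so the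
  limit is a Laguerre-Polya polynomial and Hurwitz applies.\<close>

lemma stable_limit:
  assumes S: "finite S" and P: "\<And>k. stable (P k) \<or> P k = 0" and supp: "\<And>k \<eta>. \<eta> \<notin> S \<Longrightarrow> Poly_Mapping.lookup (P k) \<eta> = 0"
    and lim: "\<And>\<eta>. (\<lambda>k. Poly_Mapping.lookup (P k) \<eta>) \<longlonglongrightarrow> Poly_Mapping.lookup Q \<eta>"
  shows "stable Q \<or> Q = 0"
proof -
  have "uniform_limit K (\<lambda>k. poly_fun (P k)) (poly_fun Q) sequentially" if "compact K" for K
    using finite_support_uniform_limit[where a = "\<lambda>k. Poly_Mapping.lookup (P k)", OF S supp lim compact_imp_bounded[OF that]]
    by (simp add: series_fun_poly)
  then have "poly_fun Q \<in> LP"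
    by (rule LP_closed[of "\<lambda>k. poly_fun (P k)", rotated 2]) (use P in \<open>auto simp: LP_poly_iff power_series_entire[OF power_series_poly]\<close>)
  then show ?thesis by (simp add: LP_poly_iff)
qed

lemma mpow_fun: "mpow (\<chi> i. v i) \<eta> = (\<Prod>i\<in>UNIV. v i ^ \<eta> i)"
  by (simp add: mpow_def)

text \<open>
  Replaces the variables \<open>v\<^sub>i, w\<^sub>i\<close> of \<open>P(v) G(w)\<close> by the functional \<open>pairing\<close>, one index \<open>i\<close> at a time.
\<close>

lemma apolar_nonzero:
  fixes P :: "'n::finite mpolynomial" and G :: "('n \<Rightarrow> nat) \<Rightarrow> complex"
  assumes P: "stable P" and E: "finite E" and l: "l > 0"
    and G: "\<And>w. (\<forall>i. 0 < Im (w $ i)) \<Longrightarrow> (\<Sum>\<theta>\<in>E. G \<theta> * mpow w \<theta>) \<noteq> 0"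
  defines "pr \<equiv> pairing (of_real (1 / real l)) (\<i> / of_nat l) l"
  shows "(\<Sum>\<theta>\<in>E. (\<Sum>\<eta>\<in>Poly_Mapping.keys P. Poly_Mapping.lookup P \<eta> * (\<Prod>i\<in>UNIV. pr (\<eta> i) (\<theta> i))) * G \<theta>) \<noteq> 0"
proof -
  define X where "X = Poly_Mapping.keys P \<times> E"
  have X: "finite X" using E by (simp add: X_def)
  define c where "c y = Poly_Mapping.lookup P (fst y) * G (snd y)" for y
  \<comment> \<open>The v i, w i outside S stay arbitrary: replacing the next pair requires
    zero-freeness for all of its values in the half-plane.\<close>
  have main: "(\<Sum>y\<in>X. c y * (\<Prod>i\<in>S. pr (fst y i) (snd y i)) * (\<Prod>i\<in>-S. v i ^ fst y i * w i ^ snd y i)) \<noteq> 0"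
    if "finite S" "\<And>i. Im (v i) > 0" "\<And>i. Im (w i) > 0" for S :: "'n set" and v w
    using that
  proof (induction S arbitrary: v w rule: finite_induct)
    case empty
    have "(\<Sum>y\<in>X. c y * (\<Prod>i\<in>UNIV. v i ^ fst y i * w i ^ snd y i))
       = poly_fun P (\<chi> i. v i) * (\<Sum>\<theta>\<in>E. G \<theta> * mpow (\<chi> i. w i) \<theta>)"
      unfolding poly_fun_def sum_product sum.cartesian_product X_def c_def
      by (intro sum.cong) (auto simp: mpow_fun prod.distrib)
    moreover have "poly_fun P (\<chi> i. v i) \<noteq> 0" using P empty by (simp add: stable_def)
    moreover have "(\<Sum>\<theta>\<in>E. G \<theta> * mpow (\<chi> i. w i) \<theta>) \<noteq> 0" by (rule G) (use empty in simp)
    ultimately show ?case by simp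
  next
    case (insert j S)
    define k where "k y = c y * (\<Prod>i\<in>S. pr (fst y i) (snd y i)) * (\<Prod>i\<in>-(insert j S). v i ^ fst y i * w i ^ snd y i)" for y
    have mS: "-S = insert j (-(insert j S))" "j \<notin> -(insert j S)" using insert.hyps by auto
    have "(\<Sum>y\<in>X. k y * v' ^ fst y j * w' ^ snd y j) \<noteq> 0" if vw: "Im v' > 0" "Im w' > 0" for v' w'
    proof -
      have "(\<Sum>y\<in>X. c y * (\<Prod>i\<in>S. pr (fst y i) (snd y i)) * (\<Prod>i\<in>-S. (v(j := v')) i ^ fst y i * (w(j := w')) i ^ snd y i)) \<noteq> 0"
        using insert.prems vw by (intro insert.IH) auto
      also have "(\<Sum>y\<in>X. c y * (\<Prod>i\<in>S. pr (fst y i) (snd y i)) * (\<Prod>i\<in>-S. (v(j := v')) i ^ fst y i * (w(j := w')) i ^ snd y i))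
         = (\<Sum>y\<in>X. k y * v' ^ fst y j * w' ^ snd y j)"
      proof (rule sum.cong[OF refl])
        fix y
        have "(\<Prod>i\<in>-S. (v(j := v')) i ^ fst y i * (w(j := w')) i ^ snd y i)
           = (v' ^ fst y j * w' ^ snd y j) * (\<Prod>i\<in>-(insert j S). (v(j := v')) i ^ fst y i * (w(j := w')) i ^ snd y i)"
          by (subst mS(1), subst prod.insert) (use mS(2) in auto)
        also have "(\<Prod>i\<in>-(insert j S). (v(j := v')) i ^ fst y i * (w(j := w')) i ^ snd y i) = (\<Prod>i\<in>-(insert j S). v i ^ fst y i * w i ^ snd y i)"
          by (rule prod.cong) auto
        finally show "c y * (\<Prod>i\<in>S. pr (fst y i) (snd y i)) * (\<Prod>i\<in>-S. (v(j := v')) i ^ fst y i * (w(j := w')) i ^ snd y i)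
          = k y * v' ^ fst y j * w' ^ snd y j" by (simp add: k_def)
      qed
      finally show ?thesis .
    qed
    then have "(\<Sum>y\<in>X. k y * pr (fst y j) (snd y j)) \<noteq> 0"
      unfolding pr_def by (intro pairing_nonzero X) (use l in auto)
    also have "(\<Sum>y\<in>X. k y * pr (fst y j) (snd y j)) = (\<Sum>y\<in>X. c y * (\<Prod>i\<in>insert j S. pr (fst y i) (snd y i)) * (\<Prod>i\<in>-(insert j S). v i ^ fst y i * w i ^ snd y i))"
      using insert.hyps by (intro sum.cong refl) (simp add: k_def)
    finally show ?case .
  qed
  have "(\<Sum>y\<in>X. c y * (\<Prod>i\<in>UNIV. pr (fst y i) (snd y i))) \<noteq> 0"
    using main[of UNIV "\<lambda>_. \<i>" "\<lambda>_. \<i>"] by simp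
  also have "(\<Sum>y\<in>X. c y * (\<Prod>i\<in>UNIV. pr (fst y i) (snd y i)))
      = (\<Sum>\<eta>\<in>Poly_Mapping.keys P. \<Sum>\<theta>\<in>E. c (\<eta>, \<theta>) * (\<Prod>i\<in>UNIV. pr (\<eta> i) (\<theta> i)))"
    unfolding X_def sum.cartesian_product by (intro sum.cong) auto
  also have "\<dots> = (\<Sum>\<theta>\<in>E. \<Sum>\<eta>\<in>Poly_Mapping.keys P. c (\<eta>, \<theta>) * (\<Prod>i\<in>UNIV. pr (\<eta> i) (\<theta> i)))"
    by (rule sum.swap)
  also have "\<dots> = (\<Sum>\<theta>\<in>E. (\<Sum>\<eta>\<in>Poly_Mapping.keys P. Poly_Mapping.lookup P \<eta> * (\<Prod>i\<in>UNIV. pr (\<eta> i) (\<theta> i))) * G \<theta>)"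
    unfolding sum_distrib_right c_def by (simp add: mult_ac)
  finally show ?thesis .
qed

text \<open>
  The polynomial \<open>R\<close> is \<open>P(-\<partial>\<^sub>w) \<Sum>\<^sub>\<theta> Q\<^sub>\<theta>(z) w\<^sup>\<theta>\<close> at \<open>w = 0\<close>.
\<close>

lemma apolar_stable:
  fixes P :: "'n::finite mpolynomial" and Q :: "('n \<Rightarrow> nat) \<Rightarrow> 'm::finite mpolynomial"
  assumes P: "stable P" and E: "finite E"
    and Q: "\<And>z w. (\<forall>i. 0 < Im (z $ i)) \<Longrightarrow> (\<forall>i. 0 < Im (w $ i)) \<Longrightarrow> (\<Sum>\<theta>\<in>E. poly_fun (Q \<theta>) z * mpow w \<theta>) \<noteq> 0"
  defines "R \<equiv> (\<Sum>\<theta>\<in>E. poly_scale (Poly_Mapping.lookup P \<theta> * (-1) ^ mdeg \<theta> * of_nat (mfact \<theta>)) (Q \<theta>))"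
  shows "stable R \<or> R = 0"
proof -
  define c where "c l \<theta> = (\<Sum>\<eta>\<in>Poly_Mapping.keys P. Poly_Mapping.lookup P \<eta> *
      (\<Prod>i\<in>UNIV. pairing (of_real (1 / real (Suc l))) (\<i> / of_nat (Suc l)) (Suc l) (\<eta> i) (\<theta> i)))" for l \<theta>
  define F where "F l = (\<Sum>\<theta>\<in>E. poly_scale (c l \<theta>) (Q \<theta>))" for l
  \<comment> \<open>Here z is only a parameter: for each fixed z in the half-plane product the sum
    is a zero-free polynomial in w. The index \<open>Suc l\<close> keeps 1/l and \<i>/l
    meaningful.\<close>
  have st: "stable (F l)" for l
    unfolding stable_def
  proof safe
    fix z :: "complex ^ 'm" assume z: "\<forall>i. 0 < Im (z $ i)" and 0: "poly_fun (F l) z = 0"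
    have "poly_fun (F l) z = (\<Sum>\<theta>\<in>E. c l \<theta> * poly_fun (Q \<theta>) z)"
      by (simp add: F_def poly_fun_sum poly_fun_scale)
    moreover have "(\<Sum>\<theta>\<in>E. c l \<theta> * poly_fun (Q \<theta>) z) \<noteq> 0"
      unfolding c_def by (rule apolar_nonzero[OF P E zero_less_Suc]) (rule Q[OF z])
    ultimately show False using 0 by simp
  qed
  have cl: "(\<lambda>l. c l \<theta>) \<longlonglongrightarrow> Poly_Mapping.lookup P \<theta> * (-1) ^ mdeg \<theta> * of_nat (mfact \<theta>)" for \<theta>
  proof -
    have "(\<lambda>l. c l \<theta>) \<longlonglongrightarrow> (\<Sum>\<eta>\<in>Poly_Mapping.keys P. Poly_Mapping.lookup P \<eta> *
      (\<Prod>i\<in>UNIV. if \<eta> i = \<theta> i then (-1) ^ \<eta> i * fact (\<eta> i) else 0))"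
      unfolding c_def by (intro tendsto_intros LIMSEQ_Suc pairing_tendsto)
    also have "(\<Sum>\<eta>\<in>Poly_Mapping.keys P. Poly_Mapping.lookup P \<eta> *
      (\<Prod>i\<in>UNIV. if \<eta> i = \<theta> i then (-1) ^ \<eta> i * fact (\<eta> i) else 0)) =
      (\<Sum>\<eta>\<in>Poly_Mapping.keys P. if \<eta> = \<theta> then Poly_Mapping.lookup P \<theta> * (-1) ^ mdeg \<theta> * of_nat (mfact \<theta>) else 0)"
    proof (intro sum.cong refl)
      fix \<eta>
      show "Poly_Mapping.lookup P \<eta> * (\<Prod>i\<in>UNIV. if \<eta> i = \<theta> i then (-1) ^ \<eta> i * fact (\<eta> i) else 0)
         = (if \<eta> = \<theta> then Poly_Mapping.lookup P \<theta> * (-1) ^ mdeg \<theta> * of_nat (mfact \<theta>) else 0)"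
      proof (cases "\<eta> = \<theta>")
        case True
        then show ?thesis by (simp add: prod.distrib mdeg_def mfact_def power_sum)
      next
        case False
        then obtain i where "\<eta> i \<noteq> \<theta> i" by auto
        then have "(\<Prod>i\<in>UNIV. if \<eta> i = \<theta> i then (-1) ^ \<eta> i * fact (\<eta> i) else 0 :: complex) = 0"
          by (intro prod_zero) auto
        then show ?thesis using False by simp
      qed
    qed
    also have "\<dots> = Poly_Mapping.lookup P \<theta> * (-1) ^ mdeg \<theta> * of_nat (mfact \<theta>)"
      by (auto simp: in_keys_iff)
    finally show ?thesis .
  qed
  have lim: "(\<lambda>l. Poly_Mapping.lookup (F l) \<zeta>) \<longlonglongrightarrow> Poly_Mapping.lookup R \<zeta>" for \<zeta>
    unfolding F_def R_def lookup_sum lookup_poly_scale by (intro tendsto_intros cl)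
  have supp: "Poly_Mapping.lookup (F l) \<zeta> = 0" if "\<zeta> \<notin> (\<Union>\<theta>\<in>E. Poly_Mapping.keys (Q \<theta>))" for l \<zeta>
    using that unfolding F_def lookup_sum lookup_poly_scale by (auto intro!: sum.neutral simp: in_keys_iff)
  show ?thesis
  proof (rule stable_limit[where P = F])
    show "finite (\<Union>\<theta>\<in>E. Poly_Mapping.keys (Q \<theta>))" using E by simp
    show "stable (F k) \<or> F k = 0" for k using st by simp
    show "(\<lambda>k. Poly_Mapping.lookup (F k) \<eta>) \<longlonglongrightarrow> Poly_Mapping.lookup R \<eta>" for \<eta> by (rule lim)
  qed (rule supp)
qed

section \<open>Jensen polynomials in several variables\<close>

definition mults :: "nat \<Rightarrow> ('n::finite \<Rightarrow> nat) \<Rightarrow> real" where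
  "mults l \<eta> = (\<Prod>i\<in>UNIV. mult1 l (\<eta> i))"

lemma mults_range: "0 \<le> mults l \<eta>" "mults l \<eta> \<le> 1"
  unfolding mults_def by (auto intro!: prod_nonneg prod_le_1 simp: mult1_range)

lemma mults_pos: "(\<And>i. \<eta> i \<le> l) \<Longrightarrow> mults l \<eta> > 0"
  unfolding mults_def by (auto intro!: prod_pos mult1_pos)

lemma mults_eq_0: "\<not> (\<forall>i. \<eta> i \<le> l) \<Longrightarrow> mults l \<eta> = 0"
  unfolding mults_def by (auto intro!: prod_zero mult1_eq_0 simp: not_le)

lemma mults_tendsto: "(\<lambda>l. mults l \<eta>) \<longlonglongrightarrow> 1"
proof -
  have "(\<lambda>l. mults l \<eta>) \<longlonglongrightarrow> (\<Prod>i\<in>(UNIV::'a set). 1)"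
    unfolding mults_def by (intro tendsto_prod mult1_tendsto)
  then show ?thesis by simp
qed

text \<open>Jensen polynomial of an arbitrary formal series. The multipliers vanish as soon as one
  exponent exceeds l, which gives the finite support that \<open>Abs_poly_mapping\<close>
  requires.\<close>

definition jpoly :: "nat \<Rightarrow> 'n::finite mseries \<Rightarrow> 'n mpolynomial" where
  "jpoly l a = Abs_poly_mapping (\<lambda>\<eta>. of_real (mults l \<eta>) * a \<eta>)"

lemma lookup_jpoly: "Poly_Mapping.lookup (jpoly l a) \<eta> = of_real (mults l \<eta>) * a \<eta>"
proof -
  have "finite {\<eta>. of_real (mults l \<eta>) * a \<eta> \<noteq> 0}"
    by (rule finite_subset[OF _ finite_bounded_idx[of l]]) (use mults_eq_0 in force)
  then show ?thesis unfolding jpoly_def by (simp add: Poly_Mapping.lookup_Abs_poly_mapping)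
qed

lemma lookup_jpoly_0: "\<eta> \<notin> {\<eta>. \<forall>i. \<eta> i \<le> l} \<Longrightarrow> Poly_Mapping.lookup (jpoly l a) \<eta> = 0"
  by (simp add: lookup_jpoly mults_eq_0)

text \<open>The kernel that represents multiplication of coefficients by \<open>mults l\<close>: it
  contains only the diagonal monomials z^\<theta> w^\<theta>.\<close>

lemma prod_binomial:
  fixes z w :: "complex ^ 'n::finite"
  shows "(\<Sum>\<theta>\<in>{\<theta>. \<forall>i. \<theta> i \<le> l}. (\<Prod>i\<in>UNIV. of_nat (l choose \<theta> i) * (- 1 / of_nat l) ^ \<theta> i) * mpow z \<theta> * mpow w \<theta>)
     = (\<Prod>i\<in>UNIV. (1 - z $ i * w $ i / of_nat l) ^ l)"
proof -
  have P: "{\<theta>::'n \<Rightarrow> nat. \<forall>i. \<theta> i \<le> l} = PiE UNIV (\<lambda>_. {..l})" by (auto simp: PiE_UNIV_domain)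
  have "(1 - z $ i * w $ i / of_nat l) ^ l = (\<Sum>k\<le>l. of_nat (l choose k) * (- 1 / of_nat l) ^ k * (z $ i) ^ k * (w $ i) ^ k)" for i
    using binomial_ring[of "- (z $ i * w $ i / of_nat l)" 1 l]
    by (simp add: power_mult_distrib[symmetric] mult.assoc)
  then have "(\<Prod>i\<in>UNIV. (1 - z $ i * w $ i / of_nat l) ^ l)
     = (\<Sum>\<theta>\<in>PiE UNIV (\<lambda>_. {..l}). \<Prod>i\<in>UNIV. of_nat (l choose \<theta> i) * (- 1 / of_nat l) ^ \<theta> i * (z $ i) ^ \<theta> i * (w $ i) ^ \<theta> i)"
    by (simp only: prod_sum_PiE[OF finite finite_atMost])
  then show ?thesis unfolding P by (simp add: mpow_def prod.distrib mult.assoc)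
qed

text \<open>The arguments of two points of the upper half-plane add up to an angle strictly between
  0 and 2 pi, so their product is never a positive real number.\<close>

lemma one_minus_uhp_nonzero:
  assumes "Im x > 0" "Im y > 0" "l > 0"
  shows "1 - x * y / of_nat l \<noteq> 0"
proof
  assume "1 - x * y / of_nat l = 0"
  then have xy: "x * y = of_nat l" using assms by (simp add: field_simps)
  have "x \<noteq> 0" using assms by auto
  then have "y = of_nat l / x" using xy by (simp add: field_simps)
  then have "Im y = - (real l * Im x) / (cmod x)\<^sup>2" by (simp add: Im_divide cmod_power2)
  moreover have "- (real l * Im x) / (cmod x)\<^sup>2 < 0" using assms \<open>x \<noteq> 0\<close> by (simp add: divide_neg_pos)
  ultimately show False using assms by simp
qed

lemma jpoly_stable:
  fixes P :: "'n::finite mpolynomial"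
  assumes P: "stable P" and l: "l > 0"
  shows "stable (jpoly l (Poly_Mapping.lookup P)) \<or> jpoly l (Poly_Mapping.lookup P) = 0"
proof -
  define c where "c \<theta> = (\<Prod>i\<in>UNIV. of_nat (l choose \<theta> i) * (- 1 / of_nat l) ^ \<theta> i :: complex)" for \<theta> :: "'n \<Rightarrow> nat"
  define Q where "Q \<theta> = Poly_Mapping.single \<theta> (c \<theta>)" for \<theta> :: "'n \<Rightarrow> nat"
  let ?E = "{\<theta>::'n \<Rightarrow> nat. \<forall>i. \<theta> i \<le> l}"
  let ?R = "\<Sum>\<theta>\<in>?E. poly_scale (Poly_Mapping.lookup P \<theta> * (-1) ^ mdeg \<theta> * of_nat (mfact \<theta>)) (Q \<theta>)"
  have "stable ?R \<or> ?R = 0"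
  proof (rule apolar_stable[OF P finite_bounded_idx])
    fix z w :: "complex ^ 'n" assume zw: "\<forall>i. 0 < Im (z $ i)" "\<forall>i. 0 < Im (w $ i)"
    have "(\<Sum>\<theta>\<in>?E. poly_fun (Q \<theta>) z * mpow w \<theta>) = (\<Prod>i\<in>UNIV. (1 - z $ i * w $ i / of_nat l) ^ l)"
      unfolding prod_binomial[symmetric] by (simp add: Q_def poly_fun_single c_def)
    also have "\<dots> \<noteq> 0" using zw l one_minus_uhp_nonzero by simp
    finally show "(\<Sum>\<theta>\<in>?E. poly_fun (Q \<theta>) z * mpow w \<theta>) \<noteq> 0" .
  qed
  moreover have "?R = jpoly l (Poly_Mapping.lookup P)"
  proof (rule poly_mapping_eqI)
    fix \<eta> :: "'n \<Rightarrow> nat"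
    have "Poly_Mapping.lookup ?R \<eta> = (\<Sum>\<theta>\<in>?E. if \<eta> = \<theta> then Poly_Mapping.lookup P \<theta> * (-1) ^ mdeg \<theta> * of_nat (mfact \<theta>) * c \<theta> else 0)"
      unfolding lookup_sum lookup_poly_scale by (intro sum.cong refl) (auto simp: Q_def lookup_single when_def)
    also have "\<dots> = (if \<eta> \<in> ?E then Poly_Mapping.lookup P \<eta> * (-1) ^ mdeg \<eta> * of_nat (mfact \<eta>) * c \<eta> else 0)"
      by (rule sum.delta') (rule finite_bounded_idx)
    also have "\<dots> = of_real (mults l \<eta>) * Poly_Mapping.lookup P \<eta>"
    proof (cases "\<eta> \<in> ?E")
      case True
      \<comment> \<open>The sign of the apolar pairing cancels the sign in the kernel, and \<theta>!
        times the binomial coefficients over the powers of l is the multiplier.\<close>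
      have "(-1) ^ mdeg \<eta> * of_nat (mfact \<eta>) * c \<eta> = of_real (mults l \<eta>)"
        unfolding mdeg_def power_sum mfact_def c_def mults_def mult1_def of_nat_prod of_real_prod prod.distrib[symmetric]
      proof (intro prod.cong refl)
        fix i
        have "(- 1 / complex_of_nat l) ^ \<eta> i = (-1) ^ \<eta> i / of_nat l ^ \<eta> i" by (rule power_divide)
        then show "(- 1) ^ \<eta> i * complex_of_nat (fact (\<eta> i)) * (complex_of_nat (l choose \<eta> i) * (- 1 / complex_of_nat l) ^ \<eta> i) =
         complex_of_real (real (l choose \<eta> i) * fact (\<eta> i) / real l ^ \<eta> i)"
          by (cases "even (\<eta> i)") (simp_all add: mult_ac)
      qed
      then show ?thesis using True by (simp add: mult_ac)
    next
      case False
      then show ?thesis using mults_eq_0[of \<eta> l] by auto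
    qed
    finally show "Poly_Mapping.lookup ?R \<eta> = Poly_Mapping.lookup (jpoly l (Poly_Mapping.lookup P)) \<eta>"
      by (simp add: lookup_jpoly)
  qed
  ultimately show ?thesis by simp
qed

text \<open>The degrees of the approximating polynomials are unrestricted, but their Jensen
  polynomials all live on the box of exponents at most l, where convergence of coefficients is
  enough.\<close>

lemma jpoly_LP:
  assumes f: "f \<in> LP" and a: "power_series_of a f" and l: "l > 0"
  shows "stable (jpoly l a) \<or> jpoly l a = 0"
proof -
  obtain P where P: "\<And>k. stable (P k)" "\<And>K. compact K \<Longrightarrow> uniform_limit K (\<lambda>k. poly_fun (P k)) f sequentially"
    using f by (auto simp: LP_def)
  have lim: "(\<lambda>k. Poly_Mapping.lookup (P k) \<eta>) \<longlonglongrightarrow> a \<eta>" for \<eta>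
    by (rule coeff_tendsto[OF power_series_poly a P(2)])
  show ?thesis
  proof (rule stable_limit[OF finite_bounded_idx[of l]])
    show "stable (jpoly l (Poly_Mapping.lookup (P k))) \<or> jpoly l (Poly_Mapping.lookup (P k)) = 0" for k
      by (rule jpoly_stable[OF P(1) l])
    show "(\<lambda>k. Poly_Mapping.lookup (jpoly l (Poly_Mapping.lookup (P k))) \<eta>) \<longlonglongrightarrow> Poly_Mapping.lookup (jpoly l a) \<eta>" for \<eta>
      unfolding lookup_jpoly by (intro tendsto_intros lim)
  qed (rule lookup_jpoly_0)
qed

lemma jpoly_uniform_limit:
  assumes "abs_entire a" "bounded K"
  shows "uniform_limit K (\<lambda>k. poly_fun (jpoly (k + N) a)) (series_fun a) sequentially"
proof -
  have "uniform_limit K (\<lambda>k. series_fun (Poly_Mapping.lookup (jpoly (k + N) a))) (series_fun a) sequentially"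
  proof (rule series_uniform_limit[OF assms(1) _ _ assms(2)])
    show "cmod (Poly_Mapping.lookup (jpoly (k + N) a) \<eta>) \<le> cmod (a \<eta>)" for k \<eta>
      using mults_range[of "k + N" \<eta>] by (simp add: lookup_jpoly norm_mult mult_left_le_one_le)
    have "(\<lambda>k. of_real (mults (k + N) \<eta>) * a \<eta>) \<longlonglongrightarrow> of_real 1 * a \<eta>" for \<eta>
      by (intro tendsto_intros LIMSEQ_ignore_initial_segment mults_tendsto)
    then show "(\<lambda>k. Poly_Mapping.lookup (jpoly (k + N) a) \<eta>) \<longlonglongrightarrow> a \<eta>" for \<eta> by (simp add: lookup_jpoly)
  qed
  then show ?thesis by (simp add: series_fun_poly)
qed

text \<open>Converse of \<open>jpoly_LP\<close> for everywhere convergent series. Only large k are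
  assumed, since the rank argument controls only those.\<close>

lemma LP_from_jpoly:
  assumes "abs_entire a" and "\<And>k. k \<ge> N \<Longrightarrow> stable (jpoly k a) \<or> jpoly k a = 0"
  shows "series_fun a \<in> LP"
  by (rule LP_closed[of "\<lambda>k. poly_fun (jpoly (k + N) a)"])
    (use assms in \<open>auto simp: LP_poly_iff entire_series intro: jpoly_uniform_limit compact_imp_bounded\<close>)

section \<open>Symbols of linear operators\<close>

lemma prod_UNIV_sum_type:
  "(\<Prod>k\<in>(UNIV :: ('a::finite + 'b::finite) set). f k) = (\<Prod>i\<in>UNIV. f (Inl i)) * (\<Prod>j\<in>UNIV. f (Inr j))"
  by (simp add: UNIV_Plus_UNIV[symmetric] prod.Plus del: UNIV_Plus_UNIV)

lemma mpow_vconcat: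
  "mpow (z \<oplus>\<^sub>v w) \<zeta> = mpow z (\<zeta> \<circ> Inl) * mpow w (\<zeta> \<circ> Inr)"
  by (simp add: mpow_def prod_UNIV_sum_type vconcat_def)

lemma mfact_sum_type: "mfact \<zeta> = mfact (\<zeta> \<circ> Inl) * mfact (\<zeta> \<circ> Inr)"
  by (simp add: mfact_def prod_UNIV_sum_type)

lemma mdeg_sum_type: "mdeg \<zeta> = mdeg (\<zeta> \<circ> Inl) + mdeg (\<zeta> \<circ> Inr)"
  by (simp add: mdeg_def UNIV_Plus_UNIV[symmetric] sum.Plus del: UNIV_Plus_UNIV)

lemma mults_sum_type: "mults l \<zeta> = mults l (\<zeta> \<circ> Inl) * mults l (\<zeta> \<circ> Inr)"
  by (simp add: mults_def prod_UNIV_sum_type)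

lemma case_sum_o [simp]: "case_sum \<kappa> \<eta> \<circ> Inl = \<kappa>" "case_sum \<kappa> \<eta> \<circ> Inr = \<eta>"
  by (auto simp: fun_eq_iff)

lemma case_sum_eta: "case_sum (\<zeta> \<circ> Inl) (\<zeta> \<circ> Inr) = \<zeta>"
  by (auto simp: fun_eq_iff split: sum.splits)

lemma bij_case_sum: "bij_betw (\<lambda>(\<kappa>, \<eta>). case_sum \<kappa> \<eta>) UNIV UNIV"
  by (rule bij_betwI[of _ _ _ "\<lambda>\<zeta>. (\<zeta> \<circ> Inl, \<zeta> \<circ> Inr)"]) (auto simp: case_sum_eta)

lemma sum_box_split:
  "(\<Sum>\<zeta>\<in>{\<zeta>. \<forall>i. \<zeta> i \<le> l}. F \<zeta>) = (\<Sum>\<theta>\<in>{\<theta>. \<forall>i. \<theta> i \<le> l}. \<Sum>\<kappa>\<in>{\<kappa>. \<forall>i. \<kappa> i \<le> l}. F (case_sum \<kappa> \<theta>))"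
  for F :: "(('a::finite + 'b::finite) \<Rightarrow> nat) \<Rightarrow> 'c::comm_monoid_add"
proof -
  have "(\<Sum>\<theta>\<in>{\<theta>. \<forall>i. \<theta> i \<le> l}. \<Sum>\<kappa>\<in>{\<kappa>. \<forall>i. \<kappa> i \<le> l}. F (case_sum \<kappa> \<theta>))
     = (\<Sum>(\<theta>, \<kappa>)\<in>{\<theta>. \<forall>i. \<theta> i \<le> l} \<times> {\<kappa>. \<forall>i. \<kappa> i \<le> l}. F (case_sum \<kappa> \<theta>))"
    by (rule sum.cartesian_product)
  also have "\<dots> = (\<Sum>\<zeta>\<in>{\<zeta>. \<forall>i. \<zeta> i \<le> l}. F \<zeta>)"
    by (rule sum.reindex_bij_witness[of _ "\<lambda>\<zeta>. (\<zeta> \<circ> Inr, \<zeta> \<circ> Inl)" "\<lambda>(\<theta>, \<kappa>). case_sum \<kappa> \<theta>"])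
      (auto simp: case_sum_eta split: sum.splits)
  finally show ?thesis by simp
qed

lemma abs_entire_slice:
  fixes G :: "('a::finite + 'b::finite) mseries"
  assumes "abs_entire G"
  shows "abs_entire (\<lambda>\<kappa>. G (case_sum \<kappa> \<theta>))"
  unfolding abs_entire_def
proof safe
  fix R :: real assume R: "R \<ge> 0"
  \<comment> \<open>At least 1, so that the additional degree of \<theta> can only increase the
    power.\<close>
  define R' where "R' = max R 1"
  have "(\<lambda>\<zeta>. cmod (G \<zeta>) * R' ^ mdeg \<zeta>) summable_on range (\<lambda>\<kappa>. case_sum \<kappa> \<theta>)"
    using abs_entireD[OF assms, of R'] by (rule summable_on_subset_banach) (auto simp: R'_def)
  moreover have "inj (\<lambda>\<kappa>. case_sum \<kappa> \<theta>)"
    by (rule injI) (metis case_sum_o(1))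
  ultimately have s: "(\<lambda>\<kappa>. cmod (G (case_sum \<kappa> \<theta>)) * R' ^ mdeg (case_sum \<kappa> \<theta>)) summable_on UNIV"
    by (subst (asm) summable_on_reindex) (auto simp: o_def)
  show "(\<lambda>\<kappa>. cmod (G (case_sum \<kappa> \<theta>)) * R ^ mdeg \<kappa>) summable_on UNIV"
  proof (rule summable_on_comparison_test[OF s])
    fix \<kappa> :: "'a \<Rightarrow> nat"
    have "R ^ mdeg \<kappa> \<le> R' ^ mdeg \<kappa>" using R by (intro power_mono) (auto simp: R'_def)
    also have "\<dots> \<le> R' ^ mdeg (case_sum \<kappa> \<theta>)"
      by (intro power_increasing) (auto simp: R'_def mdeg_sum_type[of "case_sum \<kappa> \<theta>"])
    finally show "cmod (G (case_sum \<kappa> \<theta>)) * R ^ mdeg \<kappa> \<le> cmod (G (case_sum \<kappa> \<theta>)) * R' ^ mdeg (case_sum \<kappa> \<theta>)"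
      by (intro mult_left_mono) auto
  qed (use R in auto)
qed

lemma linear_operator_hom:
  assumes "linear_operator T"
  shows "T (P + Q) = T P + T Q" "T (poly_scale c P) = series_scale c (T P)" "T 0 = 0" "T (sum f A) = (\<Sum>x\<in>A. T (f x))"
proof -
  interpret module_hom poly_scale series_scale T
    using assms unfolding linear_operator_def by (rule Vector_Spaces.linear.axioms(3))
  show "T (P + Q) = T P + T Q" "T (poly_scale c P) = series_scale c (T P)" "T 0 = 0" "T (sum f A) = (\<Sum>x\<in>A. T (f x))"
    by (rule add scale zero sum)+
qed

lemma sum_fun_apply: "(\<Sum>x\<in>A. f x) y = (\<Sum>x\<in>A. f x y)" for f :: "'a \<Rightarrow> 'b \<Rightarrow> 'c::comm_monoid_add"
  by (induction A rule: infinite_finite_induct) auto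

lemma poly_as_sum:
  assumes "finite S" "Poly_Mapping.keys P \<subseteq> S"
  shows "P = (\<Sum>\<eta>\<in>S. poly_scale (Poly_Mapping.lookup P \<eta>) (Poly_Mapping.single \<eta> 1))"
proof (rule poly_mapping_eqI)
  fix \<zeta>
  have "Poly_Mapping.lookup (\<Sum>\<eta>\<in>S. poly_scale (Poly_Mapping.lookup P \<eta>) (Poly_Mapping.single \<eta> 1)) \<zeta>
     = (\<Sum>\<eta>\<in>S. if \<eta> = \<zeta> then Poly_Mapping.lookup P \<eta> else 0)"
    unfolding lookup_sum lookup_poly_scale by (intro sum.cong refl) (auto simp: lookup_single when_def)
  also have "\<dots> = (if \<zeta> \<in> S then Poly_Mapping.lookup P \<zeta> else 0)" using assms(1) by (rule sum.delta)
  also have "\<dots> = Poly_Mapping.lookup P \<zeta>" using assms(2) by (auto simp: in_keys_iff)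
  finally show "Poly_Mapping.lookup P \<zeta> = Poly_Mapping.lookup (\<Sum>\<eta>\<in>S. poly_scale (Poly_Mapping.lookup P \<eta>) (Poly_Mapping.single \<eta> 1)) \<zeta>"
    by simp
qed

lemma linear_operator_apply:
  assumes "linear_operator T" "finite S" "Poly_Mapping.keys P \<subseteq> S"
  shows "T P \<kappa> = (\<Sum>\<eta>\<in>S. Poly_Mapping.lookup P \<eta> * T (Poly_Mapping.single \<eta> 1) \<kappa>)"
  by (subst poly_as_sum[OF assms(2,3)])
    (simp add: linear_operator_hom(4,2)[OF assms(1)] sum_fun_apply series_scale_def)

abbreviation signed_symbol :: "('n::finite mpolynomial \<Rightarrow> 'm::finite mseries) \<Rightarrow> ('m + 'n) mseries" where
  "signed_symbol T \<equiv> rescale (1 \<oplus>\<^sub>v (- 1)) (symbol T)"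

lemma mpow_one: "mpow 1 \<eta> = 1"
  by (simp add: mpow_def)

lemma mpow_minus_one: "mpow (- 1 :: complex ^ 'n::finite) \<eta> = (- 1) ^ mdeg \<eta>"
  by (simp add: mpow_def mdeg_def power_sum)

lemma symbol_case_sum: "symbol T (case_sum \<kappa> \<eta>) = T (Poly_Mapping.single \<eta> 1) \<kappa> / of_nat (mfact \<eta>)"
  by (simp add: symbol_def)

lemma signed_symbol_case_sum:
  "signed_symbol T (case_sum \<kappa> \<eta>) = T (Poly_Mapping.single \<eta> 1) \<kappa> / of_nat (mfact \<eta>) * (- 1) ^ mdeg \<eta>"
  by (simp add: rescale_def symbol_case_sum mpow_vconcat mpow_one mpow_minus_one)

lemma mfact_pos: "mfact \<eta> > 0"
  by (auto simp: mfact_def intro!: prod_pos)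

lemma poly_fun_jpoly:
  "poly_fun (jpoly l a) z = (\<Sum>\<eta>\<in>{\<eta>. \<forall>i. \<eta> i \<le> l}. of_real (mults l \<eta>) * a \<eta> * mpow z \<eta>)"
  unfolding series_fun_poly[symmetric]
  by (subst series_fun_finite[OF finite_bounded_idx[of l]]) (auto simp: lookup_jpoly mults_eq_0)

lemma poly_fun_jpoly_vconcat:
  "poly_fun (jpoly l G) (z \<oplus>\<^sub>v w) =
    (\<Sum>\<theta>\<in>{\<theta>. \<forall>i. \<theta> i \<le> l}. poly_fun (jpoly l (\<lambda>\<kappa>. of_real (mults l \<theta>) * G (case_sum \<kappa> \<theta>))) z * mpow w \<theta>)"
  unfolding poly_fun_jpoly sum_box_split sum_distrib_right
  by (intro sum.cong refl) (simp add: mults_sum_type[of _ "case_sum _ _"] mpow_vconcat mult_ac)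

lemma vconcat_uhp:
  assumes "\<forall>i. 0 < Im (z $ i)" "\<forall>i. 0 < Im (w $ i)"
  shows "\<forall>i. 0 < Im ((z \<oplus>\<^sub>v w) $ i)"
  using assms by (auto simp: vconcat_def split: sum.splits)

lemma vconcat_split: "x = (\<chi> i. x $ Inl i) \<oplus>\<^sub>v (\<chi> j. x $ Inr j)"
  by (auto simp: vconcat_def vec_eq_iff split: sum.splits)

lemma jpoly_zero_iff: "jpoly l a = 0 \<longleftrightarrow> (\<forall>\<eta>. (\<forall>i. \<eta> i \<le> l) \<longrightarrow> a \<eta> = 0)"
proof
  assume 0: "jpoly l a = 0"
  show "\<forall>\<eta>. (\<forall>i. \<eta> i \<le> l) \<longrightarrow> a \<eta> = 0"
  proof safe
    fix \<eta> :: "'a \<Rightarrow> nat" assume "\<forall>i. \<eta> i \<le> l"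
    then have "mults l \<eta> > 0" by (intro mults_pos) auto
    moreover have "of_real (mults l \<eta>) * a \<eta> = 0" using arg_cong[OF 0, of "\<lambda>p. Poly_Mapping.lookup p \<eta>"] by (simp add: lookup_jpoly)
    ultimately show "a \<eta> = 0" by simp
  qed
next
  assume "\<forall>\<eta>. (\<forall>i. \<eta> i \<le> l) \<longrightarrow> a \<eta> = 0"
  then have "of_real (mults l \<eta>) * a \<eta> = 0" for \<eta> using mults_eq_0[of \<eta> l] by (cases "\<forall>i. \<eta> i \<le> l") auto
  then show "jpoly l a = 0" by (intro poly_mapping_eqI) (simp only: lookup_jpoly lookup_zero)
qed

text \<open>The symbol is an entire function, so the apolar pairing is applied to its Jensen
  polynomials; the pairing with P then yields T P with damped coefficients, and the damping
  disappears in the limit.\<close>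

lemma symbol_LP_imp_preserver:
  fixes T :: "'n::finite mpolynomial \<Rightarrow> 'm::finite mseries"
  assumes T: "linear_operator T" and G: "signed_symbol T \<in> series_in LP"
  shows "LP_preserver T"
  unfolding LP_preserver_def
proof safe
  fix P :: "'n mpolynomial" assume "poly_fun P \<in> LP"
  then consider "stable P" | "P = 0" using LP_poly_stable by blast
  then show "T P \<in> series_in LP"
  proof cases
    case 2
    have "power_series_of (T P) (\<lambda>z. 0)"
      by (simp add: 2 linear_operator_hom(3)[OF T] power_series_of_def)
    then show ?thesis using LP_zero by (auto simp: series_in_def)
  next
    case 1
    obtain f where f: "f \<in> LP" "power_series_of (signed_symbol T) f" using G by (auto simp: series_in_def)
    have ae: "abs_entire (signed_symbol T)" using f(2) by (rule power_series_imp_abs_entire)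
    have aT: "abs_entire (T (Poly_Mapping.single \<theta> 1))" for \<theta>
    proof -
      have "abs_entire (\<lambda>\<kappa>. (of_nat (mfact \<theta>) * (- 1) ^ mdeg \<theta>) * signed_symbol T (case_sum \<kappa> \<theta>))"
        by (intro abs_entire_scale abs_entire_slice ae)
      moreover have "(\<lambda>\<kappa>. (of_nat (mfact \<theta>) * (- 1) ^ mdeg \<theta>) * signed_symbol T (case_sum \<kappa> \<theta>)) = T (Poly_Mapping.single \<theta> 1)"
        using mfact_pos[of \<theta>] by (auto simp: signed_symbol_case_sum fun_eq_iff power_mult_distrib[symmetric])
      ultimately show ?thesis by simp
    qed
    \<comment> \<open>Coefficients of T P damped by \<open>mults k\<close> both in the input
      exponent \<theta> and in the output exponent \<kappa>, because \<open>mults\<close> factorises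
      over the two groups of variables.\<close>
    define c where "c k \<kappa> = of_real (mults k \<kappa>) * (\<Sum>\<theta>\<in>Poly_Mapping.keys P. of_real (mults k \<theta>) * Poly_Mapping.lookup P \<theta> * T (Poly_Mapping.single \<theta> 1) \<kappa>)" for k \<kappa>
    define R where "R k = jpoly k (\<lambda>\<kappa>. \<Sum>\<theta>\<in>Poly_Mapping.keys P. of_real (mults k \<theta>) * Poly_Mapping.lookup P \<theta> * T (Poly_Mapping.single \<theta> 1) \<kappa>)" for k
    have Rc: "Poly_Mapping.lookup (R k) = c k" for k by (simp add: R_def c_def lookup_jpoly fun_eq_iff)
    have st: "stable (R k) \<or> R k = 0" if k: "k > 0" for k
    proof -
      define Q where "Q \<theta> = jpoly k (\<lambda>\<kappa>. of_real (mults k \<theta>) * signed_symbol T (case_sum \<kappa> \<theta>))" for \<theta>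
      let ?E = "{\<theta>::'n \<Rightarrow> nat. \<forall>i. \<theta> i \<le> k}"
      have Rk: "R k = (\<Sum>\<theta>\<in>?E. poly_scale (Poly_Mapping.lookup P \<theta> * (-1) ^ mdeg \<theta> * of_nat (mfact \<theta>)) (Q \<theta>))"
      proof (rule poly_mapping_eqI)
        fix \<kappa>
        have e: "(Poly_Mapping.lookup P \<theta> * (-1) ^ mdeg \<theta> * of_nat (mfact \<theta>)) * (of_real (mults k \<kappa>) * (of_real (mults k \<theta>) * signed_symbol T (case_sum \<kappa> \<theta>)))
           = of_real (mults k \<kappa>) * (of_real (mults k \<theta>) * Poly_Mapping.lookup P \<theta> * T (Poly_Mapping.single \<theta> 1) \<kappa>)" for \<theta>
          using mfact_pos[of \<theta>] by (cases "even (mdeg \<theta>)") (simp_all add: signed_symbol_case_sum)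
        have "Poly_Mapping.lookup (\<Sum>\<theta>\<in>?E. poly_scale (Poly_Mapping.lookup P \<theta> * (-1) ^ mdeg \<theta> * of_nat (mfact \<theta>)) (Q \<theta>)) \<kappa>
           = of_real (mults k \<kappa>) * (\<Sum>\<theta>\<in>?E. of_real (mults k \<theta>) * Poly_Mapping.lookup P \<theta> * T (Poly_Mapping.single \<theta> 1) \<kappa>)"
          unfolding lookup_sum lookup_poly_scale Q_def lookup_jpoly e sum_distrib_left ..
        also have "(\<Sum>\<theta>\<in>?E. of_real (mults k \<theta>) * Poly_Mapping.lookup P \<theta> * T (Poly_Mapping.single \<theta> 1) \<kappa>)
           = (\<Sum>\<theta>\<in>Poly_Mapping.keys P. of_real (mults k \<theta>) * Poly_Mapping.lookup P \<theta> * T (Poly_Mapping.single \<theta> 1) \<kappa>)"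
          by (rule sum.mono_neutral_cong) (auto simp: finite_bounded_idx mults_eq_0 in_keys_iff)
        finally show "Poly_Mapping.lookup (R k) \<kappa> = Poly_Mapping.lookup (\<Sum>\<theta>\<in>?E. poly_scale (Poly_Mapping.lookup P \<theta> * (-1) ^ mdeg \<theta> * of_nat (mfact \<theta>)) (Q \<theta>)) \<kappa>"
          by (simp add: Rc c_def)
      qed
      from jpoly_LP[OF f k] show ?thesis
      proof
        assume s: "stable (jpoly k (signed_symbol T))"
        show ?thesis unfolding Rk
        proof (rule apolar_stable[OF 1 finite_bounded_idx])
          fix z :: "complex ^ 'm" and w :: "complex ^ 'n" assume zw: "\<forall>i. 0 < Im (z $ i)" "\<forall>i. 0 < Im (w $ i)"
          have "poly_fun (jpoly k (signed_symbol T)) (z \<oplus>\<^sub>v w) \<noteq> 0"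
            using s vconcat_uhp[OF zw] by (simp add: stable_def)
          then show "(\<Sum>\<theta>\<in>?E. poly_fun (Q \<theta>) z * mpow w \<theta>) \<noteq> 0"
            by (simp add: poly_fun_jpoly_vconcat Q_def)
        qed
      next
        \<comment> \<open>Vanishing of the Jensen polynomial kills every symbol coefficient in the
          box, hence all summands of R k.\<close>
        assume "jpoly k (signed_symbol T) = 0"
        then have z: "signed_symbol T \<zeta> = 0" if "\<forall>i. \<zeta> i \<le> k" for \<zeta> using that by (simp add: jpoly_zero_iff)
        have "Q \<theta> = 0" if "\<theta> \<in> ?E" for \<theta>
          unfolding Q_def jpoly_zero_iff using that by (auto intro!: z split: sum.splits)
        then have "R k = 0" unfolding Rk by (intro sum.neutral) auto
        then show ?thesis by simp
      qed
    qed
    \<comment> \<open>A majorant of all c k at once, since the multipliers lie between 0 and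
      1.\<close>
    define g where "g \<kappa> = (\<Sum>\<theta>\<in>Poly_Mapping.keys P. of_real (cmod (Poly_Mapping.lookup P \<theta> * T (Poly_Mapping.single \<theta> 1) \<kappa>)) :: complex)" for \<kappa>
    have sg: "abs_entire (\<lambda>\<kappa>. \<Sum>\<theta>\<in>A. of_real (cmod (Poly_Mapping.lookup P \<theta> * T (Poly_Mapping.single \<theta> 1) \<kappa>)) :: complex)" if "finite A" for A
      using that
    proof (induction A rule: finite_induct)
      case empty
      then show ?case by (simp add: abs_entire_finite)
    next
      case (insert x A)
      have "abs_entire (\<lambda>\<kappa>. of_real (cmod (Poly_Mapping.lookup P x * T (Poly_Mapping.single x 1) \<kappa>)) :: complex)"
        by (rule abs_entire_mono[OF abs_entire_scale[OF aT[of x], of "Poly_Mapping.lookup P x"]]) simp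
      from abs_entire_add[OF this insert.IH] show ?case using insert.hyps by simp
    qed
    have g: "abs_entire g" unfolding g_def by (rule sg) simp
    have cg: "cmod (c k \<kappa>) \<le> cmod (g \<kappa>)" for k \<kappa>
    proof -
      have "cmod (c k \<kappa>) \<le> 1 * (\<Sum>\<theta>\<in>Poly_Mapping.keys P. 1 * cmod (Poly_Mapping.lookup P \<theta> * T (Poly_Mapping.single \<theta> 1) \<kappa>))"
        unfolding c_def norm_mult[of "of_real (mults k \<kappa>)"]
      proof (intro mult_mono order_trans[OF norm_sum] sum_mono)
        fix \<theta>
        show "cmod (of_real (mults k \<theta>) * Poly_Mapping.lookup P \<theta> * T (Poly_Mapping.single \<theta> 1) \<kappa>)
           \<le> 1 * cmod (Poly_Mapping.lookup P \<theta> * T (Poly_Mapping.single \<theta> 1) \<kappa>)"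
          unfolding mult.assoc norm_mult[of "of_real (mults k \<theta>)"] by (intro mult_right_mono) (auto simp: mults_range)
      qed (auto simp: mults_range)
      also have "\<dots> = cmod (g \<kappa>)" unfolding g_def of_real_sum[symmetric] norm_of_real by (simp add: sum_nonneg)
      finally show ?thesis .
    qed
    have TP: "T P \<kappa> = (\<Sum>\<theta>\<in>Poly_Mapping.keys P. Poly_Mapping.lookup P \<theta> * T (Poly_Mapping.single \<theta> 1) \<kappa>)" for \<kappa>
      by (rule linear_operator_apply[OF T]) auto
    have lim: "(\<lambda>k. c (Suc k) \<kappa>) \<longlonglongrightarrow> T P \<kappa>" for \<kappa>
    proof -
      have "(\<lambda>k. c (Suc k) \<kappa>) \<longlonglongrightarrow> of_real 1 * (\<Sum>\<theta>\<in>Poly_Mapping.keys P. of_real 1 * Poly_Mapping.lookup P \<theta> * T (Poly_Mapping.single \<theta> 1) \<kappa>)"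
        unfolding c_def by (intro tendsto_intros LIMSEQ_Suc mults_tendsto)
      then show ?thesis by (simp add: TP)
    qed
    have aTP: "abs_entire (T P)"
      by (rule abs_entire_mono[OF g])
        (use LIMSEQ_le_const2[OF tendsto_norm[OF lim]] cg in blast)
    have "series_fun (T P) \<in> LP"
    proof (rule LP_closed)
      show "poly_fun (R (Suc k)) \<in> LP" for k using st[of "Suc k"] by (simp add: LP_poly_iff)
      show "entire (series_fun (T P))" by (rule entire_series[OF aTP])
      fix K :: "(complex ^ 'm) set" assume K: "compact K"
      have "uniform_limit K (\<lambda>k. series_fun (c (Suc k))) (series_fun (T P)) sequentially"
        by (rule series_uniform_limit[OF g cg lim compact_imp_bounded[OF K]])
      then show "uniform_limit K (\<lambda>k. poly_fun (R (Suc k))) (series_fun (T P)) sequentially"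
        by (simp add: Rc[symmetric] series_fun_poly)
    qed
    then show ?thesis using abs_entire_power_series[OF aTP] by (auto simp: series_in_def)
  qed
qed

section \<open>From preservers to stable Jensen polynomials of the symbol\<close>

text \<open>The only zero of 1 - x y is 1/y, at distance \<delta> > 0 below the half-plane. Hence |x
  - 1/y| is at least \<delta>, and it dominates |x| as well since |1/y| is a fixed multiple of
  \<delta>.\<close>

lemma one_minus_lower_bound:
  assumes "Im y > 0"
  shows "\<exists>c>0. \<forall>x. Im x > 0 \<longrightarrow> c \<le> cmod (1 - x * y) \<and> c * cmod x \<le> cmod (1 - x * y)"
proof -
  have y0: "y \<noteq> 0" using assms by auto
  define \<delta> where "\<delta> = - Im (inverse y)"
  have d: "\<delta> > 0" using assms y0 by (simp add: \<delta>_def divide_pos_pos sum_power2_gt_zero_iff complex_eq_iff)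
  define M where "M = 1 + cmod (inverse y) / \<delta>"
  have M: "M > 0" using d by (simp add: M_def add_pos_nonneg)
  define c where "c = min (cmod y * \<delta>) (cmod y / M)"
  have c: "c > 0" using y0 d M by (simp add: c_def)
  have "c \<le> cmod (1 - x * y) \<and> c * cmod x \<le> cmod (1 - x * y)" if x: "Im x > 0" for x
  proof -
    have e: "cmod (1 - x * y) = cmod y * cmod (x - inverse y)"
    proof -
      have "1 - x * y = - y * (x - inverse y)" using y0 by (simp add: algebra_simps)
      then show ?thesis by (simp only: norm_mult norm_minus_cancel)
    qed
    have 1: "\<delta> \<le> cmod (x - inverse y)"
      using abs_Im_le_cmod[of "x - inverse y"] x by (simp add: \<delta>_def)
    have "cmod x \<le> cmod (x - inverse y) + cmod (inverse y)" using norm_triangle_sub[of x "inverse y"] by simp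
    also have "cmod (inverse y) = cmod (inverse y) / \<delta> * \<delta>" using d by simp
    also have "\<dots> \<le> cmod (inverse y) / \<delta> * cmod (x - inverse y)" using 1 d by (intro mult_left_mono) auto
    finally have "cmod x \<le> M * cmod (x - inverse y)" by (simp add: M_def algebra_simps)
    then have 2: "cmod x / M \<le> cmod (x - inverse y)" using M by (simp add: field_simps)
    have "c \<le> cmod y * \<delta>" by (simp add: c_def)
    also have "\<dots> \<le> cmod (1 - x * y)" unfolding e by (intro mult_left_mono 1) auto
    finally have 3: "c \<le> cmod (1 - x * y)" .
    have "c * cmod x \<le> (cmod y / M) * cmod x" by (intro mult_right_mono) (auto simp: c_def)
    also have "\<dots> = cmod y * (cmod x / M)" by simp
    also have "\<dots> \<le> cmod (1 - x * y)" unfolding e by (intro mult_left_mono 2) auto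
    finally show ?thesis using 3 by blast
  qed
  then show ?thesis using c by blast
qed

text \<open>On the unbounded half-plane product |B| dominates every monomial with exponents at most
  k: each of the k factors in a variable bounds either a constant or that variable. A small multiple
  of f therefore cannot create zeros.\<close>

lemma perturbation:
  fixes w :: "complex ^ 'n::finite" and f :: "'n mpolynomial"
  assumes w: "\<forall>i. 0 < Im (w $ i)" and k: "k > 0"
    and B: "\<And>x. poly_fun B x = (\<Prod>i\<in>UNIV. (1 - x $ i * w $ i / of_nat k) ^ k)"
    and f: "\<And>\<eta>. \<eta> \<in> Poly_Mapping.keys f \<Longrightarrow> \<forall>i. \<eta> i \<le> k"
  shows "\<exists>\<epsilon>>0. stable (B + poly_scale (of_real \<epsilon>) f)"
proof -
  have "\<exists>c>0. \<forall>x. Im x > 0 \<longrightarrow> c \<le> cmod (1 - x * (w $ i / of_nat k)) \<and> c * cmod x \<le> cmod (1 - x * (w $ i / of_nat k))" for i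
    by (rule one_minus_lower_bound) (use w k in simp)
  then obtain c where c: "\<And>i. c i > (0::real)"
    "\<And>i x. Im x > 0 \<Longrightarrow> c i \<le> cmod (1 - x * (w $ i / of_nat k)) \<and> c i * cmod x \<le> cmod (1 - x * (w $ i / of_nat k))" by metis
  define C where "C = (\<Prod>i\<in>UNIV. c i ^ k)"
  have C: "C > 0" unfolding C_def using c(1) by (intro prod_pos) auto
  have Bx: "C * cmod (mpow x \<eta>) \<le> cmod (poly_fun B x)" if x: "\<forall>i. 0 < Im (x $ i)" and \<eta>: "\<forall>i. \<eta> i \<le> k" for x \<eta>
  proof -
    have "C * cmod (mpow x \<eta>) = (\<Prod>i\<in>UNIV. c i ^ k * cmod (x $ i) ^ \<eta> i)"
      by (simp add: C_def norm_mpow prod.distrib)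
    also have "\<dots> \<le> (\<Prod>i\<in>UNIV. cmod (1 - x $ i * (w $ i / of_nat k)) ^ k)"
    proof (intro prod_mono conjI)
      fix i
      let ?r = "cmod (1 - x $ i * (w $ i / of_nat k))"
      have ki: "k = (k - \<eta> i) + \<eta> i" using \<eta> by simp
      have "c i ^ k * cmod (x $ i) ^ \<eta> i = c i ^ (k - \<eta> i) * (c i * cmod (x $ i)) ^ \<eta> i"
        by (subst ki, subst power_add) (simp add: power_mult_distrib)
      also have "\<dots> \<le> ?r ^ (k - \<eta> i) * ?r ^ \<eta> i"
        using c(1)[of i] c(2)[of "x $ i" i] x by (intro mult_mono power_mono) auto
      also have "\<dots> = ?r ^ k" by (subst (3) ki) (simp add: power_add)
      finally show "c i ^ k * cmod (x $ i) ^ \<eta> i \<le> ?r ^ k" .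
      show "0 \<le> c i ^ k * cmod (x $ i) ^ \<eta> i" using c(1)[of i] by simp
    qed
    also have "\<dots> = cmod (poly_fun B x)" by (simp add: B prod_norm[symmetric] norm_power)
    finally show ?thesis .
  qed
  define M where "M = (\<Sum>\<eta>\<in>Poly_Mapping.keys f. cmod (Poly_Mapping.lookup f \<eta>))"
  have M: "M \<ge> 0" by (simp add: M_def sum_nonneg)
  \<comment> \<open>Makes the perturbation at most M / (M + 1) < 1 times |B|.\<close>
  define \<epsilon> where "\<epsilon> = C / (M + 1)"
  have e: "\<epsilon> > 0" using C M by (simp add: \<epsilon>_def)
  have "stable (B + poly_scale (of_real \<epsilon>) f)"
    unfolding stable_def
  proof safe
    fix x :: "complex ^ 'n" assume x: "\<forall>i. 0 < Im (x $ i)"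
      and "poly_fun (B + poly_scale (of_real \<epsilon>) f) x = 0"
    then have "poly_fun B x = - of_real \<epsilon> * poly_fun f x" by (simp add: poly_fun_add poly_fun_scale add_eq_0_iff)
    then have "cmod (poly_fun B x) = \<epsilon> * cmod (poly_fun f x)" using e by (simp add: norm_mult)
    also have "cmod (poly_fun f x) \<le> (\<Sum>\<eta>\<in>Poly_Mapping.keys f. cmod (Poly_Mapping.lookup f \<eta>) * (cmod (poly_fun B x) / C))"
      unfolding poly_fun_def[of f]
    proof (rule sum_norm_le)
      fix \<eta> assume "\<eta> \<in> Poly_Mapping.keys f"
      from Bx[OF x f[OF this]] have "cmod (mpow x \<eta>) \<le> cmod (poly_fun B x) / C" using C by (simp add: field_simps)
      then show "cmod (Poly_Mapping.lookup f \<eta> * mpow x \<eta>) \<le> cmod (Poly_Mapping.lookup f \<eta>) * (cmod (poly_fun B x) / C)"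
        unfolding norm_mult by (intro mult_left_mono) auto
    qed
    also have "\<dots> = M * (cmod (poly_fun B x) / C)" unfolding M_def by (rule sum_distrib_right[symmetric])
    finally have "cmod (poly_fun B x) \<le> \<epsilon> * (M * (cmod (poly_fun B x) / C))" using e by simp
    also have "\<dots> = cmod (poly_fun B x) * (M / (M + 1))" using C by (simp add: \<epsilon>_def)
    finally have "cmod (poly_fun B x) * (1 - M / (M + 1)) \<le> 0" by (simp add: algebra_simps)
    moreover have "1 - M / (M + 1) > 0" using M by (simp add: field_simps)
    moreover have "poly_fun B x \<noteq> 0"
      unfolding B using one_minus_uhp_nonzero x w k by simp
    ultimately show False by (simp add: mult_le_0_iff)
  qed
  then show ?thesis using e by blast
qed

text \<open>Condenses linear independence of two formal series into two coefficient positions, which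
  survive truncation to a large box.\<close>

lemma independent_pair_minor:
  fixes u v :: "'m mseries"
  assumes uv: "u \<noteq> v" and ind: "\<not> module.dependent series_scale {u, v}"
  shows "\<exists>\<kappa>1 \<kappa>2. u \<kappa>1 * v \<kappa>2 \<noteq> u \<kappa>2 * v \<kappa>1"
proof (rule ccontr)
  assume "\<not> ?thesis"
  then have m: "u \<kappa>1 * v \<kappa>2 = u \<kappa>2 * v \<kappa>1" for \<kappa>1 \<kappa>2 by blast
  have "u \<noteq> 0" using ind mseries_vs.dependent_zero by blast
  then obtain \<kappa>1 where k: "u \<kappa>1 \<noteq> 0" by (auto simp: fun_eq_iff zero_fun_def)
  have "v = series_scale (v \<kappa>1 / u \<kappa>1) u"
    using k m[of \<kappa>1] by (auto simp: series_scale_def fun_eq_iff field_simps)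
  then have "v \<in> mseries_vs.span {u}"
    using mseries_vs.span_scale[OF mseries_vs.span_base] by (metis insertI1)
  moreover have "{u, v} - {v} = {u}" using uv by auto
  ultimately have "mseries_vs.dependent {u, v}"
    unfolding mseries_vs.dependent_def by (intro bexI[of _ v]) auto
  then show False using ind by simp
qed

text \<open>A zero (z,w) of the Jensen polynomial forces the image of B = \<Prod> (1 - x_i w_i/k)^k
  to vanish up to degree k in each variable. Perturbing B then shows that the truncated images of
  all polynomials in the box are stable or zero, and so span at most one dimension, against the
  rank.\<close>

lemma preserver_imp_jpoly_stable:
  fixes T :: "'n::finite mpolynomial \<Rightarrow> 'm::finite mseries"
  assumes T: "linear_operator T" and rank: "rank_at_least 2 T" and pres: "LP_preserver T"
  shows "\<exists>N. \<forall>k\<ge>N. stable (jpoly k (signed_symbol T))"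
proof -
  obtain S where S: "S \<subseteq> range T" "card S = 2" "\<not> module.dependent series_scale S"
    using rank by (auto simp: rank_at_least_def)
  then obtain u v where uv: "S = {u, v}" "u \<noteq> v" by (auto simp: card_2_iff)
  obtain f1 f2 where f: "u = T f1" "v = T f2" using S uv by auto
  obtain \<kappa>1 \<kappa>2 where minor: "u \<kappa>1 * v \<kappa>2 \<noteq> u \<kappa>2 * v \<kappa>1"
    using independent_pair_minor[OF uv(2)] S(3) uv(1) by blast
  have bnd: "\<exists>N. \<forall>\<eta>\<in>A. \<forall>i. \<eta> i \<le> N" if "finite A" for A :: "('k::finite \<Rightarrow> nat) set"
    by (rule exI[of _ "Max ((\<lambda>(\<eta>, i). \<eta> i) ` (A \<times> UNIV))"]) (use that in \<open>force intro!: Max_ge\<close>)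
  obtain N1 where N1: "\<forall>\<eta>\<in>Poly_Mapping.keys f1 \<union> Poly_Mapping.keys f2. \<forall>i. \<eta> i \<le> N1" using bnd[of "Poly_Mapping.keys f1 \<union> Poly_Mapping.keys f2"] by auto
  obtain N2 where N2: "\<forall>\<eta>\<in>{\<kappa>1, \<kappa>2}. \<forall>i. \<eta> i \<le> N2" using bnd[of "{\<kappa>1, \<kappa>2}"] by auto
  \<comment> \<open>The box must contain the exponents of f1 and f2, so that they are admissible
    perturbations, and both positions of the non-zero minor.\<close>
  have "stable (jpoly k (signed_symbol T))" if k: "k \<ge> max 1 (max N1 N2)" for k
  proof (rule ccontr)
    assume "\<not> stable (jpoly k (signed_symbol T))"
    then obtain x where x: "\<forall>i. 0 < Im (x $ i)" "poly_fun (jpoly k (signed_symbol T)) x = 0" by (auto simp: stable_def)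
    define z where "z = (\<chi> i. x $ Inl i)"
    define w where "w = (\<chi> j. x $ Inr j)"
    have zw: "\<forall>i. 0 < Im (z $ i)" "\<forall>i. 0 < Im (w $ i)" "x = z \<oplus>\<^sub>v w"
      using x(1) vconcat_split[of x] by (auto simp: z_def w_def)
    have k0: "k > 0" using k by simp
    let ?E = "{\<theta>::'n \<Rightarrow> nat. \<forall>i. \<theta> i \<le> k}"
    \<comment> \<open>The Taylor coefficients of exp (- \<Sum> x_i w_i), whose Jensen polynomial is
      the product of the (1 - x_i w_i/k)^k.\<close>
    define b where "b \<eta> = (-1) ^ mdeg \<eta> / of_nat (mfact \<eta>) * mpow w \<eta>" for \<eta>
    define B where "B = jpoly k b"
    have coef: "of_real (mults k \<eta>) * ((-1) ^ mdeg \<eta> / of_nat (mfact \<eta>)) = (\<Prod>i\<in>UNIV. of_nat (k choose \<eta> i) * (- 1 / of_nat k) ^ \<eta> i :: complex)" for \<eta> :: "'n \<Rightarrow> nat"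
      unfolding mdeg_def power_sum mfact_def mults_def mult1_def of_nat_prod of_real_prod prod.distrib[symmetric] prod_dividef[symmetric]
    proof (intro prod.cong refl)
      fix i
      have "(- 1 / complex_of_nat k) ^ \<eta> i = (-1) ^ \<eta> i / of_nat k ^ \<eta> i" by (rule power_divide)
      then show "complex_of_real (real (k choose \<eta> i) * fact (\<eta> i) / real k ^ \<eta> i) * ((- 1) ^ \<eta> i / complex_of_nat (fact (\<eta> i)))
        = complex_of_nat (k choose \<eta> i) * (- 1 / complex_of_nat k) ^ \<eta> i" by simp
    qed
    have Bfun: "poly_fun B y = (\<Prod>i\<in>UNIV. (1 - y $ i * w $ i / of_nat k) ^ k)" for y
      unfolding prod_binomial[symmetric] B_def poly_fun_jpoly b_def coef[symmetric]
      by (intro sum.cong refl) (simp add: mult_ac)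
    have LPj: "stable (jpoly k (T P)) \<or> jpoly k (T P) = 0" if "stable P" for P
    proof -
      have "T P \<in> series_in LP" using pres LP_stable[OF that] by (auto simp: LP_preserver_def)
      then show ?thesis using jpoly_LP k0 by (auto simp: series_in_def)
    qed
    have stB: "stable B"
      unfolding stable_def Bfun using one_minus_uhp_nonzero zw(2) k0 by simp
    have "poly_fun (jpoly k (T B)) z = poly_fun (jpoly k (signed_symbol T)) (z \<oplus>\<^sub>v w)"
    proof -
      have TB: "T B \<kappa> = (\<Sum>\<theta>\<in>?E. of_real (mults k \<theta>) * b \<theta> * T (Poly_Mapping.single \<theta> 1) \<kappa>)" for \<kappa>
        by (subst linear_operator_apply[OF T finite_bounded_idx[of k]])
          (auto simp: B_def lookup_jpoly in_keys_iff mults_eq_0, metis mults_eq_0)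
      have "poly_fun (jpoly k (T B)) z = (\<Sum>\<kappa>\<in>{\<kappa>. \<forall>i. \<kappa> i \<le> k}. \<Sum>\<theta>\<in>?E. of_real (mults k \<kappa>) * (of_real (mults k \<theta>) * b \<theta> * T (Poly_Mapping.single \<theta> 1) \<kappa>) * mpow z \<kappa>)"
        by (simp add: poly_fun_jpoly TB sum_distrib_left sum_distrib_right)
      also have "\<dots> = (\<Sum>\<theta>\<in>?E. \<Sum>\<kappa>\<in>{\<kappa>. \<forall>i. \<kappa> i \<le> k}. of_real (mults k \<kappa>) * (of_real (mults k \<theta>) * b \<theta> * T (Poly_Mapping.single \<theta> 1) \<kappa>) * mpow z \<kappa>)"
        by (rule sum.swap)
      also have "\<dots> = poly_fun (jpoly k (signed_symbol T)) (z \<oplus>\<^sub>v w)"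
        unfolding poly_fun_jpoly_vconcat unfolding poly_fun_jpoly sum_distrib_right
        by (intro sum.cong refl) (simp add: signed_symbol_case_sum b_def mult_ac)
      finally show ?thesis .
    qed
    then have "poly_fun (jpoly k (T B)) z = 0" using x zw by simp
    then have "\<not> stable (jpoly k (T B))" using zw by (auto simp: stable_def)
    then have TB0: "jpoly k (T B) = 0" using LPj[OF stB] by blast
    \<comment> \<open>B has image zero after truncation, so the image of the stable polynomial B +
      \<epsilon> g is just \<epsilon> times that of g.\<close>
    have all: "stable (jpoly k (T g)) \<or> jpoly k (T g) = 0" if g: "\<And>\<eta>. \<eta> \<in> Poly_Mapping.keys g \<Longrightarrow> \<forall>i. \<eta> i \<le> k" for g
    proof -
      obtain \<epsilon> where e: "\<epsilon> > 0" "stable (B + poly_scale (of_real \<epsilon>) g)"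
        using perturbation[OF zw(2) k0 Bfun g] by blast
      have "jpoly k (T (B + poly_scale (of_real \<epsilon>) g)) = poly_scale (of_real \<epsilon>) (jpoly k (T g))"
      proof (rule poly_mapping_eqI)
        fix \<eta>
        have "of_real (mults k \<eta>) * T B \<eta> = 0"
          using arg_cong[OF TB0, of "\<lambda>p. Poly_Mapping.lookup p \<eta>"] by (simp add: lookup_jpoly)
        then show "Poly_Mapping.lookup (jpoly k (T (B + poly_scale (of_real \<epsilon>) g))) \<eta> = Poly_Mapping.lookup (poly_scale (of_real \<epsilon>) (jpoly k (T g))) \<eta>"
          by (auto simp: lookup_jpoly lookup_poly_scale linear_operator_hom(1,2)[OF T] series_scale_def)
      qed
      then have "stable (poly_scale (of_real \<epsilon>) (jpoly k (T g))) \<or> poly_scale (of_real \<epsilon>) (jpoly k (T g)) = 0"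
        using LPj[OF e(2)] by simp
      then show ?thesis
      proof
        assume "stable (poly_scale (of_real \<epsilon>) (jpoly k (T g)))"
        then show ?thesis by (auto simp: stable_def poly_fun_scale)
      next
        assume "poly_scale (of_real \<epsilon>) (jpoly k (T g)) = 0"
        then have "jpoly k (T g) = 0" using e(1) by simp
        then show ?thesis by simp
      qed
    qed
    define p where "p g = poly_fun (jpoly k (T g)) (\<chi> i. \<i>)" for g
    \<comment> \<open>A non-trivial combination whose truncated image vanishes at (\<i>, ..., \<i>);
      being unstable it must be zero, and then the minor vanishes.\<close>
    obtain a b where ab: "a * p f1 + b * p f2 = 0" "a \<noteq> 0 \<or> b \<noteq> 0"
    proof (cases "p f1 = 0")
      case True
      then show ?thesis using that[of 1 0] by simp
    next
      case False
      then show ?thesis using that[of "p f2" "- p f1"] by simp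
    qed
    define g where "g = poly_scale a f1 + poly_scale b f2"
    have Tg: "T g \<kappa> = a * u \<kappa> + b * v \<kappa>" for \<kappa>
      by (simp add: g_def linear_operator_hom(1,2)[OF T] series_scale_def f)
    have "Poly_Mapping.keys g \<subseteq> Poly_Mapping.keys f1 \<union> Poly_Mapping.keys f2"
      by (auto simp: g_def in_keys_iff lookup_add lookup_poly_scale)
    then have "\<forall>i. \<eta> i \<le> k" if "\<eta> \<in> Poly_Mapping.keys g" for \<eta>
      using that N1 k by (meson max.boundedE order_trans subsetD)
    then have "stable (jpoly k (T g)) \<or> jpoly k (T g) = 0" by (rule all)
    moreover have "poly_fun (jpoly k (T g)) (\<chi> i. \<i>) = a * p f1 + b * p f2"
      unfolding p_def poly_fun_jpoly sum_distrib_left sum.distrib[symmetric]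
      by (intro sum.cong refl) (simp add: Tg f algebra_simps)
    then have "\<not> stable (jpoly k (T g))" using ab(1) by (auto simp: stable_def intro!: exI[of _ "\<chi> i. \<i>"])
    ultimately have "jpoly k (T g) = 0" by blast
    moreover have "\<forall>i. \<kappa>1 i \<le> k" "\<forall>i. \<kappa>2 i \<le> k" using N2 k by (auto intro: order_trans)
    ultimately have "a * u \<kappa>1 + b * v \<kappa>1 = 0" "a * u \<kappa>2 + b * v \<kappa>2 = 0"
      unfolding jpoly_zero_iff Tg by blast+
    then have "a * (u \<kappa>1 * v \<kappa>2 - u \<kappa>2 * v \<kappa>1) = 0" "b * (u \<kappa>1 * v \<kappa>2 - u \<kappa>2 * v \<kappa>1) = 0" by algebra+
    then show False using minor ab(2) by auto
  qed
  then show ?thesis by blast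
qed

section \<open>Coefficient growth of limits of stable polynomials\<close>

lemma prod_node_distances:
  fixes j d :: nat
  assumes "j \<le> d"
  shows "(\<Prod>i\<in>{..d} - {j}. \<bar>real j - real i\<bar>) = fact j * fact (d - j)"
proof -
  have S: "{..d} - {j} = {..<j} \<union> {j<..d}" using assms by auto
  have "(\<Prod>i\<in>{..d} - {j}. \<bar>real j - real i\<bar>) = (\<Prod>i<j. \<bar>real j - real i\<bar>) * (\<Prod>i\<in>{j<..d}. \<bar>real j - real i\<bar>)"
    unfolding S by (rule prod.union_disjoint) auto
  also have "(\<Prod>i<j. \<bar>real j - real i\<bar>) = (\<Prod>i<j. real (j - i))" by (intro prod.cong) auto
  also have "\<dots> = fact j" by (simp add: fact_prod_rev atLeast0LessThan)
  also have "(\<Prod>i\<in>{j<..d}. \<bar>real j - real i\<bar>) = (\<Prod>i\<in>{1..d - j}. real i)"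
    by (rule prod.reindex_bij_witness[of _ "\<lambda>i. i + j" "\<lambda>i. i - j"]) auto
  also have "\<dots> = fact (d - j)" by (simp add: fact_prod)
  finally show ?thesis .
qed

text \<open>A single term of the exponential series at d, together with e \<le> 3.\<close>

lemma power_self_le_exp_fact: "real d ^ d \<le> 3 ^ d * fact d"
proof -
  have "real d ^ d / fact d \<le> exp (real d)"
  proof -
    have "(\<Sum>n\<in>{d}. real d ^ n /\<^sub>R fact n) \<le> suminf (\<lambda>n. real d ^ n /\<^sub>R fact n)"
      by (rule sum_le_suminf[OF summable_exp_generic]) auto
    then show ?thesis by (simp add: exp_def field_simps)
  qed
  also have "exp (real d) = exp 1 ^ d" by (simp add: exp_of_nat_mult[symmetric])
  also have "\<dots> \<le> 3 ^ d" using exp_le by (intro power_mono) auto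
  finally show ?thesis by (simp add: field_simps)
qed

text \<open>
  Lagrange interpolation at the nodes \<open>1 + j/d\<close>.
\<close>

lemma lagrange_bound:
  fixes q :: "complex poly"
  assumes deg: "degree q \<le> d" and d: "d > 0" and M: "\<And>j. j \<le> d \<Longrightarrow> cmod (poly q (of_real (1 + real j / real d))) \<le> M"
    and x: "cmod x \<le> 1"
  shows "cmod (poly q x) \<le> M * 18 ^ d"
proof -
  define X where "X j = complex_of_real (1 + real j / real d)" for j
  have Xinj: "X i = X j \<longleftrightarrow> i = j" for i j
  proof -
    have "X i = X j \<longleftrightarrow> real i / real d = real j / real d" unfolding X_def of_real_eq_iff by linarith
    then show ?thesis using d by simp
  qed
  define D where "D j = (\<Prod>i\<in>{..d} - {j}. X j - X i)" for j
  define L where "L = (\<Sum>j\<le>d. smult (poly q (X j) / D j) (\<Prod>i\<in>{..d} - {j}. [:- X i, 1:]))"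
  have D0: "D j \<noteq> 0" if "j \<le> d" for j unfolding D_def using Xinj by auto
  have degL: "degree L \<le> d"
    unfolding L_def
  proof (rule degree_sum_le)
    fix j assume j: "j \<in> {..d}"
    have "degree (\<Prod>i\<in>{..d} - {j}. [:- X i, 1:]) \<le> (\<Sum>i\<in>{..d} - {j}. degree [:- X i, 1:])"
      by (rule degree_prod_sum_le[unfolded o_def]) simp
    also have "\<dots> \<le> d" using j by simp
    finally show "degree (smult (poly q (X j) / D j) (\<Prod>i\<in>{..d} - {j}. [:- X i, 1:])) \<le> d"
      by (rule order_trans[OF degree_smult_le])
  qed simp
  have "q = L"
  proof (rule poly_eqI_degree[of "X ` {..d}"])
    show "card (X ` {..d}) > degree q" "card (X ` {..d}) > degree L"
      using deg degL by (subst card_image; auto simp: inj_on_def Xinj)+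
    fix y assume "y \<in> X ` {..d}"
    then obtain k where k: "k \<le> d" "y = X k" by auto
    have "poly L (X k) = (\<Sum>j\<le>d. if j = k then poly q (X k) else 0)"
      unfolding L_def poly_sum
    proof (rule sum.cong[OF refl])
      fix j assume j: "j \<in> {..d}"
      show "poly (smult (poly q (X j) / D j) (\<Prod>i\<in>{..d} - {j}. [:- X i, 1:])) (X k) = (if j = k then poly q (X k) else 0)"
      proof (cases "j = k")
        case True
        have "poly (\<Prod>i\<in>{..d} - {j}. [:- X i, 1:]) (X k) = D k" by (simp add: poly_prod D_def True)
        then show ?thesis using True D0[OF k(1)] by simp
      next
        case False
        have "poly (\<Prod>i\<in>{..d} - {j}. [:- X i, 1:]) (X k) = 0"
          unfolding poly_prod using k False by (intro prod_zero) auto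
        then show ?thesis using False by simp
      qed
    qed
    also have "\<dots> = poly q (X k)" using k by simp
    finally show "poly q y = poly L y" using k by simp
  qed
  have M0: "M \<ge> 0" using M[of 0] norm_ge_zero order_trans by blast
  have Dj: "cmod (D j) = fact j * fact (d - j) / real d ^ d" if "j \<le> d" for j
  proof -
    have "cmod (D j) = (\<Prod>i\<in>{..d} - {j}. \<bar>real j - real i\<bar> / real d)"
      unfolding D_def prod_norm[symmetric]
    proof (rule prod.cong[OF refl])
      fix i
      have "X j - X i = of_real ((real j - real i) / real d)" by (simp add: X_def diff_divide_distrib)
      then show "cmod (X j - X i) = \<bar>real j - real i\<bar> / real d" by (simp only: norm_of_real) simp
    qed
    also have "\<dots> = fact j * fact (d - j) / real d ^ d"
      using that by (simp add: prod_dividef prod_node_distances)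
    finally show ?thesis .
  qed
  \<comment> \<open>18 = 3 * 3 * 2: each factor x - X i is at most 3, d^d / d! is at most 3^d, and
    the reciprocal node products sum to binomial coefficients of total 2^d.\<close>
  have "cmod (poly q x) \<le> (\<Sum>j\<le>d. M * (3 ^ d * real d ^ d / fact d) * real (d choose j))"
    unfolding \<open>q = L\<close>[symmetric]
  proof -
    have "poly q x = (\<Sum>j\<le>d. poly q (X j) / D j * (\<Prod>i\<in>{..d} - {j}. x - X i))"
      by (subst \<open>q = L\<close>) (simp add: L_def poly_sum poly_prod)
    also have "cmod \<dots> \<le> (\<Sum>j\<le>d. M * (3 ^ d * real d ^ d / fact d) * real (d choose j))"
    proof (rule sum_norm_le)
      fix j assume "j \<in> {..d}"
      then have j: "j \<le> d" by simp
      have "cmod (\<Prod>i\<in>{..d} - {j}. x - X i) = (\<Prod>i\<in>{..d} - {j}. cmod (x - X i))" by (rule prod_norm[symmetric])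
      also have "\<dots> \<le> (\<Prod>i\<in>{..d} - {j}. 3)"
      proof (rule prod_mono, safe)
        fix i assume i: "i \<le> d"
        have "cmod (X i) \<le> 2" unfolding X_def norm_of_real using i d by simp
        then show "cmod (x - X i) \<le> 3" using norm_triangle_ineq4[of x "X i"] x by linarith
      qed simp
      also have "\<dots> = 3 ^ d" using j by simp
      finally have 3: "cmod (\<Prod>i\<in>{..d} - {j}. x - X i) \<le> 3 ^ d" .
      have "cmod (poly q (X j) / D j * (\<Prod>i\<in>{..d} - {j}. x - X i)) = cmod (poly q (X j)) / cmod (D j) * cmod (\<Prod>i\<in>{..d} - {j}. x - X i)"
        by (simp add: norm_mult norm_divide)
      also have "\<dots> \<le> M / cmod (D j) * 3 ^ d"
        using M[OF j] M0 3 by (intro mult_mono divide_right_mono) (auto simp: X_def)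
      also have "\<dots> = M * (3 ^ d * real d ^ d / fact d) * real (d choose j)"
        using binomial_fact[OF j, where ?'a = real] by (simp add: Dj[OF j] field_simps)
      finally show "cmod (poly q (X j) / D j * (\<Prod>i\<in>{..d} - {j}. x - X i)) \<le> M * (3 ^ d * real d ^ d / fact d) * real (d choose j)" .
    qed
    finally show ?thesis .
  qed
  also have "\<dots> = M * (3 ^ d * real d ^ d / fact d) * 2 ^ d"
  proof -
    have "(\<Sum>j\<le>d. real (d choose j)) = 2 ^ d"
      using choose_row_sum[of d] by (metis of_nat_sum of_nat_power of_nat_numeral)
    then show ?thesis by (simp only: sum_distrib_left[symmetric])
  qed
  also have "\<dots> \<le> M * (3 ^ d * 3 ^ d) * 2 ^ d"
    using power_self_le_exp_fact[of d] M0 by (intro mult_right_mono mult_left_mono) (auto simp: field_simps)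
  also have "\<dots> = M * 18 ^ d" by (simp add: power_mult_distrib[symmetric])
  finally show ?thesis .
qed

text \<open>Coordinates move one at a time from the interval [1,2], where the bound is known, to the
  unit disc; each move costs the one-variable factor 18^d.\<close>

lemma lagrange_bound_multi:
  fixes q :: "complex ^ 'n::finite \<Rightarrow> complex"
  assumes pol: "\<And>z i. \<exists>p. degree p \<le> d \<and> (\<forall>t. poly p t = q (\<chi> j. if j = i then t else z $ j))"
    and d: "d > 0" and M: "\<And>v. (\<And>i. \<exists>s\<in>{1..2}. v $ i = complex_of_real s) \<Longrightarrow> cmod (q v) \<le> M"
    and z: "\<And>i. cmod (z $ i) \<le> 1"
  shows "cmod (q z) \<le> M * 18 ^ (d * CARD('n))"
proof -
  have "cmod (q z) \<le> M * 18 ^ (d * card S)"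
    if "finite S" "\<And>i. i \<in> S \<Longrightarrow> cmod (z $ i) \<le> 1" "\<And>i. i \<notin> S \<Longrightarrow> \<exists>s\<in>{1..2}. z $ i = complex_of_real s" for S z
    using that
  proof (induction S arbitrary: z rule: finite_induct)
    case empty
    then show ?case using M by simp
  next
    case (insert k S)
    obtain p where p: "degree p \<le> d" "\<And>t. poly p t = q (\<chi> j. if j = k then t else z $ j)" using pol by blast
    have "cmod (poly p (z $ k)) \<le> M * 18 ^ (d * card S) * 18 ^ d"
    proof (rule lagrange_bound[OF p(1) d])
      show "cmod (z $ k) \<le> 1" using insert.prems by simp
      fix j assume j: "j \<le> d"
      have r: "1 + real j / real d \<in> {1..2}" using j d by simp
      show "cmod (poly p (of_real (1 + real j / real d))) \<le> M * 18 ^ (d * card S)"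
        unfolding p(2)
      proof (rule insert.IH)
        show "\<exists>s\<in>{1..2}. (\<chi> ja. if ja = k then complex_of_real (1 + real j / real d) else z $ ja) $ i = complex_of_real s"
          if "i \<notin> S" for i
        proof (cases "i = k")
          case True
          then show ?thesis by (intro bexI[OF _ r]) simp
        next
          case False
          then show ?thesis using insert.prems(2)[of i] that by auto
        qed
        show "cmod ((\<chi> ja. if ja = k then complex_of_real (1 + real j / real d) else z $ ja) $ i) \<le> 1" if "i \<in> S" for i
          using insert.prems(1)[of i] insert.hyps(2) that by auto
      qed
    qed
    moreover have "poly p (z $ k) = q z"
      unfolding p(2) by (rule arg_cong[of _ _ q]) (auto simp: vec_eq_iff)
    ultimately show ?case using insert.hyps by (simp add: power_add mult_ac)
  qed
  from this[of UNIV z] show ?thesis using z by simp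
qed

lemma poly_coeff_cauchy:
  fixes p :: "complex poly"
  assumes r: "r > 0" and B: "\<And>t. cmod t = r \<Longrightarrow> cmod (poly p t) \<le> B"
  shows "cmod (coeff p n) \<le> B / r ^ n"
proof -
  have d: "(deriv ^^ n) (poly p) = poly ((pderiv ^^ n) p)" for n
  proof (induction n)
    case (Suc n)
    have "deriv (poly ((pderiv ^^ n) p)) = poly (pderiv ((pderiv ^^ n) p))"
      by (rule ext) (rule DERIV_imp_deriv[OF poly_DERIV])
    then show ?case by (simp add: Suc)
  qed simp
  have "cmod ((deriv ^^ n) (poly p) 0) \<le> fact n * B / r ^ n"
    by (rule Cauchy_inequality[OF _ _ r]) (auto intro!: holomorphic_intros continuous_intros B)
  moreover have "(deriv ^^ n) (poly p) 0 = fact n * coeff p n"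
    unfolding d poly_0_coeff_0 by (simp add: coeff_higher_pderiv pochhammer_fact[symmetric])
  ultimately have "fact n * cmod (coeff p n) \<le> fact n * (B / r ^ n)" by (simp add: norm_mult)
  then show ?thesis by (subst (asm) mult_le_cancel_left_pos) simp_all
qed

lemma mfact_le_fact: "mfact \<eta> \<le> fact (mdeg \<eta>)"
proof -
  have "(\<Prod>i\<in>S. fact (\<eta> i)) \<le> (fact (\<Sum>i\<in>S. \<eta> i) :: nat)" if "finite S" for S
    using that
  proof (induction S rule: finite_induct)
    case (insert x S)
    have "fact (\<eta> x) * (\<Prod>i\<in>S. fact (\<eta> i)) \<le> fact (\<eta> x) * (fact (\<Sum>i\<in>S. \<eta> i) :: nat)"
      by (intro mult_left_mono insert.IH) simp
    also have "\<dots> \<le> fact (\<eta> x + (\<Sum>i\<in>S. \<eta> i))" by (rule dvd_imp_le[OF fact_fact_dvd_fact]) simp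
    finally show ?case using insert.hyps by simp
  qed simp
  then show ?thesis by (simp add: mfact_def mdeg_def)
qed

lemma le_mdeg: "\<eta> i \<le> mdeg \<eta>"
  unfolding mdeg_def by (rule member_le_sum) auto

definition hom :: "nat \<Rightarrow> ('n::finite \<Rightarrow> nat) set" where "hom d = {\<eta>. mdeg \<eta> = d}"

lemma finite_hom: "finite (hom d)"
  by (rule finite_subset[OF _ finite_bounded_idx[of d]]) (auto simp: hom_def intro: le_mdeg)

lemma mpow_scale: "mpow (\<chi> i. t * v $ i) \<eta> = t ^ mdeg \<eta> * mpow v \<eta>" for t :: "'a::comm_semiring_1"
  by (simp add: mpow_def power_mult_distrib prod.distrib mdeg_def power_sum)

definition hom_part :: "'n::finite mseries \<Rightarrow> nat \<Rightarrow> complex ^ 'n \<Rightarrow> complex" where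
  "hom_part a d z = (\<Sum>\<eta>\<in>hom d. a \<eta> * mpow z \<eta>)"

definition hom_poly :: "'n::finite mseries \<Rightarrow> nat \<Rightarrow> 'n mpolynomial" where
  "hom_poly a d = Abs_poly_mapping (\<lambda>\<eta>. if mdeg \<eta> = d then a \<eta> else 0)"

lemma lookup_hom_poly: "Poly_Mapping.lookup (hom_poly a d) \<eta> = (if mdeg \<eta> = d then a \<eta> else 0)"
proof -
  have "finite {\<eta>. (if mdeg \<eta> = d then a \<eta> else 0) \<noteq> 0}"
    by (rule finite_subset[OF _ finite_hom[of d]]) (auto simp: hom_def)
  then show ?thesis unfolding hom_poly_def by (simp add: Poly_Mapping.lookup_Abs_poly_mapping)
qed

lemma poly_fun_hom_poly: "poly_fun (hom_poly a d) z = hom_part a d z"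
  unfolding series_fun_poly[symmetric] hom_part_def
  by (subst series_fun_finite[OF finite_hom[of d]]) (auto simp: lookup_hom_poly hom_def intro!: sum.cong)

text \<open>Interpolation carries the bound from positive real points to the unit polydisc, where
  the Cauchy estimate reads off the coefficient.\<close>

lemma coeff_bound_from_hom_part:
  fixes a :: "'n::finite mseries"
  assumes d: "d > 0" and M: "\<And>v. (\<And>i. \<exists>s\<in>{1..2}. v $ i = complex_of_real s) \<Longrightarrow> cmod (hom_part a d v) \<le> M"
    and \<eta>: "mdeg \<eta> = d"
  shows "cmod (a \<eta>) \<le> M * 18 ^ (d * CARD('n))"
proof -
  have "cmod (Poly_Mapping.lookup (hom_poly a d) \<eta>) \<le> M * 18 ^ (d * CARD('n))"
  proof (rule cauchy_estimate[OF power_series_poly])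
    fix z :: "complex ^ 'n" assume z: "\<And>i. cmod (z $ i) \<le> 1"
    have "cmod (hom_part a d z) \<le> M * 18 ^ (d * CARD('n))"
    proof (rule lagrange_bound_multi[OF _ d M z])
      fix z :: "complex ^ 'n" and i
      define p where "p = (\<Sum>\<eta>\<in>hom d. smult (a \<eta> * (\<Prod>j\<in>UNIV - {i}. z $ j ^ \<eta> j)) (monom 1 (\<eta> i)))"
      have "degree p \<le> d" unfolding p_def
      proof (rule degree_sum_le[OF finite_hom])
        fix \<eta> :: "'n \<Rightarrow> nat" assume "\<eta> \<in> hom d"
        then have "\<eta> i \<le> d" using le_mdeg[of \<eta> i] by (simp add: hom_def)
        then show "degree (smult (a \<eta> * (\<Prod>j\<in>UNIV - {i}. z $ j ^ \<eta> j)) (monom 1 (\<eta> i))) \<le> d"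
          by (intro order_trans[OF degree_smult_le] order_trans[OF degree_monom_le])
      qed
      moreover have "poly p t = hom_part a d (\<chi> j. if j = i then t else z $ j)" for t
        unfolding p_def hom_part_def poly_sum
      proof (rule sum.cong[OF refl])
        fix \<eta> :: "'n \<Rightarrow> nat"
        have "mpow (\<chi> j. if j = i then t else z $ j) \<eta> = t ^ \<eta> i * (\<Prod>j\<in>UNIV - {i}. z $ j ^ \<eta> j)"
          unfolding mpow_def by (subst prod.remove[of _ i]) (auto intro!: prod.cong)
        then show "poly (smult (a \<eta> * (\<Prod>j\<in>UNIV - {i}. z $ j ^ \<eta> j)) (monom 1 (\<eta> i))) t = a \<eta> * mpow (\<chi> j. if j = i then t else z $ j) \<eta>"
          by (simp add: poly_monom)
      qed
      ultimately show "\<exists>p. degree p \<le> d \<and> (\<forall>t. poly p t = hom_part a d (\<chi> j. if j = i then t else z $ j))" by blast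
    qed auto
    then show "cmod (poly_fun (hom_poly a d) z) \<le> M * 18 ^ (d * CARD('n))" by (simp add: poly_fun_hom_poly)
  qed
  then show ?thesis using \<eta> by (simp add: lookup_hom_poly)
qed

text \<open>Along t v with v positive a Jensen polynomial is t^r q(t), where r is the lowest degree
  present in a and q is zero-free in the upper half-plane. Szasz's inequality bounds q uniformly in
  k and v once q(0) is bounded away from 0, and Cauchy's inequality on circles then bounds all
  homogeneous parts.\<close>

lemma szasz_growth:
  fixes a :: "'n::finite mseries"
  assumes a0: "a \<noteq> (\<lambda>_. 0)" and st: "\<And>k. k \<ge> N \<Longrightarrow> stable (jpoly k a)"
  shows "\<exists>C D. D > 0 \<and> (\<forall>\<eta>. cmod (a \<eta>) * sqrt (real (mfact \<eta>)) \<le> C * D ^ mdeg \<eta>)"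
proof -
  define r where "r = (LEAST d. \<exists>\<eta>. mdeg \<eta> = d \<and> a \<eta> \<noteq> 0)"
  have "\<exists>d. \<exists>\<eta>. mdeg \<eta> = d \<and> a \<eta> \<noteq> 0" using a0 by auto
  from LeastI_ex[OF this] obtain \<eta>0 where \<eta>0: "mdeg \<eta>0 = r" "a \<eta>0 \<noteq> 0" unfolding r_def by blast
  have low: "a \<eta> = 0" if "mdeg \<eta> < r" for \<eta>
    using not_less_Least[of "mdeg \<eta>"] that unfolding r_def by blast
  define m where "m k \<eta> = of_real (mults k \<eta>) * a \<eta>" for k and \<eta> :: "'n \<Rightarrow> nat"
  have lj: "Poly_Mapping.lookup (jpoly k a) = m k" for k by (simp add: lookup_jpoly m_def fun_eq_iff)
  have mlim: "(\<lambda>k. m k \<eta>) \<longlonglongrightarrow> a \<eta>" for \<eta>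
  proof -
    have "(\<lambda>k. m k \<eta>) \<longlonglongrightarrow> of_real 1 * a \<eta>" unfolding m_def by (intro tendsto_intros mults_tendsto)
    then show ?thesis by simp
  qed
  have mle: "cmod (m k \<eta>) \<le> cmod (a \<eta>)" for k \<eta>
    using mults_range[of k \<eta>] by (simp add: m_def norm_mult mult_left_le_one_le)
  have mlow: "m k \<eta> = 0" if "mdeg \<eta> < r" for k \<eta> using low[OF that] by (simp add: m_def)

  \<comment> \<open>The lowest homogeneous part is the limit of t^(-r) P(t z) as t decreases to 0.
    Below degree r the truncated difference of exponents is harmless because those coefficients
    vanish.\<close>
  have hk: "stable (hom_poly (m k) r) \<or> hom_poly (m k) r = 0" if k: "k \<ge> N" for k
  proof -
    define F where "F j = Abs_poly_mapping (\<lambda>\<eta>. m k \<eta> * of_real (inverse (real (Suc j))) ^ (mdeg \<eta> - r))" for j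
    have lF: "Poly_Mapping.lookup (F j) \<eta> = m k \<eta> * of_real (inverse (real (Suc j))) ^ (mdeg \<eta> - r)" for j \<eta>
    proof -
      have "finite {\<eta>. m k \<eta> * of_real (inverse (real (Suc j))) ^ (mdeg \<eta> - r) \<noteq> 0}"
        by (rule finite_subset[OF _ finite_lookup[of "jpoly k a"]]) (auto simp: lj)
      then show ?thesis unfolding F_def by (simp add: Poly_Mapping.lookup_Abs_poly_mapping)
    qed
    have stF: "stable (F j)" for j
      unfolding stable_def
    proof safe
      fix z :: "complex ^ 'n" assume z: "\<forall>i. 0 < Im (z $ i)" and 0: "poly_fun (F j) z = 0"
      define t where "t = inverse (real (Suc j))"
      have t: "t > 0" by (simp add: t_def)
      have "poly_fun (jpoly k a) (\<chi> i. of_real t * z $ i) = of_real t ^ r * poly_fun (F j) z"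
      proof -
        have "((\<lambda>\<eta>. of_real t ^ r * (Poly_Mapping.lookup (F j) \<eta> * mpow z \<eta>)) has_sum (of_real t ^ r * poly_fun (F j) z)) UNIV"
          using power_series_poly[of "F j"] by (auto simp: power_series_of_def intro: has_sum_cmult_right)
        moreover have "of_real t ^ r * (Poly_Mapping.lookup (F j) \<eta> * mpow z \<eta>) = m k \<eta> * mpow (\<chi> i. of_real t * z $ i) \<eta>" for \<eta>
        proof (cases "mdeg \<eta> < r")
          case True
          then show ?thesis by (simp add: lF mlow)
        next
          case False
          then have "complex_of_real t ^ mdeg \<eta> = of_real t ^ r * of_real t ^ (mdeg \<eta> - r)" by (simp add: power_add[symmetric])
          then show ?thesis by (simp add: lF mpow_scale t_def[symmetric] del: of_nat_Suc)
        qed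
        ultimately have "((\<lambda>\<eta>. m k \<eta> * mpow (\<chi> i. of_real t * z $ i) \<eta>) has_sum (of_real t ^ r * poly_fun (F j) z)) UNIV" by simp
        moreover have "((\<lambda>\<eta>. m k \<eta> * mpow (\<chi> i. of_real t * z $ i) \<eta>) has_sum (poly_fun (jpoly k a) (\<chi> i. of_real t * z $ i))) UNIV"
          using power_series_poly[of "jpoly k a"] by (simp add: power_series_of_def lj)
        ultimately show ?thesis using has_sum_unique by blast
      qed
      moreover have "poly_fun (jpoly k a) (\<chi> i. of_real t * z $ i) \<noteq> 0"
        using st[OF k] z t by (simp add: stable_def)
      ultimately show False using 0 by simp
    qed
    have limF: "(\<lambda>j. Poly_Mapping.lookup (F j) \<eta>) \<longlonglongrightarrow> Poly_Mapping.lookup (hom_poly (m k) r) \<eta>" for \<eta>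
    proof -
      have "(\<lambda>j. Poly_Mapping.lookup (F j) \<eta>) \<longlonglongrightarrow> m k \<eta> * of_real 0 ^ (mdeg \<eta> - r)"
        unfolding lF by (intro tendsto_intros LIMSEQ_inverse_real_of_nat)
      moreover have "m k \<eta> * of_real 0 ^ (mdeg \<eta> - r) = Poly_Mapping.lookup (hom_poly (m k) r) \<eta>"
        using mlow[of \<eta> k] by (cases "mdeg \<eta>" r rule: linorder_cases) (auto simp: lookup_hom_poly power_0_left)
      ultimately show ?thesis by simp
    qed
    show ?thesis
    proof (rule stable_limit[where P = F])
      show "finite (Poly_Mapping.keys (jpoly k a))" by simp
      show "stable (F j) \<or> F j = 0" for j using stF by simp
      show "Poly_Mapping.lookup (F j) \<eta> = 0" if "\<eta> \<notin> Poly_Mapping.keys (jpoly k a)" for j \<eta>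
        using that by (simp add: lF lj in_keys_iff)
    qed (rule limF)
  qed
  have hlim: "(\<lambda>k. Poly_Mapping.lookup (hom_poly (m (k + n)) d) \<eta>) \<longlonglongrightarrow> Poly_Mapping.lookup (hom_poly a d) \<eta>" for \<eta> d n
    by (cases "mdeg \<eta> = d") (auto simp: lookup_hom_poly intro: LIMSEQ_ignore_initial_segment mlim)
  have "stable (hom_poly a r) \<or> hom_poly a r = 0"
  proof (rule stable_limit[OF finite_hom[of r]])
    show "stable (hom_poly (m (k + N)) r) \<or> hom_poly (m (k + N)) r = 0" for k by (rule hk) simp
    show "Poly_Mapping.lookup (hom_poly (m (k + N)) r) \<eta> = 0" if "\<eta> \<notin> hom r" for k \<eta>
      using that by (simp add: lookup_hom_poly hom_def)
  qed (rule hlim)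
  moreover have "hom_poly a r \<noteq> 0"
  proof
    assume "hom_poly a r = 0"
    then have "Poly_Mapping.lookup (hom_poly a r) \<eta>0 = 0" by simp
    then show False using \<eta>0 by (simp add: lookup_hom_poly)
  qed
  ultimately have sthom: "stable (hom_poly a r)" by blast
  \<comment> \<open>For positive v the point \<i> v lies in the half-plane product, and homogeneity
    changes the value only by the factor \<i>^r.\<close>
  have hom_nz: "hom_part a r v \<noteq> 0" if v: "\<And>i. \<exists>s\<in>{1..2}. v $ i = complex_of_real s" for v
  proof
    assume 0: "hom_part a r v = 0"
    have "hom_part a r (\<chi> i. \<i> * v $ i) = \<i> ^ r * hom_part a r v"
      unfolding hom_part_def sum_distrib_left
      by (intro sum.cong refl) (auto simp: mpow_scale hom_def)
    then have "poly_fun (hom_poly a r) (\<chi> i. \<i> * v $ i) = 0" using 0 by (simp add: poly_fun_hom_poly)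
    moreover have "0 < Im (\<i> * v $ i)" for i using v[of i] by auto
    ultimately show False using sthom by (auto simp: stable_def)
  qed
  define V :: "(complex ^ 'n) set" where "V = {v. \<forall>i. \<exists>s\<in>{1..2}. v $ i = complex_of_real s}"
  have V_D: "\<exists>s\<in>{1..2}. v $ i = complex_of_real s" if "v \<in> V" for v i
    using that unfolding V_def by (simp only: mem_Collect_eq)
  have V_I: "v \<in> V" if "\<And>i. \<exists>s\<in>{1..2}. v $ i = complex_of_real s" for v
    unfolding V_def mem_Collect_eq using that by (rule allI)
  have Veq: "V = cvec ` cbox (\<chi> i. 1) (\<chi> i. 2)"
  proof
    show "V \<subseteq> cvec ` cbox (\<chi> i. 1) (\<chi> i. 2)"
    proof
      fix v assume "v \<in> V"
      then have "\<forall>i. \<exists>s. s \<in> {1..2} \<and> v $ i = complex_of_real s" using V_D by (meson bexE)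
      then obtain s where s: "\<And>i. s i \<in> {1..2}" "\<And>i. v $ i = complex_of_real (s i)" by metis
      then have "v = cvec (\<chi> i. s i)" "(\<chi> i. s i) \<in> cbox (\<chi> i. 1) (\<chi> i. 2)"
        by (auto simp: cvec_def vec_eq_iff mem_box_cart)
      then show "v \<in> cvec ` cbox (\<chi> i. 1) (\<chi> i. 2)" by blast
    qed
    show "cvec ` cbox (\<chi> i. 1) (\<chi> i. 2) \<subseteq> V" by (auto simp: V_def cvec_def mem_box_cart)
  qed
  have compV: "compact V"
    unfolding Veq cvec_def by (intro compact_continuous_image continuous_on_vec_lambda continuous_intros) auto
  have neV: "V \<noteq> {}" unfolding Veq by (auto simp: mem_box_cart interval_ne_empty_cart)
  have "continuous_on V (\<lambda>v. cmod (hom_part a r v))"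
    unfolding hom_part_def mpow_def by (intro continuous_intros)
  from continuous_attains_inf[OF compV neV this] obtain v0 where v0: "v0 \<in> V" "\<And>v. v \<in> V \<Longrightarrow> cmod (hom_part a r v0) \<le> cmod (hom_part a r v)" by blast
  \<comment> \<open>Half of the minimum over the box: the other half absorbs the distance of the
    truncations from their limit.\<close>
  define c where "c = cmod (hom_part a r v0) / 2"
  have "hom_part a r v0 \<noteq> 0" by (rule hom_nz[OF V_D[OF v0(1)]])
  then have c: "c > 0" by (simp add: c_def)
  have "uniform_limit V (\<lambda>k. series_fun (Poly_Mapping.lookup (hom_poly (m (k + N)) r))) (series_fun (Poly_Mapping.lookup (hom_poly a r))) sequentially"
    by (rule finite_support_uniform_limit[OF finite_hom[of r] _ hlim compact_imp_bounded[OF compV]]) (simp add: lookup_hom_poly hom_def)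
  then have "uniform_limit V (\<lambda>k. hom_part (m (k + N)) r) (hom_part a r) sequentially"
    by (simp add: series_fun_poly poly_fun_hom_poly[abs_def])
  from eventually_sequentially[THEN iffD1, OF uniform_limitD[OF this c]] obtain N0 where
    N0: "\<And>k v. k \<ge> N0 \<Longrightarrow> v \<in> V \<Longrightarrow> dist (hom_part (m (k + N)) r v) (hom_part a r v) < c" by blast
  have lower: "c \<le> cmod (hom_part (m k) r v)" if k: "k \<ge> N0 + N" and v: "v \<in> V" for k v
  proof -
    have "dist (hom_part (m k) r v) (hom_part a r v) < c" using N0[of "k - N" v] k v by simp
    moreover have "2 * c \<le> cmod (hom_part a r v)" using v0(2)[OF v] by (simp add: c_def)
    ultimately show ?thesis using norm_triangle_ineq2[of "hom_part a r v" "hom_part a r v - hom_part (m k) r v"]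
      by (simp add: dist_norm norm_minus_commute)
  qed
  define bd where "bd d = (\<Sum>\<eta>\<in>hom d. cmod (a \<eta>) * 2 ^ d)" for d
  have bd: "cmod (hom_part (m k) d v) \<le> bd d" if vV: "v \<in> V" for k d v
    unfolding hom_part_def bd_def
  proof (rule sum_norm_le)
    fix \<eta> :: "'n \<Rightarrow> nat" assume "\<eta> \<in> hom d"
    then have e: "mdeg \<eta> = d" by (simp add: hom_def)
    have "cmod (mpow v \<eta>) \<le> 2 ^ mdeg \<eta>"
    proof (rule norm_mpow_le)
      fix i
      obtain s where "s \<in> {1..2}" "v $ i = complex_of_real s" using V_D[OF vV] by blast
      then show "cmod (v $ i) \<le> 2" by simp
    qed
    then show "cmod (m k \<eta> * mpow v \<eta>) \<le> cmod (a \<eta>) * 2 ^ d"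
      unfolding norm_mult e by (intro mult_mono mle) auto
  qed
  \<comment> \<open>Bounds the three lowest coefficients of q, which are all that
    \<open>szasz\<close> asks for.\<close>
  define b where "b = bd r + bd (r + 1) + bd (r + 2)"
  have bdn: "bd d \<ge> 0" for d by (auto simp: bd_def intro!: sum_nonneg)
  define L where "L = b / c + (3/2 * (b / c)\<^sup>2 + b / c)"
  have b0: "b \<ge> 0" using bdn by (simp add: b_def)
  have L0: "L \<ge> 0" using b0 c by (simp add: L_def)
  \<comment> \<open>Szasz's inequality on the circle of radius \<rho> followed by Cauchy's
    inequality. The estimate \<rho> \<le> 1 + \<rho>^2 merges the linear term of the exponent into
    L.\<close>
  have main: "cmod (hom_part (m k) (r + j) v) \<le> b * exp (L + L * \<rho>\<^sup>2) / \<rho> ^ j"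
    if k: "k \<ge> N0 + N" and v: "v \<in> V" and \<rho>: "\<rho> > 0" for k j v \<rho>
  proof -
    define q where "q = (\<Sum>\<eta>\<in>Poly_Mapping.keys (jpoly k a). monom (m k \<eta> * mpow v \<eta>) (mdeg \<eta> - r))"
    have cq: "coeff q j = hom_part (m k) (r + j) v" for j
    proof -
      have "coeff q j = (\<Sum>\<eta>\<in>Poly_Mapping.keys (jpoly k a). if mdeg \<eta> - r = j then m k \<eta> * mpow v \<eta> else 0)"
        unfolding q_def coeff_sum by (auto intro!: sum.cong simp: coeff_monom)
      also have "\<dots> = (\<Sum>\<eta>\<in>hom (r + j). m k \<eta> * mpow v \<eta>)"
      proof (rule sum.mono_neutral_cong)
        show "finite (hom (r + j))" by (rule finite_hom)
        show "m k \<eta> * mpow v \<eta> = 0" if "\<eta> \<in> hom (r + j) - Poly_Mapping.keys (jpoly k a)" for \<eta>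
          using that by (auto simp: in_keys_iff lj)
        show "(if mdeg \<eta> - r = j then m k \<eta> * mpow v \<eta> else 0) = 0" if "\<eta> \<in> Poly_Mapping.keys (jpoly k a) - hom (r + j)" for \<eta>
          using that mlow[of \<eta> k] by (force simp: in_keys_iff lj hom_def)
        show "(if mdeg \<eta> - r = j then m k \<eta> * mpow v \<eta> else 0) = m k \<eta> * mpow v \<eta>" if "\<eta> \<in> Poly_Mapping.keys (jpoly k a) \<inter> hom (r + j)" for \<eta>
          using that by (auto simp: hom_def)
      qed simp
      finally show ?thesis by (simp add: hom_part_def)
    qed
    have qt: "t ^ r * poly q t = poly_fun (jpoly k a) (\<chi> i. t * v $ i)" for t
      unfolding q_def poly_sum poly_fun_def sum_distrib_left
    proof (rule sum.cong[OF refl])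
      fix \<eta> assume "\<eta> \<in> Poly_Mapping.keys (jpoly k a)"
      then have "r \<le> mdeg \<eta>" using mlow[of \<eta> k] by (auto simp: in_keys_iff lj not_less[symmetric])
      then have "t ^ mdeg \<eta> = t ^ r * t ^ (mdeg \<eta> - r)" by (simp add: power_add[symmetric])
      then show "t ^ r * poly (monom (m k \<eta> * mpow v \<eta>) (mdeg \<eta> - r)) t = Poly_Mapping.lookup (jpoly k a) \<eta> * mpow (\<chi> i. t * v $ i) \<eta>"
        by (simp add: poly_monom lj mpow_scale)
    qed
    have nz: "poly q t \<noteq> 0" if t: "Im t > 0" for t
    proof -
      have "0 < Im (t * v $ i)" for i
      proof -
        obtain s where "s \<in> {1..2}" "v $ i = complex_of_real s" using V_D[OF v] by blast
        then show ?thesis using t by simp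
      qed
      then have "poly_fun (jpoly k a) (\<chi> i. t * v $ i) \<noteq> 0" using st[of k] k by (simp add: stable_def)
      then show ?thesis using qt[of t] by auto
    qed
    have bq: "cmod (coeff q j) \<le> bd (r + j)" for j unfolding cq by (rule bd[OF v])
    have "cmod (poly q t) \<le> b * exp (L + L * \<rho>\<^sup>2)" if t: "cmod t = \<rho>" for t
    proof -
      have "cmod (poly q t) \<le> b * exp (b / c * cmod t + (3/2 * (b / c)\<^sup>2 + b / c) * (cmod t)\<^sup>2)"
      proof (rule szasz[OF nz _ c])
        show "c \<le> cmod (coeff q 0)" using lower[OF k v] by (simp add: cq)
        show "cmod (coeff q 0) \<le> b" "cmod (coeff q 1) \<le> b" "cmod (coeff q 2) \<le> b"
          using bq[of 0] bq[of 1] bq[of 2] bdn[of r] bdn[of "r + 1"] bdn[of "r + 2"] by (auto simp: b_def)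
      qed
      also have "\<dots> \<le> b * exp (L + L * \<rho>\<^sup>2)"
      proof (intro mult_left_mono iffD2[OF exp_le_cancel_iff] b0)
        have "\<rho> \<le> 1 + \<rho>\<^sup>2"
          using sum_squares_bound[of 1 \<rho>] \<rho> by (simp add: power2_eq_square)
        then have "b / c * \<rho> \<le> b / c * (1 + \<rho>\<^sup>2)" using b0 c by (intro mult_left_mono) auto
        moreover have "0 \<le> 3/2 * (b / c)\<^sup>2 + b / c" using b0 c by simp
        ultimately show "b / c * cmod t + (3/2 * (b / c)\<^sup>2 + b / c) * (cmod t)\<^sup>2 \<le> L + L * \<rho>\<^sup>2"
          unfolding t L_def by (simp add: algebra_simps)
      qed
      finally show ?thesis .
    qed
    from poly_coeff_cauchy[OF \<rho> this] show ?thesis by (simp add: cq)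
  qed
  have lim_main: "cmod (hom_part a (r + j) v) \<le> b * exp (L + L * \<rho>\<^sup>2) / \<rho> ^ j"
    if v: "v \<in> V" and \<rho>: "\<rho> > 0" for j v \<rho>
  proof (rule LIMSEQ_le_const2)
    show "(\<lambda>k. cmod (hom_part (m k) (r + j) v)) \<longlonglongrightarrow> cmod (hom_part a (r + j) v)"
      unfolding hom_part_def by (intro tendsto_intros mlim)
    show "\<exists>n. \<forall>k\<ge>n. cmod (hom_part (m k) (r + j) v) \<le> b * exp (L + L * \<rho>\<^sup>2) / \<rho> ^ j"
      using main[OF _ v \<rho>] by blast
  qed
  \<comment> \<open>The second summand covers \<eta> = 0. In D, exp L comes from the growth in
    \<rho>^2 = d, exp r pays for the shift by the lowest degree r, and the power of 18 for
    interpolation.\<close>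
  define C where "C = b * exp L + cmod (a (\<lambda>_. 0))"
  define D where "D = exp L * exp (real r) * 18 ^ CARD('n)"
  have D: "D > 0" by (simp add: D_def)
  have C0: "C \<ge> 0" using b0 by (simp add: C_def)
  have "cmod (a \<eta>) * sqrt (real (mfact \<eta>)) \<le> C * D ^ mdeg \<eta>" for \<eta>
  proof -
    consider "mdeg \<eta> < r" | "mdeg \<eta> = 0" | "mdeg \<eta> \<ge> r" "mdeg \<eta> > 0" by linarith
    then show ?thesis
    proof cases
      case 1
      then show ?thesis using low C0 D by simp
    next
      case 2
      then have "\<eta> = (\<lambda>_. 0)" by (auto simp: mdeg_def fun_eq_iff)
      then show ?thesis using b0 by (simp add: mfact_def mdeg_def C_def)
    next
      case 3
      define d where "d = mdeg \<eta>"
      define j where "j = d - r"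
      have d: "d = r + j" "d > 0" using 3 by (auto simp: d_def j_def)
      \<comment> \<open>With this radius exp (L \<rho>^2) is only geometric in d, while \<rho>^d =
        d^(d/2) matches the square root of \<eta>! \<le> d!. The surplus \<rho>^r is absorbed by exp
        (r d).\<close>
      define \<rho> where "\<rho> = sqrt (real d)"
      have \<rho>: "\<rho> > 0" "\<rho>\<^sup>2 = real d" "\<rho> \<ge> 1" using d by (auto simp: \<rho>_def)
      have "cmod (a \<eta>) \<le> b * exp (L + L * \<rho>\<^sup>2) / \<rho> ^ j * 18 ^ (d * CARD('n))"
      proof (rule coeff_bound_from_hom_part[OF d(2)])
        show "cmod (hom_part a d v) \<le> b * exp (L + L * \<rho>\<^sup>2) / \<rho> ^ j" if "\<And>i. \<exists>s\<in>{1..2}. v $ i = complex_of_real s" for v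
          unfolding d(1) by (rule lim_main[OF V_I \<rho>(1)]) (rule that)
      qed (simp add: d_def)
      moreover have "sqrt (real (mfact \<eta>)) \<le> \<rho> ^ d"
      proof (rule real_le_lsqrt)
        have "real (mfact \<eta>) \<le> real (fact d)" unfolding d_def of_nat_le_iff by (rule mfact_le_fact)
        also have "\<dots> \<le> real d ^ d" using fact_le_power[of d, where ?'a = real] by simp
        also have "\<dots> = (\<rho> ^ d)\<^sup>2" by (simp add: \<rho>(2)[symmetric] power_mult[symmetric] mult.commute)
        finally show "real (mfact \<eta>) \<le> (\<rho> ^ d)\<^sup>2" .
      qed (use \<rho> in auto)
      ultimately have "cmod (a \<eta>) * sqrt (real (mfact \<eta>)) \<le> b * exp (L + L * \<rho>\<^sup>2) / \<rho> ^ j * 18 ^ (d * CARD('n)) * \<rho> ^ d"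
        by (intro mult_mono) (use b0 \<rho> in auto)
      also have "\<dots> = b * exp (L + L * real d) * 18 ^ (d * CARD('n)) * \<rho> ^ r"
      proof -
        have "\<rho> ^ d = \<rho> ^ j * \<rho> ^ r" by (simp add: d(1) power_add)
        then show ?thesis using \<rho> by simp
      qed
      also have "\<dots> \<le> b * exp (L + L * real d) * 18 ^ (d * CARD('n)) * exp (real r) ^ d"
      proof (intro mult_left_mono)
        have "\<rho> \<le> \<rho>\<^sup>2" using \<rho>(3) by (simp add: power2_eq_square)
        also have "\<dots> \<le> exp (real d)" using exp_ge_add_one_self[of "real d"] \<rho>(2) by linarith
        finally have "\<rho> ^ r \<le> exp (real d) ^ r" using \<rho> by (intro power_mono) auto
        also have "\<dots> = exp (real r) ^ d" by (simp add: exp_of_nat_mult[symmetric] mult.commute)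
        finally show "\<rho> ^ r \<le> exp (real r) ^ d" .
      qed (use b0 in auto)
      also have "\<dots> = b * exp L * D ^ d"
      proof -
        have "exp (L + L * real d) = exp L * exp L ^ d" by (simp add: exp_add exp_of_nat_mult[symmetric] mult.commute)
        moreover have "(18::real) ^ (d * CARD('n)) = (18 ^ CARD('n)) ^ d" by (simp add: power_mult[symmetric] mult.commute)
        ultimately show ?thesis unfolding D_def power_mult_distrib by simp
      qed
      also have "\<dots> \<le> C * D ^ d" using D by (intro mult_right_mono) (auto simp: C_def)
      finally show ?thesis by (simp add: d_def)
    qed
  qed
  then show ?thesis using D by blast
qed

section \<open>Fock spaces\<close>

text \<open>Any finite set of multi-indices lies in a box, and sums over boxes factorise into
  one-variable partial sums.\<close>

lemma summable_on_idx_prod: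
  fixes f :: "'n::finite \<Rightarrow> nat \<Rightarrow> real"
  assumes f0: "\<And>i k. f i k \<ge> 0" and f: "\<And>i. f i summable_on UNIV"
  shows "(\<lambda>\<eta>. \<Prod>i\<in>UNIV. f i (\<eta> i)) summable_on UNIV"
proof (rule nonneg_bdd_above_summable_on)
  show "bdd_above (sum (\<lambda>\<eta>. \<Prod>i\<in>UNIV. f i (\<eta> i)) ` {F. F \<subseteq> UNIV \<and> finite F})"
  proof (rule bdd_aboveI2)
    fix F :: "('n \<Rightarrow> nat) set" assume "F \<in> {F. F \<subseteq> UNIV \<and> finite F}"
    then have F: "finite F" by simp
    define N where "N = Max ((\<lambda>(\<theta>,i). \<theta> i) ` (F \<times> UNIV))"
    have N: "\<theta> i \<le> N" if "\<theta> \<in> F" for \<theta> i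
      unfolding N_def by (rule Max_ge) (use that F in auto)
    have "finite (PiE (UNIV :: 'n set) (\<lambda>_. {..N}))" by (rule finite_PiE) auto
    then have "(\<Sum>\<eta>\<in>F. \<Prod>i\<in>UNIV. f i (\<eta> i)) \<le> (\<Sum>\<eta>\<in>PiE UNIV (\<lambda>_. {..N}). \<Prod>i\<in>UNIV. f i (\<eta> i))"
      by (rule sum_mono2) (auto simp: PiE_UNIV_domain N f0 intro!: prod_nonneg)
    also have "\<dots> = (\<Prod>i\<in>UNIV. \<Sum>k\<le>N. f i k)" by (rule prod_sum_PiE[symmetric]) auto
    also have "\<dots> \<le> (\<Prod>i\<in>UNIV. infsum (f i) UNIV)"
      by (intro prod_mono conjI sum_nonneg f0 finite_sum_le_infsum f) auto
    finally show "(\<Sum>\<eta>\<in>F. \<Prod>i\<in>UNIV. f i (\<eta> i)) \<le> (\<Prod>i\<in>UNIV. infsum (f i) UNIV)" .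
  qed
qed (auto intro: prod_nonneg f0)

lemma summable_on_geometric_mdeg: "0 \<le> q \<Longrightarrow> q < 1 \<Longrightarrow> (\<lambda>\<eta>. q ^ mdeg \<eta> :: real) summable_on UNIV"
  using summable_on_idx_prod[of "\<lambda>_ k. q ^ k"]
  by (simp add: mdeg_def power_sum summable_on_UNIV_nonneg_real_iff)

lemma mpow_real_nonneg: "(\<And>i. 0 \<le> c $ i) \<Longrightarrow> 0 \<le> mpow c \<eta>" for c :: "real ^ 'n::finite"
  by (auto simp: mpow_def intro: prod_nonneg)

lemma mpow_real_pos: "pos_vec c \<Longrightarrow> 0 < mpow c \<eta>" for c :: "real ^ 'n::finite"
  by (auto simp: mpow_def pos_vec_def intro: prod_pos)

lemma weight_pos: "pos_vec \<beta> \<Longrightarrow> 0 < real (mfact \<eta>) / mpow \<beta> \<eta>"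
  by (intro divide_pos_pos mpow_real_pos) (simp_all add: mfact_pos)

lemma mpow_scale_square: "mpow (\<chi> i. R\<^sup>2 * \<beta> $ i) \<eta> = (R ^ mdeg \<eta>)\<^sup>2 * mpow \<beta> \<eta>" for R :: real
  unfolding mpow_scale by (simp add: power_mult[symmetric] mult.commute)

lemma summable_on_exp_mpow:
  fixes c :: "real ^ 'n::finite"
  assumes "\<And>i. 0 \<le> c $ i"
  shows "(\<lambda>\<eta>. mpow c \<eta> / real (mfact \<eta>)) summable_on UNIV"
proof -
  have "(\<lambda>k. (c $ i) ^ k / fact k) summable_on UNIV" for i
    using assms summable_exp[of "c $ i"]
    by (subst summable_on_UNIV_nonneg_real_iff) (auto simp: divide_inverse mult.commute)
  then have "(\<lambda>\<eta>. \<Prod>i\<in>UNIV. (c $ i) ^ \<eta> i / fact (\<eta> i)) summable_on UNIV"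
    using assms by (intro summable_on_idx_prod) auto
  then show ?thesis by (simp add: mpow_def mfact_def prod_dividef)
qed

text \<open>With t chosen as a Fock weight this splits a product into a term of a Fock norm and a
  term of an exponential series.\<close>

lemma weighted_am_gm: "t > 0 \<Longrightarrow> x * y \<le> t * x\<^sup>2 + y\<^sup>2 / t" for t x y :: real
proof -
  assume t: "t > 0"
  have "0 \<le> ((t * x - y)\<^sup>2 + (t * x)\<^sup>2 + y\<^sup>2) / (2 * t)" using t by simp
  also have "\<dots> = t * x\<^sup>2 + y\<^sup>2 / t - x * y" using t by (simp add: power2_eq_square field_simps)
  finally show ?thesis by simp
qed

text \<open>The weighted arithmetic-geometric inequality bounds |a \<eta>| R^|\<eta>| by a Fock term
  plus (R^2 \<beta>)^\<eta> / \<eta>!, and both families are summable.\<close>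

lemma fock_abs_entire:
  fixes a :: "'n::finite mseries"
  assumes \<beta>: "pos_vec \<beta>" and s: "fock_term \<beta> a summable_on UNIV"
  shows "abs_entire a"
  unfolding abs_entire_def
proof safe
  fix R :: real assume R: "R \<ge> 0"
  have e: "(\<lambda>\<eta>. mpow (\<chi> i. R\<^sup>2 * \<beta> $ i) \<eta> / real (mfact \<eta>)) summable_on UNIV"
    using \<beta> by (intro summable_on_exp_mpow) (auto simp: pos_vec_def less_imp_le)
  show "(\<lambda>\<eta>. cmod (a \<eta>) * R ^ mdeg \<eta>) summable_on UNIV"
  proof (rule summable_on_comparison_test[OF summable_on_add[OF s e]])
    fix \<eta>
    have t: "real (mfact \<eta>) / mpow \<beta> \<eta> > 0" by (rule weight_pos[OF \<beta>])
    show "cmod (a \<eta>) * R ^ mdeg \<eta> \<le> fock_term \<beta> a \<eta> + mpow (\<chi> i. R\<^sup>2 * \<beta> $ i) \<eta> / real (mfact \<eta>)"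
      using weighted_am_gm[OF t, of "cmod (a \<eta>)" "R ^ mdeg \<eta>"]
      unfolding mpow_scale_square by (simp add: fock_term_def)
  qed (use R in auto)
qed

lemma fock_term_nonneg: "pos_vec \<beta> \<Longrightarrow> 0 \<le> fock_term \<beta> a \<eta>"
  using mpow_real_pos[of \<beta> \<eta>] by (simp add: fock_term_def)

lemma fock_coeffs:
  assumes "f \<in> fock \<beta>"
  shows "power_series_of (taylor_coeffs f) f" "fock_term \<beta> (taylor_coeffs f) summable_on UNIV"
  using assms taylor_coeffs_eq by (auto simp: fock_def)

lemma fockI:
  assumes "pos_vec \<beta>" "fock_term \<beta> a summable_on UNIV"
  shows "series_fun a \<in> fock \<beta>" "taylor_coeffs (series_fun a) = a" "power_series_of a (series_fun a)"
  using fock_abs_entire[OF assms] assms(2) abs_entire_power_series[of a] entire_series[of a] taylor_coeffs_eq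
  by (auto simp: fock_def)

text \<open>The weight 2 D^2 in every variable cancels the growth D^(2|\<eta>|) and leaves the
  geometric series of ratio 1/2.\<close>

lemma growth_imp_fock:
  fixes a :: "'n::finite mseries"
  assumes D: "D > 0" and g: "\<And>\<eta>. cmod (a \<eta>) * sqrt (real (mfact \<eta>)) \<le> C * D ^ mdeg \<eta>"
  shows "fock_term (\<chi> i. 2 * D\<^sup>2) a summable_on UNIV"
proof (rule summable_on_comparison_test)
  show "(\<lambda>\<eta>. C\<^sup>2 * (1/2) ^ mdeg \<eta>) summable_on (UNIV :: ('n \<Rightarrow> nat) set)"
    by (intro summable_on_cmult_right summable_on_geometric_mdeg) auto
  fix \<eta> :: "'n \<Rightarrow> nat"
  have b: "mpow ((\<chi> i. 2 * D\<^sup>2) :: real ^ 'n) \<eta> = 2 ^ mdeg \<eta> * (D ^ mdeg \<eta>)\<^sup>2"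
  proof -
    have "mpow ((\<chi> i. 2 * D\<^sup>2) :: real ^ 'n) \<eta> = (2 * D\<^sup>2) ^ mdeg \<eta>"
      by (simp add: mpow_def mdeg_def power_sum)
    then show ?thesis by (simp add: power_mult_distrib power_mult[symmetric] mult.commute)
  qed
  have "(cmod (a \<eta>))\<^sup>2 * real (mfact \<eta>) = (cmod (a \<eta>) * sqrt (real (mfact \<eta>)))\<^sup>2"
    by (simp add: power_mult_distrib)
  also have "\<dots> \<le> (C * D ^ mdeg \<eta>)\<^sup>2" by (intro power_mono g) simp
  finally have "(cmod (a \<eta>))\<^sup>2 * real (mfact \<eta>) / (2 ^ mdeg \<eta> * (D ^ mdeg \<eta>)\<^sup>2) \<le> (C * D ^ mdeg \<eta>)\<^sup>2 / (2 ^ mdeg \<eta> * (D ^ mdeg \<eta>)\<^sup>2)"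
    using D by (intro divide_right_mono) auto
  also have "\<dots> = C\<^sup>2 * (1/2) ^ mdeg \<eta>" using D by (simp add: power_mult_distrib power_divide)
  finally show "fock_term (\<chi> i. 2 * D\<^sup>2) a \<eta> \<le> C\<^sup>2 * (1/2) ^ mdeg \<eta>"
    by (simp add: fock_term_def b mult.commute)
  show "0 \<le> fock_term (\<chi> i. 2 * D\<^sup>2) a \<eta>" using D by (intro fock_term_nonneg) (simp add: pos_vec_def)
qed

lemma preserver_imp_symbol_fock:
  fixes T :: "'n::finite mpolynomial \<Rightarrow> 'm::finite mseries"
  assumes T: "linear_operator T" and rank: "rank_at_least 2 T" and pres: "LP_preserver T"
  shows "\<exists>\<beta> \<gamma>. pos_vec \<beta> \<and> pos_vec \<gamma> \<and> signed_symbol T \<in> series_in (LP_fock (\<beta> \<oplus>\<^sub>v \<gamma>))"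
proof -
  obtain N where N: "\<And>k. k \<ge> N \<Longrightarrow> stable (jpoly k (signed_symbol T))"
    using preserver_imp_jpoly_stable[OF assms] by blast
  have nz: "signed_symbol T \<noteq> (\<lambda>_. 0)"
  proof
    assume "signed_symbol T = (\<lambda>_. 0)"
    then have "jpoly N (signed_symbol T) = 0" by (simp add: jpoly_zero_iff)
    moreover have "\<forall>i. 0 < Im ((\<chi> i :: 'm + 'n. \<i>) $ i)" by simp
    ultimately show False using N[of N] unfolding stable_def by (metis order_refl poly_fun_0)
  qed
  obtain C D where D: "D > 0" "\<And>\<eta>. cmod (signed_symbol T \<eta>) * sqrt (real (mfact \<eta>)) \<le> C * D ^ mdeg \<eta>"
    using szasz_growth[OF nz N] by blast
  define b where "b = 2 * D\<^sup>2"
  have b: "b > 0" using D by (simp add: b_def)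
  have s: "fock_term ((\<chi> i. b) :: real ^ ('m + 'n)) (signed_symbol T) summable_on UNIV"
    unfolding b_def by (rule growth_imp_fock[OF D])
  have p: "pos_vec ((\<chi> i. b) :: real ^ ('m + 'n))" using b by (simp add: pos_vec_def)
  have e: "((\<chi> i. b) :: real ^ 'm) \<oplus>\<^sub>v ((\<chi> j. b) :: real ^ 'n) = (\<chi> i. b)" by (auto simp: vconcat_def vec_eq_iff split: sum.splits)
  have "series_fun (signed_symbol T) \<in> LP"
    by (rule LP_from_jpoly[OF fock_abs_entire[OF p s]]) (use N in blast)
  moreover note fockI[OF p s]
  ultimately have "signed_symbol T \<in> series_in (LP_fock (((\<chi> i. b) :: real ^ 'm) \<oplus>\<^sub>v ((\<chi> j. b) :: real ^ 'n)))"
    unfolding e series_in_def LP_fock_def by auto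
  then show ?thesis using b
    by (intro exI[of _ "(\<chi> i. b) :: real ^ 'm"] exI[of _ "(\<chi> j. b) :: real ^ 'n"]) (simp add: pos_vec_def)
qed

section \<open>Double series and the extension of the operator\<close>

lemma group_sums:
  fixes H :: "'a \<Rightarrow> 'b \<Rightarrow> complex"
  assumes s: "(\<lambda>(x, y). cmod (H x y)) summable_on UNIV"
  shows "(\<lambda>y. cmod (H x y)) summable_on UNIV"
    and "(\<lambda>x. cmod (\<Sum>\<^sub>\<infinity>y. H x y)) summable_on UNIV"
    and "((\<lambda>x. \<Sum>\<^sub>\<infinity>y. H x y) has_sum (\<Sum>\<^sub>\<infinity>(x, y). H x y)) UNIV"
proof -
  have s': "(\<lambda>p. norm (case p of (x, y) \<Rightarrow> H x y)) summable_on Sigma UNIV (\<lambda>_. UNIV)"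
    using s by (simp add: case_prod_unfold)
  from Infinite_Sum.abs_summable_on_Sigma_iff[THEN iffD1, OF s']
  have 1: "\<And>x. (\<lambda>y. cmod (H x y)) summable_on UNIV" and 2: "(\<lambda>x. norm (\<Sum>\<^sub>\<infinity>y. cmod (H x y))) summable_on UNIV"
    by auto
  show "(\<lambda>y. cmod (H x y)) summable_on UNIV" by (rule 1)
  show "(\<lambda>x. cmod (\<Sum>\<^sub>\<infinity>y. H x y)) summable_on UNIV"
  proof (rule summable_on_comparison_test[OF 2])
    fix x
    show "cmod (\<Sum>\<^sub>\<infinity>y. H x y) \<le> norm (\<Sum>\<^sub>\<infinity>y. cmod (H x y))"
      using norm_infsum_bound[OF 1] by (simp add: infsum_nonneg)
  qed auto
  have s2: "(\<lambda>(x, y). H x y) summable_on Sigma UNIV (\<lambda>_. UNIV)"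
    by (rule abs_summable_summable[OF s'])
  have h: "((\<lambda>(x, y). H x y) has_sum (\<Sum>\<^sub>\<infinity>(x, y). H x y)) (Sigma UNIV (\<lambda>_. UNIV))"
    using has_sum_infsum[OF s2] by simp
  show "((\<lambda>x. \<Sum>\<^sub>\<infinity>y. H x y) has_sum (\<Sum>\<^sub>\<infinity>(x, y). H x y)) UNIV"
    by (rule has_sum_SigmaD[OF h]) (auto intro: has_sum_infsum abs_summable_summable[OF 1])
qed

lemma summable_on_pair_swap:
  "(\<lambda>(x, y). F x y) summable_on UNIV \<longleftrightarrow> (\<lambda>(y, x). F x y) summable_on UNIV"
  using summable_on_swap[of "\<lambda>(x, y). F x y" UNIV UNIV] by (simp add: case_prod_unfold)

lemma infsum_pair_swap:
  "(\<Sum>\<^sub>\<infinity>(x, y). F x y) = (\<Sum>\<^sub>\<infinity>(y, x). F x y)" for F :: "_ \<Rightarrow> _ \<Rightarrow> 'c::{t2_space,comm_monoid_add}"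
proof -
  have "bij_betw (\<lambda>(x,y). (y,x)) UNIV UNIV" by (rule bij_betwI[of _ _ _ "\<lambda>(x,y). (y,x)"]) auto
  from infsum_reindex_bij_betw[OF this, of "\<lambda>(x, y). F x y"] show ?thesis by (simp add: case_prod_unfold)
qed

lemma summable_case_sum:
  "F summable_on UNIV \<longleftrightarrow> (\<lambda>(\<kappa>, \<eta>). F (case_sum \<kappa> \<eta>)) summable_on UNIV"
  using summable_on_reindex_bij_betw[OF bij_case_sum, of F] by (simp add: case_prod_unfold)

lemma infsum_case_sum:
  "infsum F UNIV = (\<Sum>\<^sub>\<infinity>(\<kappa>, \<eta>). F (case_sum \<kappa> \<eta>))" for F :: "_ \<Rightarrow> 'c::{t2_space,comm_monoid_add}"
  using infsum_reindex_bij_betw[OF bij_case_sum, of F] by (simp add: case_prod_unfold)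

lemma summable_on_product_pairs:
  fixes f :: "'a \<Rightarrow> real" and g :: "'b \<Rightarrow> real"
  assumes "f summable_on UNIV" "g summable_on UNIV" "\<And>x. f x \<ge> 0" "\<And>y. g y \<ge> 0"
  shows "(\<lambda>(x, y). f x * g y) summable_on UNIV"
proof -
  have "(\<lambda>p. norm (case p of (x, y) \<Rightarrow> f x * g y)) summable_on Sigma UNIV (\<lambda>_. UNIV)"
    by (rule Infinite_Sum.abs_summable_on_Sigma_iff[THEN iffD2])
      (use assms in \<open>auto simp: abs_mult infsum_nonneg infsum_cmult_right' intro!: summable_on_cmult_right summable_on_cmult_left\<close>)
  from abs_summable_summable[OF this] show ?thesis by simp
qed

lemma infsum_cauchy_schwarz:
  fixes x y :: "'a \<Rightarrow> real"
  assumes x: "(\<lambda>i. (x i)\<^sup>2) summable_on UNIV" and y: "(\<lambda>i. (y i)\<^sup>2) summable_on UNIV"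
    and n: "\<And>i. x i \<ge> 0" "\<And>i. y i \<ge> 0"
  shows "(\<lambda>i. x i * y i) summable_on UNIV"
    and "(\<Sum>\<^sub>\<infinity>i. x i * y i)\<^sup>2 \<le> (\<Sum>\<^sub>\<infinity>i. (x i)\<^sup>2) * (\<Sum>\<^sub>\<infinity>i. (y i)\<^sup>2)"
proof -
  show s: "(\<lambda>i. x i * y i) summable_on UNIV"
    by (rule summable_on_comparison_test[OF summable_on_add[OF x y]])
      (use weighted_am_gm[of 1] n in auto)
  have "(\<Sum>\<^sub>\<infinity>i. x i * y i) \<le> sqrt ((\<Sum>\<^sub>\<infinity>i. (x i)\<^sup>2) * (\<Sum>\<^sub>\<infinity>i. (y i)\<^sup>2))"
  proof (rule infsum_le_finite_sums[OF s])
    fix F :: "'a set" assume F: "finite F"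
    have "(\<Sum>i\<in>F. x i * y i)\<^sup>2 \<le> (\<Sum>i\<in>F. (x i)\<^sup>2) * (\<Sum>i\<in>F. (y i)\<^sup>2)" by (rule Cauchy_Schwarz_ineq_sum)
    also have "\<dots> \<le> (\<Sum>\<^sub>\<infinity>i. (x i)\<^sup>2) * (\<Sum>\<^sub>\<infinity>i. (y i)\<^sup>2)"
      by (intro mult_mono finite_sum_le_infsum x y F sum_nonneg infsum_nonneg) auto
    finally show "(\<Sum>i\<in>F. x i * y i) \<le> sqrt ((\<Sum>\<^sub>\<infinity>i. (x i)\<^sup>2) * (\<Sum>\<^sub>\<infinity>i. (y i)\<^sup>2))" by (rule real_le_rsqrt)
  qed
  moreover have "0 \<le> (\<Sum>\<^sub>\<infinity>i. x i * y i)" using n by (intro infsum_nonneg) auto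
  ultimately have "(\<Sum>\<^sub>\<infinity>i. x i * y i)\<^sup>2 \<le> (sqrt ((\<Sum>\<^sub>\<infinity>i. (x i)\<^sup>2) * (\<Sum>\<^sub>\<infinity>i. (y i)\<^sup>2)))\<^sup>2" by (rule power_mono)
  then show "(\<Sum>\<^sub>\<infinity>i. x i * y i)\<^sup>2 \<le> (\<Sum>\<^sub>\<infinity>i. (x i)\<^sup>2) * (\<Sum>\<^sub>\<infinity>i. (y i)\<^sup>2)"
    by (simp add: infsum_nonneg)
qed

lemma mpow_cvec: "mpow (cvec \<alpha>) \<eta> = of_real (mpow \<alpha> \<eta>)"
  by (simp add: mpow_def cvec_def)

lemma pos_vec_vconcat: "pos_vec \<beta> \<Longrightarrow> pos_vec \<gamma> \<Longrightarrow> pos_vec (\<beta> \<oplus>\<^sub>v \<gamma>)"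
  by (auto simp: pos_vec_def vconcat_def split: sum.splits)

definition kernel_coeffs :: "('n::finite mpolynomial \<Rightarrow> 'm::finite mseries) \<Rightarrow> real ^ 'n \<Rightarrow> ('m + 'n) mseries" where
  "kernel_coeffs T \<alpha> = rescale (1 \<oplus>\<^sub>v cvec \<alpha>) (symbol T)"

lemma kernel_coeffs_case_sum:
  "kernel_coeffs T \<alpha> (case_sum \<kappa> \<eta>) = T (Poly_Mapping.single \<eta> 1) \<kappa> / of_nat (mfact \<eta>) * of_real (mpow \<alpha> \<eta>)"
  by (simp add: kernel_coeffs_def rescale_def symbol_case_sum mpow_vconcat mpow_one mpow_cvec)

text \<open>Rescaling w by \<alpha> multiplies squared coefficients by \<alpha>^(2\<eta>), and the
  weight contributes \<alpha>^(-\<eta>). What remains is \<alpha>^\<eta> in place of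
  \<gamma>^(-\<eta>), which is where \<alpha> \<le> 1/\<gamma> enters; the sign of w does not affect
  moduli.\<close>

lemma kernel_fock_summable:
  fixes T :: "'n::finite mpolynomial \<Rightarrow> 'm::finite mseries"
  assumes \<beta>: "pos_vec \<beta>" and \<gamma>: "pos_vec \<gamma>" and \<alpha>: "pos_vec \<alpha>" "\<forall>i. \<alpha> $ i \<le> inverse (\<gamma> $ i)"
    and s: "fock_term (\<beta> \<oplus>\<^sub>v \<gamma>) (signed_symbol T) summable_on UNIV"
  shows "fock_term (\<beta> \<oplus>\<^sub>v \<alpha>) (kernel_coeffs T \<alpha>) summable_on UNIV"
proof (rule summable_on_comparison_test[OF s])
  fix \<zeta> :: "'m + 'n \<Rightarrow> nat"
  define \<kappa> \<eta> where "\<kappa> = \<zeta> \<circ> Inl" and "\<eta> = \<zeta> \<circ> Inr"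
  have z: "\<zeta> = case_sum \<kappa> \<eta>" by (simp add: \<kappa>_def \<eta>_def case_sum_eta)
  have "mpow \<alpha> \<eta> \<le> inverse (mpow \<gamma> \<eta>)"
    unfolding mpow_def prod_inversef[symmetric]
    using \<alpha> by (intro prod_mono) (auto simp: pos_vec_def less_imp_le power_inverse[symmetric] intro!: power_mono)
  then have le: "mpow \<alpha> \<eta> \<le> 1 / mpow \<gamma> \<eta>" by (simp add: inverse_eq_divide)
  have pos: "mpow \<alpha> \<eta> > 0" "mpow \<gamma> \<eta> > 0" "mpow \<beta> \<kappa> > 0" using \<alpha> \<beta> \<gamma> mpow_real_pos by auto
  define X where "X = real (mfact \<kappa>) * real (mfact \<eta>) / mpow \<beta> \<kappa> * (cmod (T (Poly_Mapping.single \<eta> 1) \<kappa> / of_nat (mfact \<eta>)))\<^sup>2"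
  have X: "X \<ge> 0" using pos by (simp add: X_def)
  have "fock_term (\<beta> \<oplus>\<^sub>v \<alpha>) (kernel_coeffs T \<alpha>) \<zeta> = X * mpow \<alpha> \<eta>"
    unfolding fock_term_def z kernel_coeffs_case_sum norm_mult power_mult_distrib
    using pos by (simp add: mfact_sum_type[of "case_sum \<kappa> \<eta>"] mpow_vconcat X_def power2_eq_square)
  moreover have "fock_term (\<beta> \<oplus>\<^sub>v \<gamma>) (signed_symbol T) \<zeta> = X * (1 / mpow \<gamma> \<eta>)"
    unfolding fock_term_def z signed_symbol_case_sum norm_mult power_mult_distrib
    by (simp add: mfact_sum_type[of "case_sum \<kappa> \<eta>"] mpow_vconcat X_def norm_power)
  ultimately show "fock_term (\<beta> \<oplus>\<^sub>v \<alpha>) (kernel_coeffs T \<alpha>) \<zeta> \<le> fock_term (\<beta> \<oplus>\<^sub>v \<gamma>) (signed_symbol T) \<zeta>"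
    using mult_left_mono[OF le X] by simp
  show "0 \<le> fock_term (\<beta> \<oplus>\<^sub>v \<alpha>) (kernel_coeffs T \<alpha>) \<zeta>"
    by (intro fock_term_nonneg pos_vec_vconcat \<beta> \<alpha>)
qed

text \<open>For a non-summable family the infinite sum defaults to 0;
  \<open>ext_row_summable\<close> excludes that case when b has finite Fock norm and the kernel is
  in its Fock space.\<close>

definition ext_coeffs :: "('n::finite mpolynomial \<Rightarrow> 'm::finite mseries) \<Rightarrow> 'n mseries \<Rightarrow> 'm mseries" where
  "ext_coeffs T b \<kappa> = (\<Sum>\<^sub>\<infinity>\<eta>. b \<eta> * T (Poly_Mapping.single \<eta> 1) \<kappa>)"

lemma ext_poly:
  fixes T :: "'n::finite mpolynomial \<Rightarrow> 'm::finite mseries"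
  assumes T: "linear_operator T"
  shows "ext_coeffs T (Poly_Mapping.lookup P) = T P"
proof
  fix \<kappa>
  have "((\<lambda>\<eta>. Poly_Mapping.lookup P \<eta> * T (Poly_Mapping.single \<eta> 1) \<kappa>) has_sum T P \<kappa>) UNIV"
    unfolding linear_operator_apply[OF T finite_keys subset_refl, of P \<kappa>]
    by (rule has_sum_finite_neutralI) (auto simp: in_keys_iff)
  then show "ext_coeffs T (Poly_Mapping.lookup P) \<kappa> = T P \<kappa>"
    unfolding ext_coeffs_def by (rule infsumI)
qed

lemma fock_term_poly: "fock_term \<alpha> (Poly_Mapping.lookup P) summable_on UNIV"
  by (rule finite_nonzero_values_imp_summable_on, rule finite_subset[OF _ finite_lookup[of P]])
    (auto simp: fock_term_def)

context
  fixes T :: "'n::finite mpolynomial \<Rightarrow> 'm::finite mseries" and \<alpha> :: "real ^ 'n" and \<beta> :: "real ^ 'm"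
  assumes \<alpha>: "pos_vec \<alpha>" and \<beta>: "pos_vec \<beta>"
    and ker: "fock_term (\<beta> \<oplus>\<^sub>v \<alpha>) (kernel_coeffs T \<alpha>) summable_on UNIV"
begin

text \<open>The squared modulus of the matrix entry of T between the normalised monomials of the two
  Fock spaces. Their total is the squared Fock norm of the kernel, which is thus a Hilbert-Schmidt
  norm.\<close>

definition wt :: "('m \<Rightarrow> nat) \<Rightarrow> ('n \<Rightarrow> nat) \<Rightarrow> real" where
  "wt \<kappa> \<eta> = real (mfact \<kappa>) / mpow \<beta> \<kappa> * (mpow \<alpha> \<eta> / real (mfact \<eta>)) * (cmod (T (Poly_Mapping.single \<eta> 1) \<kappa>))\<^sup>2"

lemma fock_term_kernel: "fock_term (\<beta> \<oplus>\<^sub>v \<alpha>) (kernel_coeffs T \<alpha>) (case_sum \<kappa> \<eta>) = wt \<kappa> \<eta>"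
  using mpow_real_pos[OF \<alpha>, of \<eta>] mfact_pos[of \<eta>]
  by (simp add: fock_term_def kernel_coeffs_case_sum wt_def mfact_sum_type[of "case_sum \<kappa> \<eta>"] mpow_vconcat
      norm_mult norm_divide power_mult_distrib power_divide power2_eq_square field_simps)

lemma wt_summable: "(\<lambda>(\<kappa>, \<eta>). wt \<kappa> \<eta>) summable_on UNIV"
  using ker unfolding summable_case_sum[of "fock_term _ _"] fock_term_kernel .

lemma kernel_norm: "(fock_norm (\<beta> \<oplus>\<^sub>v \<alpha>) (series_fun (kernel_coeffs T \<alpha>)))\<^sup>2 = (\<Sum>\<^sub>\<infinity>(\<kappa>, \<eta>). wt \<kappa> \<eta>)"
proof -
  have "taylor_coeffs (series_fun (kernel_coeffs T \<alpha>)) = kernel_coeffs T \<alpha>"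
    by (rule fockI[OF pos_vec_vconcat[OF \<beta> \<alpha>] ker])
  then have "(fock_norm (\<beta> \<oplus>\<^sub>v \<alpha>) (series_fun (kernel_coeffs T \<alpha>)))\<^sup>2 = (\<Sum>\<^sub>\<infinity>\<zeta>. fock_term (\<beta> \<oplus>\<^sub>v \<alpha>) (kernel_coeffs T \<alpha>) \<zeta>)"
    unfolding fock_norm_def by (simp add: infsum_nonneg fock_term_nonneg pos_vec_vconcat \<alpha> \<beta>)
  also have "\<dots> = (\<Sum>\<^sub>\<infinity>(\<kappa>, \<eta>). wt \<kappa> \<eta>)" by (simp add: infsum_case_sum fock_term_kernel)
  finally show ?thesis .
qed

text \<open>Licenses every interchange of summation below. The parameter t of
  \<open>weighted_am_gm\<close> is chosen so that the square of the entry of T becomes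
  \<open>wt\<close>; the other term is an exponential series in \<kappa> times a Fock term in
  \<eta>.\<close>

lemma pair_summable:
  assumes b: "fock_term \<alpha> b summable_on UNIV" and R: "R \<ge> 0"
  shows "(\<lambda>(\<kappa>, \<eta>). cmod (b \<eta> * T (Poly_Mapping.single \<eta> 1) \<kappa>) * R ^ mdeg \<kappa>) summable_on UNIV"
proof -
  have e: "(\<lambda>\<kappa>. mpow (\<chi> i. R\<^sup>2 * \<beta> $ i) \<kappa> / real (mfact \<kappa>)) summable_on UNIV"
    using \<beta> by (intro summable_on_exp_mpow) (auto simp: pos_vec_def less_imp_le)
  have p: "(\<lambda>(\<kappa>, \<eta>). mpow (\<chi> i. R\<^sup>2 * \<beta> $ i) \<kappa> / real (mfact \<kappa>) * fock_term \<alpha> b \<eta>) summable_on UNIV"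
    using \<beta> by (intro summable_on_product_pairs e b fock_term_nonneg \<alpha> divide_nonneg_nonneg mpow_real_nonneg)
      (auto simp: pos_vec_def less_imp_le)
  show ?thesis
  proof (rule summable_on_comparison_test[OF summable_on_add[OF wt_summable p]], goal_cases)
    case (1 p)
    obtain \<kappa> \<eta> where p: "p = (\<kappa>, \<eta>)" by (cases p)
    define t where "t = real (mfact \<kappa>) / mpow \<beta> \<kappa> * (mpow \<alpha> \<eta> / real (mfact \<eta>))"
    have t: "t > 0" using mpow_real_pos[OF \<alpha>, of \<eta>] mpow_real_pos[OF \<beta>, of \<kappa>] mfact_pos[of \<kappa>] mfact_pos[of \<eta>]
      by (simp add: t_def)
    have "cmod (T (Poly_Mapping.single \<eta> 1) \<kappa>) * (cmod (b \<eta>) * R ^ mdeg \<kappa>) \<le> t * (cmod (T (Poly_Mapping.single \<eta> 1) \<kappa>))\<^sup>2 + (cmod (b \<eta>) * R ^ mdeg \<kappa>)\<^sup>2 / t"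
      by (rule weighted_am_gm[OF t])
    moreover have "(cmod (b \<eta>) * R ^ mdeg \<kappa>)\<^sup>2 / t = mpow (\<chi> i. R\<^sup>2 * \<beta> $ i) \<kappa> / real (mfact \<kappa>) * fock_term \<alpha> b \<eta>"
      unfolding mpow_scale_square by (simp add: t_def fock_term_def power_mult_distrib mult_ac)
    ultimately show ?case by (simp add: p wt_def t_def norm_mult mult_ac)
  qed (use R in auto)
qed

lemma ext_row_summable:
  assumes b: "fock_term \<alpha> b summable_on UNIV"
  shows "(\<lambda>\<eta>. b \<eta> * T (Poly_Mapping.single \<eta> 1) \<kappa>) summable_on UNIV"
proof -
  have "(\<lambda>(\<kappa>, \<eta>). cmod (b \<eta> * T (Poly_Mapping.single \<eta> 1) \<kappa>)) summable_on UNIV"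
    using pair_summable[OF b, of 1] by simp
  from abs_summable_summable[OF group_sums(1)[OF this]] show ?thesis .
qed

text \<open>Cauchy-Schwarz along one row of the matrix of T, after distributing the Fock weight and
  its reciprocal over the two factors.\<close>

lemma ext_coeff_bound:
  assumes b: "fock_term \<alpha> b summable_on UNIV"
  shows "fock_term \<beta> (ext_coeffs T b) \<kappa> \<le> (\<Sum>\<^sub>\<infinity>\<eta>. fock_term \<alpha> b \<eta>) * (\<Sum>\<^sub>\<infinity>\<eta>. wt \<kappa> \<eta>)"
proof -
  define c where "c = real (mfact \<kappa>) / mpow \<beta> \<kappa>"
  have c: "c > 0" unfolding c_def by (rule weight_pos[OF \<beta>])
  define x where "x \<eta> = sqrt (real (mfact \<eta>) / mpow \<alpha> \<eta>) * cmod (b \<eta>)" for \<eta>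
  define y where "y \<eta> = sqrt (mpow \<alpha> \<eta> / real (mfact \<eta>)) * cmod (T (Poly_Mapping.single \<eta> 1) \<kappa>)" for \<eta>
  have x2: "(x \<eta>)\<^sup>2 = fock_term \<alpha> b \<eta>" for \<eta>
    using mpow_real_pos[OF \<alpha>, of \<eta>] by (simp add: x_def fock_term_def power_mult_distrib)
  have y2: "(y \<eta>)\<^sup>2 = wt \<kappa> \<eta> / c" for \<eta>
    using mpow_real_pos[OF \<alpha>, of \<eta>] c by (simp add: y_def wt_def power_mult_distrib c_def[symmetric])
  have xy: "x \<eta> * y \<eta> = cmod (b \<eta> * T (Poly_Mapping.single \<eta> 1) \<kappa>)" for \<eta>
    using mpow_real_pos[OF \<alpha>, of \<eta>] mfact_pos[of \<eta>]
    by (simp add: x_def y_def norm_mult real_sqrt_divide field_simps)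
  have n: "0 \<le> x \<eta>" "0 \<le> y \<eta>" for \<eta> using mpow_real_pos[OF \<alpha>, of \<eta>] by (auto simp: x_def y_def)
  have ws: "(\<lambda>\<eta>. wt \<kappa> \<eta>) summable_on UNIV"
    using wt_summable by (intro summable_on_SigmaD1[of wt UNIV "\<lambda>_. UNIV"]) auto
  have xs: "(\<lambda>\<eta>. (x \<eta>)\<^sup>2) summable_on UNIV" unfolding x2 by (rule b)
  have ys: "(\<lambda>\<eta>. (y \<eta>)\<^sup>2) summable_on UNIV"
    unfolding y2 divide_inverse by (intro summable_on_cmult_left ws)
  note cs = infsum_cauchy_schwarz[OF xs ys n]
  have "cmod (ext_coeffs T b \<kappa>) \<le> (\<Sum>\<^sub>\<infinity>\<eta>. x \<eta> * y \<eta>)"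
    unfolding ext_coeffs_def xy by (rule norm_infsum_bound) (use cs(1) in \<open>simp add: xy\<close>)
  then have "(cmod (ext_coeffs T b \<kappa>))\<^sup>2 \<le> (\<Sum>\<^sub>\<infinity>\<eta>. x \<eta> * y \<eta>)\<^sup>2" by (intro power_mono) auto
  also have "\<dots> \<le> (\<Sum>\<^sub>\<infinity>\<eta>. fock_term \<alpha> b \<eta>) * (\<Sum>\<^sub>\<infinity>\<eta>. wt \<kappa> \<eta> / c)" using cs(2) by (simp add: x2 y2)
  also have "(\<Sum>\<^sub>\<infinity>\<eta>. wt \<kappa> \<eta> / c) = (\<Sum>\<^sub>\<infinity>\<eta>. wt \<kappa> \<eta>) / c"
    unfolding divide_inverse by (rule infsum_cmult_left) (rule ws)
  finally have "c * (cmod (ext_coeffs T b \<kappa>))\<^sup>2 \<le> c * ((\<Sum>\<^sub>\<infinity>\<eta>. fock_term \<alpha> b \<eta>) * ((\<Sum>\<^sub>\<infinity>\<eta>. wt \<kappa> \<eta>) / c))"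
    using c by (intro mult_left_mono) auto
  then show ?thesis using c by (simp add: fock_term_def c_def[symmetric])
qed

lemma ext_fock:
  assumes b: "fock_term \<alpha> b summable_on UNIV"
  shows "fock_term \<beta> (ext_coeffs T b) summable_on UNIV"
    and "(\<Sum>\<^sub>\<infinity>\<kappa>. fock_term \<beta> (ext_coeffs T b) \<kappa>) \<le> (\<Sum>\<^sub>\<infinity>\<eta>. fock_term \<alpha> b \<eta>) * (\<Sum>\<^sub>\<infinity>(\<kappa>, \<eta>). wt \<kappa> \<eta>)"
proof -
  have s: "(\<lambda>(\<kappa>, \<eta>). wt \<kappa> \<eta>) summable_on Sigma UNIV (\<lambda>_. UNIV)" using wt_summable by simp
  have r: "(\<lambda>\<kappa>. (\<Sum>\<^sub>\<infinity>\<eta>. fock_term \<alpha> b \<eta>) * (\<Sum>\<^sub>\<infinity>\<eta>. wt \<kappa> \<eta>)) summable_on UNIV"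
    by (intro summable_on_cmult_right summable_on_Sigma_banach[OF s])
  show 1: "fock_term \<beta> (ext_coeffs T b) summable_on UNIV"
    by (rule summable_on_comparison_test[OF r]) (auto intro: ext_coeff_bound b fock_term_nonneg \<beta>)
  have "(\<Sum>\<^sub>\<infinity>\<kappa>. fock_term \<beta> (ext_coeffs T b) \<kappa>) \<le> (\<Sum>\<^sub>\<infinity>\<kappa>. (\<Sum>\<^sub>\<infinity>\<eta>. fock_term \<alpha> b \<eta>) * (\<Sum>\<^sub>\<infinity>\<eta>. wt \<kappa> \<eta>))"
    by (rule infsum_mono[OF 1 r]) (rule ext_coeff_bound[OF b])
  also have "\<dots> = (\<Sum>\<^sub>\<infinity>\<eta>. fock_term \<alpha> b \<eta>) * (\<Sum>\<^sub>\<infinity>\<kappa>. \<Sum>\<^sub>\<infinity>\<eta>. wt \<kappa> \<eta>)"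
    by (rule infsum_cmult_right) (rule summable_on_Sigma_banach[OF s])
  also have "(\<Sum>\<^sub>\<infinity>\<kappa>. \<Sum>\<^sub>\<infinity>\<eta>. wt \<kappa> \<eta>) = (\<Sum>\<^sub>\<infinity>(\<kappa>, \<eta>). wt \<kappa> \<eta>)"
    using infsum_Sigma'_banach[OF s] by simp
  finally show "(\<Sum>\<^sub>\<infinity>\<kappa>. fock_term \<beta> (ext_coeffs T b) \<kappa>) \<le> (\<Sum>\<^sub>\<infinity>\<eta>. fock_term \<alpha> b \<eta>) * (\<Sum>\<^sub>\<infinity>(\<kappa>, \<eta>). wt \<kappa> \<eta>)" .
qed

lemma ext_value:
  assumes b: "fock_term \<alpha> b summable_on UNIV"
  shows "series_fun (ext_coeffs T b) z = (\<Sum>\<^sub>\<infinity>(\<kappa>, \<eta>). b \<eta> * T (Poly_Mapping.single \<eta> 1) \<kappa> * mpow z \<kappa>)"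
    and "((\<lambda>\<eta>. b \<eta> * (\<Sum>\<^sub>\<infinity>\<kappa>. T (Poly_Mapping.single \<eta> 1) \<kappa> * mpow z \<kappa>)) has_sum series_fun (ext_coeffs T b) z) UNIV"
proof -
  define H where "H \<kappa> \<eta> = b \<eta> * T (Poly_Mapping.single \<eta> 1) \<kappa> * mpow z \<kappa>" for \<kappa> \<eta>
  have s: "(\<lambda>(\<kappa>, \<eta>). cmod (H \<kappa> \<eta>)) summable_on UNIV"
    by (rule summable_on_comparison_test[OF pair_summable[OF b norm_ge_zero[of z]]])
      (auto simp: H_def norm_mult intro!: mult_left_mono norm_mpow_norm)
  have s': "(\<lambda>(\<eta>, \<kappa>). cmod (H \<kappa> \<eta>)) summable_on UNIV"
    using s unfolding summable_on_pair_swap[of "\<lambda>\<kappa> \<eta>. cmod (H \<kappa> \<eta>)"] .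
  have e: "(\<Sum>\<^sub>\<infinity>\<eta>. H \<kappa> \<eta>) = ext_coeffs T b \<kappa> * mpow z \<kappa>" for \<kappa>
    unfolding H_def ext_coeffs_def by (rule infsum_cmult_left) (rule ext_row_summable[OF b])
  have 1: "((\<lambda>\<kappa>. ext_coeffs T b \<kappa> * mpow z \<kappa>) has_sum (\<Sum>\<^sub>\<infinity>(\<kappa>, \<eta>). H \<kappa> \<eta>)) UNIV"
    using group_sums(3)[OF s] unfolding e .
  then show v: "series_fun (ext_coeffs T b) z = (\<Sum>\<^sub>\<infinity>(\<kappa>, \<eta>). b \<eta> * T (Poly_Mapping.single \<eta> 1) \<kappa> * mpow z \<kappa>)"
    unfolding series_fun_def H_def by (rule infsumI)
  have e2: "(\<Sum>\<^sub>\<infinity>\<kappa>. H \<kappa> \<eta>) = b \<eta> * (\<Sum>\<^sub>\<infinity>\<kappa>. T (Poly_Mapping.single \<eta> 1) \<kappa> * mpow z \<kappa>)" for \<eta>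
    unfolding H_def mult.assoc by (rule infsum_cmult_right')
  show "((\<lambda>\<eta>. b \<eta> * (\<Sum>\<^sub>\<infinity>\<kappa>. T (Poly_Mapping.single \<eta> 1) \<kappa> * mpow z \<kappa>)) has_sum series_fun (ext_coeffs T b) z) UNIV"
    using group_sums(3)[OF s'] unfolding v e2 H_def[symmetric] infsum_pair_swap[of H] .
qed

text \<open>T preserves the class on the Jensen polynomials of f. Their images converge locally
  uniformly to the extension because the error terms carry the factor 1 - \<open>mults\<close>,
  which tends to 0, and are dominated by the absolutely convergent double series.\<close>

lemma ext_LP:
  assumes T: "linear_operator T" and pres: "LP_preserver T"
    and f: "f \<in> LP" "power_series_of b f" and b: "fock_term \<alpha> b summable_on UNIV"
  shows "series_fun (ext_coeffs T b) \<in> LP"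
proof (rule LP_closed)
  let ?J = "\<lambda>k. jpoly (Suc k) b"
  show "series_fun (ext_coeffs T (Poly_Mapping.lookup (?J k))) \<in> LP" for k
  proof -
    have "poly_fun (?J k) \<in> LP" unfolding LP_poly_iff by (rule jpoly_LP[OF f]) simp
    then have "T (?J k) \<in> series_in LP" using pres by (simp add: LP_preserver_def)
    then show ?thesis using power_series_eq by (auto simp: series_in_def ext_poly[OF T])
  qed
  show "entire (series_fun (ext_coeffs T b))"
    by (rule entire_series[OF fock_abs_entire[OF \<beta> ext_fock(1)[OF b]]])
  fix K :: "(complex ^ 'm) set" assume "compact K"
  then have "bounded K" by (rule compact_imp_bounded)
  then obtain R where R: "R > 0" "\<And>z. z \<in> K \<Longrightarrow> norm z \<le> R"
    unfolding bounded_pos by (elim exE conjE) blast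
  define h where "h k = (\<lambda>(\<kappa>, \<eta>). (1 - mults (Suc k) \<eta>) * (cmod (b \<eta> * T (Poly_Mapping.single \<eta> 1) \<kappa>) * R ^ mdeg \<kappa>))" for k
  have gs: "(\<lambda>(\<kappa>, \<eta>). cmod (b \<eta> * T (Poly_Mapping.single \<eta> 1) \<kappa>) * R ^ mdeg \<kappa>) summable_on UNIV"
    using R by (intro pair_summable b) auto
  have h0: "0 \<le> h k p" for k p
    unfolding h_def case_prod_beta
    by (rule mult_nonneg_nonneg) (use mults_range[of "Suc k" "snd p"] R in auto)
  have hg: "h k p \<le> (\<lambda>(\<kappa>, \<eta>). cmod (b \<eta> * T (Poly_Mapping.single \<eta> 1) \<kappa>) * R ^ mdeg \<kappa>) p" for k p
    unfolding h_def prod.case_distrib case_prod_beta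
    by (rule mult_left_le_one_le) (use mults_range[of "Suc k" "snd p"] R in auto)
  have hl: "(\<lambda>k. h k p) \<longlonglongrightarrow> 0" for p
  proof -
    obtain \<kappa> \<eta> where p: "p = (\<kappa>, \<eta>)" by (cases p)
    have "(\<lambda>k. (1 - mults (Suc k) \<eta>) * (cmod (b \<eta> * T (Poly_Mapping.single \<eta> 1) \<kappa>) * R ^ mdeg \<kappa>)) \<longlonglongrightarrow> (1 - 1) * (cmod (b \<eta> * T (Poly_Mapping.single \<eta> 1) \<kappa>) * R ^ mdeg \<kappa>)"
      by (intro tendsto_intros LIMSEQ_Suc mults_tendsto)
    then show ?thesis by (simp add: h_def p)
  qed
  have lim0: "(\<lambda>k. \<Sum>\<^sub>\<infinity>p. h k p) \<longlonglongrightarrow> 0"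
    by (rule infsum_dominated[OF gs h0 hg hl])
  have hs: "h k summable_on UNIV" for k
    by (rule summable_on_comparison_test[OF gs]) (use h0 hg in auto)
  have bd: "dist (series_fun (ext_coeffs T (Poly_Mapping.lookup (?J k))) z) (series_fun (ext_coeffs T b) z) \<le> (\<Sum>\<^sub>\<infinity>p. h k p)"
    if z: "z \<in> K" for k z
  proof -
    have nz: "norm (mpow z \<kappa>) \<le> R ^ mdeg \<kappa>" for \<kappa> by (rule norm_mpow_norm[OF R(2)[OF z]])
    have sJ: "(\<lambda>(\<kappa>, \<eta>). Poly_Mapping.lookup (?J k) \<eta> * T (Poly_Mapping.single \<eta> 1) \<kappa> * mpow z \<kappa>) summable_on UNIV"
      if "fock_term \<alpha> (Poly_Mapping.lookup (?J k)) summable_on UNIV"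
      by (rule abs_summable_summable, rule summable_on_comparison_test[OF pair_summable[OF that less_imp_le[OF R(1)]]])
        (auto simp: norm_mult intro!: mult_left_mono nz)
    have sb: "(\<lambda>(\<kappa>, \<eta>). b \<eta> * T (Poly_Mapping.single \<eta> 1) \<kappa> * mpow z \<kappa>) summable_on UNIV"
      by (rule abs_summable_summable, rule summable_on_comparison_test[OF gs])
        (auto simp: norm_mult intro!: mult_left_mono nz)
    define D where "D = (\<lambda>(\<kappa>, \<eta>). (Poly_Mapping.lookup (?J k) \<eta> * T (Poly_Mapping.single \<eta> 1) \<kappa> * mpow z \<kappa>) - (b \<eta> * T (Poly_Mapping.single \<eta> 1) \<kappa> * mpow z \<kappa>))"
    have hD: "(D has_sum (series_fun (ext_coeffs T (Poly_Mapping.lookup (?J k))) z - series_fun (ext_coeffs T b) z)) UNIV"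
      unfolding ext_value(1)[OF fock_term_poly] ext_value(1)[OF b]
      using has_sum_add[OF has_sum_infsum[OF sJ[OF fock_term_poly]] has_sum_uminusI[OF has_sum_infsum[OF sb]]]
      by (simp add: D_def case_prod_unfold)
    have Dh: "norm (D p) \<le> h k p" for p
    proof -
      obtain \<kappa> \<eta> where p: "p = (\<kappa>, \<eta>)" by (cases p)
      have "D p = - (of_real (1 - mults (Suc k) \<eta>) * (b \<eta> * T (Poly_Mapping.single \<eta> 1) \<kappa> * mpow z \<kappa>))"
        by (simp add: D_def p lookup_jpoly algebra_simps)
      then have "norm (D p) = (1 - mults (Suc k) \<eta>) * (cmod (b \<eta> * T (Poly_Mapping.single \<eta> 1) \<kappa>) * cmod (mpow z \<kappa>))"
        using mults_range[of "Suc k" \<eta>] by (simp only: norm_minus_cancel norm_mult norm_of_real)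
      also have "\<dots> \<le> h k p"
        unfolding p h_def prod.case using mults_range[of "Suc k" \<eta>] nz by (intro mult_left_mono) auto
      finally show ?thesis .
    qed
    show ?thesis unfolding dist_norm by (rule norm_infsum_le[OF hD has_sum_infsum[OF hs] Dh])
  qed
  show "uniform_limit K (\<lambda>k. series_fun (ext_coeffs T (Poly_Mapping.lookup (?J k)))) (series_fun (ext_coeffs T b)) sequentially"
  proof (rule uniform_limitI)
    fix e :: real assume "e > 0"
    then have "\<forall>\<^sub>F k in sequentially. (\<Sum>\<^sub>\<infinity>p. h k p) < e" using lim0 order_tendstoD(2) by blast
    then show "\<forall>\<^sub>F k in sequentially. \<forall>z\<in>K. dist (series_fun (ext_coeffs T (Poly_Mapping.lookup (?J k))) z) (series_fun (ext_coeffs T b) z) < e"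
      by eventually_elim (use bd in \<open>auto intro: le_less_trans\<close>)
  qed
qed

text \<open>Taylor coefficients in w of the kernel at fixed z; their conjugates represent the
  functional that sends f to the value of T f at z.\<close>

definition row_coeffs :: "complex ^ 'm \<Rightarrow> 'n mseries" where
  "row_coeffs z \<eta> = (\<Sum>\<^sub>\<infinity>\<kappa>. T (Poly_Mapping.single \<eta> 1) \<kappa> * mpow z \<kappa>) * of_real (mpow \<alpha> \<eta> / real (mfact \<eta>))"

lemma row_fock: "fock_term \<alpha> (row_coeffs z) summable_on UNIV"
  and row_power_series: "power_series_of (row_coeffs z) (\<lambda>w. series_fun (kernel_coeffs T \<alpha>) (z \<oplus>\<^sub>v w))"
proof -
  have ae: "abs_entire (kernel_coeffs T \<alpha>)" by (rule fock_abs_entire[OF pos_vec_vconcat[OF \<beta> \<alpha>] ker])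
  have colsum: "(\<lambda>\<kappa>. T (Poly_Mapping.single \<eta> 1) \<kappa> * mpow z \<kappa>) summable_on UNIV" for \<eta>
  proof -
    define c where "c = (of_nat (mfact \<eta>) / of_real (mpow \<alpha> \<eta>) :: complex)"
    have "abs_entire (\<lambda>\<kappa>. c * kernel_coeffs T \<alpha> (case_sum \<kappa> \<eta>))"
      by (intro abs_entire_scale abs_entire_slice ae)
    moreover have "(\<lambda>\<kappa>. c * kernel_coeffs T \<alpha> (case_sum \<kappa> \<eta>)) = T (Poly_Mapping.single \<eta> 1)"
      using mfact_pos[of \<eta>] mpow_real_pos[OF \<alpha>, of \<eta>] by (auto simp: c_def kernel_coeffs_case_sum)
    ultimately show ?thesis using abs_entire_has_sum has_sum_imp_summable by fastforce
  qed
  have K: "kernel_coeffs T \<alpha> (case_sum \<kappa> \<eta>) * mpow z \<kappa> = T (Poly_Mapping.single \<eta> 1) \<kappa> * mpow z \<kappa> * of_real (mpow \<alpha> \<eta> / real (mfact \<eta>))" for \<kappa> \<eta>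
    by (simp add: kernel_coeffs_case_sum)
  have row: "(\<Sum>\<^sub>\<infinity>\<kappa>. kernel_coeffs T \<alpha> (case_sum \<kappa> \<eta>) * mpow z \<kappa>) = row_coeffs z \<eta>" for \<eta>
    unfolding K row_coeffs_def by (rule infsum_cmult_left) (rule colsum)
  show "power_series_of (row_coeffs z) (\<lambda>w. series_fun (kernel_coeffs T \<alpha>) (z \<oplus>\<^sub>v w))"
    unfolding power_series_of_def
  proof
    fix w
    define H where "H \<eta> \<kappa> = kernel_coeffs T \<alpha> (case_sum \<kappa> \<eta>) * mpow z \<kappa> * mpow w \<eta>" for \<eta> \<kappa>
    have "(\<lambda>\<zeta>. norm (kernel_coeffs T \<alpha> \<zeta> * mpow (z \<oplus>\<^sub>v w) \<zeta>)) summable_on UNIV"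
      by (rule summable_on_iff_abs_summable_on_complex[THEN iffD1, OF has_sum_imp_summable[OF abs_entire_has_sum[OF ae]]])
    then have "(\<lambda>(\<kappa>, \<eta>). cmod (H \<eta> \<kappa>)) summable_on UNIV"
      by (subst (asm) summable_case_sum) (simp add: H_def mpow_vconcat mult.assoc)
    then have s: "(\<lambda>(\<eta>, \<kappa>). cmod (H \<eta> \<kappa>)) summable_on UNIV"
      by (subst summable_on_pair_swap)
    have "(\<Sum>\<^sub>\<infinity>(\<eta>, \<kappa>). H \<eta> \<kappa>) = (\<Sum>\<^sub>\<infinity>(\<kappa>, \<eta>). H \<eta> \<kappa>)" by (rule infsum_pair_swap)
    also have "\<dots> = series_fun (kernel_coeffs T \<alpha>) (z \<oplus>\<^sub>v w)"
      unfolding series_fun_def by (subst infsum_case_sum) (simp add: H_def mpow_vconcat mult.assoc)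
    finally have t: "(\<Sum>\<^sub>\<infinity>(\<eta>, \<kappa>). H \<eta> \<kappa>) = series_fun (kernel_coeffs T \<alpha>) (z \<oplus>\<^sub>v w)" .
    have r: "(\<Sum>\<^sub>\<infinity>\<kappa>. H \<eta> \<kappa>) = row_coeffs z \<eta> * mpow w \<eta>" for \<eta>
      unfolding H_def row[symmetric] by (rule infsum_cmult_left') 
    show "((\<lambda>\<eta>. row_coeffs z \<eta> * mpow w \<eta>) has_sum series_fun (kernel_coeffs T \<alpha>) (z \<oplus>\<^sub>v w)) UNIV"
      using group_sums(3)[OF s] unfolding t r .
  qed
  \<comment> \<open>An exponential series with value exp (|z|^2 \<Sum> \<beta>_i), bounding the
    squared norm of evaluation at z. The full norm of z replaces each coordinate.\<close>
  define E where "E = (\<Sum>\<^sub>\<infinity>\<kappa>. mpow (\<chi> i. (norm z)\<^sup>2 * \<beta> $ i) \<kappa> / real (mfact \<kappa>))"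
  have Es: "(\<lambda>\<kappa>. mpow (\<chi> i. (norm z)\<^sup>2 * \<beta> $ i) \<kappa> / real (mfact \<kappa>)) summable_on UNIV"
    using \<beta> by (intro summable_on_exp_mpow) (auto simp: pos_vec_def less_imp_le)
  have s: "(\<lambda>(\<eta>, \<kappa>). wt \<kappa> \<eta>) summable_on Sigma UNIV (\<lambda>_. UNIV)"
    using wt_summable unfolding summable_on_pair_swap[of wt] by simp
  show "fock_term \<alpha> (row_coeffs z) summable_on UNIV"
  proof (rule summable_on_comparison_test)
    show "(\<lambda>\<eta>. E * (\<Sum>\<^sub>\<infinity>\<kappa>. wt \<kappa> \<eta>)) summable_on UNIV"
      by (intro summable_on_cmult_right summable_on_Sigma_banach[OF s])
    fix \<eta>
    define x where "x \<kappa> = sqrt (mpow \<beta> \<kappa> / real (mfact \<kappa>)) * norm z ^ mdeg \<kappa>" for \<kappa>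
    define y where "y \<kappa> = sqrt (real (mfact \<kappa>) / mpow \<beta> \<kappa>) * cmod (T (Poly_Mapping.single \<eta> 1) \<kappa>)" for \<kappa>
    define c where "c = mpow \<alpha> \<eta> / real (mfact \<eta>)"
    have c: "c > 0" using mpow_real_pos[OF \<alpha>, of \<eta>] mfact_pos[of \<eta>] by (simp add: c_def)
    have x2: "(x \<kappa>)\<^sup>2 = mpow (\<chi> i. (norm z)\<^sup>2 * \<beta> $ i) \<kappa> / real (mfact \<kappa>)" for \<kappa>
      unfolding mpow_scale_square using mpow_real_pos[OF \<beta>, of \<kappa>] by (simp add: x_def power_mult_distrib mult_ac)
    have y2: "(y \<kappa>)\<^sup>2 = wt \<kappa> \<eta> / c" for \<kappa>
      using mpow_real_pos[OF \<beta>, of \<kappa>] c by (simp add: y_def wt_def power_mult_distrib c_def[symmetric])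
    have xy: "cmod (T (Poly_Mapping.single \<eta> 1) \<kappa> * mpow z \<kappa>) \<le> x \<kappa> * y \<kappa>" for \<kappa>
    proof -
      have "x \<kappa> * y \<kappa> = cmod (T (Poly_Mapping.single \<eta> 1) \<kappa>) * norm z ^ mdeg \<kappa>"
        using mpow_real_pos[OF \<beta>, of \<kappa>] mfact_pos[of \<kappa>] by (simp add: x_def y_def real_sqrt_divide field_simps)
      then show ?thesis unfolding norm_mult by (simp add: mult_left_mono norm_mpow_norm)
    qed
    have n: "0 \<le> x \<kappa>" "0 \<le> y \<kappa>" for \<kappa> using mpow_real_pos[OF \<beta>, of \<kappa>] by (auto simp: x_def y_def)
    have ws: "(\<lambda>\<kappa>. wt \<kappa> \<eta>) summable_on UNIV"
      using s by (intro summable_on_SigmaD1[of "\<lambda>\<eta> \<kappa>. wt \<kappa> \<eta>" UNIV "\<lambda>_. UNIV"]) auto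
    have xs: "(\<lambda>\<kappa>. (x \<kappa>)\<^sup>2) summable_on UNIV" unfolding x2 by (rule Es)
    have ys: "(\<lambda>\<kappa>. (y \<kappa>)\<^sup>2) summable_on UNIV" unfolding y2 divide_inverse by (intro summable_on_cmult_left ws)
    note cs = infsum_cauchy_schwarz[OF xs ys n]
    have "cmod (\<Sum>\<^sub>\<infinity>\<kappa>. T (Poly_Mapping.single \<eta> 1) \<kappa> * mpow z \<kappa>) \<le> (\<Sum>\<^sub>\<infinity>\<kappa>. x \<kappa> * y \<kappa>)"
      by (rule norm_infsum_le[OF has_sum_infsum[OF colsum] has_sum_infsum[OF cs(1)] xy])
    then have "(cmod (\<Sum>\<^sub>\<infinity>\<kappa>. T (Poly_Mapping.single \<eta> 1) \<kappa> * mpow z \<kappa>))\<^sup>2 \<le> (\<Sum>\<^sub>\<infinity>\<kappa>. x \<kappa> * y \<kappa>)\<^sup>2" by (intro power_mono) auto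
    also have "\<dots> \<le> E * (\<Sum>\<^sub>\<infinity>\<kappa>. wt \<kappa> \<eta> / c)" using cs(2) by (simp add: x2 y2 E_def)
    also have "(\<Sum>\<^sub>\<infinity>\<kappa>. wt \<kappa> \<eta> / c) = (\<Sum>\<^sub>\<infinity>\<kappa>. wt \<kappa> \<eta>) / c"
      unfolding divide_inverse by (rule infsum_cmult_left) (rule ws)
    finally have "c * (cmod (\<Sum>\<^sub>\<infinity>\<kappa>. T (Poly_Mapping.single \<eta> 1) \<kappa> * mpow z \<kappa>))\<^sup>2 \<le> c * (E * ((\<Sum>\<^sub>\<infinity>\<kappa>. wt \<kappa> \<eta>) / c))"
      using c by (intro mult_left_mono) auto
    moreover have "fock_term \<alpha> (row_coeffs z) \<eta> = c * (cmod (\<Sum>\<^sub>\<infinity>\<kappa>. T (Poly_Mapping.single \<eta> 1) \<kappa> * mpow z \<kappa>))\<^sup>2"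
    proof -
      have "real (mfact \<eta>) / mpow \<alpha> \<eta> = 1 / c" by (simp add: c_def)
      then show ?thesis unfolding fock_term_def row_coeffs_def c_def[symmetric] norm_mult power_mult_distrib norm_of_real
        using c by (simp add: power2_eq_square)
    qed
    ultimately show "fock_term \<alpha> (row_coeffs z) \<eta> \<le> E * (\<Sum>\<^sub>\<infinity>\<kappa>. wt \<kappa> \<eta>)" using c by simp
    show "0 \<le> fock_term \<alpha> (row_coeffs z) \<eta>" by (rule fock_term_nonneg[OF \<alpha>])
  qed
qed

lemma ext_as_pairing:
  assumes b: "fock_term \<alpha> b summable_on UNIV"
  shows "((\<lambda>\<eta>. b \<eta> * row_coeffs z \<eta> * of_real (real (mfact \<eta>) / mpow \<alpha> \<eta>)) has_sum series_fun (ext_coeffs T b) z) UNIV"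
proof -
  have "b \<eta> * row_coeffs z \<eta> * of_real (real (mfact \<eta>) / mpow \<alpha> \<eta>) = b \<eta> * (\<Sum>\<^sub>\<infinity>\<kappa>. T (Poly_Mapping.single \<eta> 1) \<kappa> * mpow z \<kappa>)" for \<eta>
    using mpow_real_pos[OF \<alpha>, of \<eta>] mfact_pos[of \<eta>] by (simp add: row_coeffs_def)
  then show ?thesis using ext_value(2)[OF b, of z] by simp
qed

end

section \<open>Gaussian integrals\<close>

lemma prod_Basis_cvec:
  fixes g :: "complex ^ 'n::finite \<Rightarrow> 'b::comm_monoid_mult"
  shows "(\<Prod>b\<in>Basis. g b) = (\<Prod>i\<in>UNIV. g (axis i 1) * g (axis i \<i>))"
proof -
  have B: "(Basis :: (complex ^ 'n) set) = (\<lambda>(i, u). axis i u) ` (UNIV \<times> Basis)"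
    by (auto simp: Basis_vec_def)
  have inj: "inj_on (\<lambda>(i, u). axis i u :: complex ^ 'n) (UNIV \<times> Basis)"
    by (auto simp: inj_on_def axis_eq_axis Basis_complex_def)
  have "(\<Prod>b\<in>Basis. g b) = (\<Prod>(i, u)\<in>UNIV \<times> Basis. g (axis i u))"
    unfolding B by (subst prod.reindex[OF inj]) (simp add: case_prod_unfold)
  also have "\<dots> = (\<Prod>i\<in>UNIV. \<Prod>u\<in>Basis. g (axis i u))" by (rule prod.cartesian_product[symmetric])
  finally show ?thesis by (simp add: Basis_complex_def)
qed

lemma nn_integral_gaussian_real:
  assumes c: "c > 0"
  shows "(\<integral>\<^sup>+x. ennreal (exp (- c * x\<^sup>2)) \<partial>lborel) = ennreal (sqrt (pi / c))"
proof -
  define s where "s = 1 / sqrt (2 * c)"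
  have s: "s > 0" "s\<^sup>2 = 1 / (2 * c)" using c by (auto simp: s_def power_divide)
  have e: "exp (- c * x\<^sup>2) = sqrt (pi / c) * normal_density 0 s x" for x
    using c by (simp add: normal_density_def s field_simps real_sqrt_divide)
  have "(\<integral>\<^sup>+x. ennreal (normal_density 0 s x) \<partial>lborel) = 1"
    using nn_integral_eq_integral[OF integrable_normal_density[OF s(1), of 0]] s(1) by simp
  then show ?thesis
    unfolding e using c by (simp add: ennreal_mult nn_integral_cmult)
qed

lemma nn_integral_gaussian:
  fixes c :: "'n::finite \<Rightarrow> real"
  assumes c: "\<And>i. c i > 0"
  shows "(\<integral>\<^sup>+w. ennreal (exp (- (\<Sum>i\<in>UNIV. c i * (cmod (w $ i))\<^sup>2))) \<partial>lborel) = ennreal (\<Prod>i\<in>UNIV. pi / c i)"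
proof -
  define C where "C b = (\<Sum>i\<in>UNIV. c i * (cmod (b $ i))\<^sup>2)" for b :: "complex ^ 'n"
  have C: "C (axis i u) = c i * (cmod u)\<^sup>2" for i u
  proof -
    have "C (axis i u) = (\<Sum>j\<in>UNIV. if j = i then c i * (cmod u)\<^sup>2 else 0)"
      unfolding C_def by (intro sum.cong) (auto simp: axis_def)
    then show ?thesis by simp
  qed
  have e: "ennreal (exp (- (\<Sum>i\<in>UNIV. c i * (cmod (w $ i))\<^sup>2))) = (\<Prod>b\<in>Basis. ennreal (exp (- C b * (w \<bullet> b)\<^sup>2)))" for w
  proof -
    have "(\<Prod>b\<in>Basis. exp (- C b * (w \<bullet> b)\<^sup>2)) = (\<Prod>i\<in>UNIV. exp (- (c i * (cmod (w $ i))\<^sup>2)))"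
      unfolding prod_Basis_cvec C inner_axis
      by (intro prod.cong refl) (simp add: exp_add[symmetric] cmod_power2 inner_complex_def algebra_simps)
    then show ?thesis by (simp add: prod_ennreal exp_sum sum_negf[symmetric])
  qed
  have "(\<integral>\<^sup>+w. ennreal (exp (- (\<Sum>i\<in>UNIV. c i * (cmod (w $ i))\<^sup>2))) \<partial>lborel)
      = (\<Prod>b\<in>Basis. \<integral>\<^sup>+x. ennreal (exp (- C b * x\<^sup>2)) \<partial>lborel)"
    unfolding e by (rule nn_integral_lborel_prod[of "\<lambda>b x. ennreal (exp (- C b * x\<^sup>2))"]) auto
  also have "\<dots> = (\<Prod>i\<in>UNIV. ennreal (sqrt (pi / c i)) * ennreal (sqrt (pi / c i)))"
    unfolding prod_Basis_cvec C using nn_integral_gaussian_real[OF c] by simp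
  also have "\<dots> = ennreal (\<Prod>i\<in>UNIV. pi / c i)"
    using c by (simp add: ennreal_mult[symmetric] less_imp_le prod_ennreal)
  finally show ?thesis .
qed

text \<open>Only values to the right of 0 are known, so the constant term is recovered as a
  one-sided limit; division by t^n shifts the argument to the next coefficient.\<close>

lemma power_series_zero:
  fixes a :: "nat \<Rightarrow> real"
  assumes s: "s > 0" and z: "\<And>t. 0 < t \<Longrightarrow> t < s \<Longrightarrow> (\<lambda>n. a n * t ^ n) sums 0"
  shows "a n = 0"
proof (induction n rule: less_induct)
  case (less n)
  define b where "b k = a (k + n)" for k
  have bs: "(\<lambda>k. b k * t ^ k) sums 0" if t: "0 < t" "t < s" for t
  proof -
    have "(\<lambda>k. a (k + n) * t ^ (k + n)) sums (0 - (\<Sum>i<n. a i * t ^ i))"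
      using z[OF t] by (rule sums_split_initial_segment)
    then have "(\<lambda>k. (a (k + n) * t ^ (k + n)) / t ^ n) sums ((0 - (\<Sum>i<n. a i * t ^ i)) / t ^ n)" by (rule sums_divide)
    then show ?thesis using t less by (simp add: b_def power_add)
  qed
  have sm: "summable (\<lambda>k. b k * x ^ k)" if "\<bar>x\<bar> < s / 2" for x
    by (rule powser_inside[of _ "s/2"]) (use bs[of "s/2"] s that in \<open>auto simp: sums_iff\<close>)
  define f where "f x = suminf (\<lambda>k. b k * x ^ k)" for x
  have "f \<midarrow>0\<rightarrow> b 0"
    by (rule powser_limit_0[of "s/2"]) (use s sm in \<open>auto simp: f_def intro: summable_sums\<close>)
  then have 1: "(f \<longlongrightarrow> b 0) (at_right 0)" by (rule filterlim_at_split[THEN iffD1, THEN conjunct2])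
  have "\<forall>\<^sub>F t in at_right 0. f t = 0"
    using eventually_at_right_less[of 0] eventually_at_right_field[of "\<lambda>t. t < s" 0, THEN iffD2] s
    by (auto simp: eventually_at_right_field f_def intro!: exI[of _ s] sums_unique[symmetric] bs)
  then have "(f \<longlongrightarrow> 0) (at_right 0)" by (rule tendsto_eventually)
  with 1 have "b 0 = 0" by (intro tendsto_unique[of "at_right (0::real)"]) auto
  then show ?case by (simp add: b_def)
qed

text \<open>Moments from a generating function: inserting exp (t |w_j|^2) merely changes c_j to c_j
  - t, and expanding both sides in t identifies the moments in coordinate j. This is why c varies in
  the induction.\<close>

lemma nn_integral_gaussian_moments:
  fixes c :: "'n::finite \<Rightarrow> real" and \<eta> :: "'n \<Rightarrow> nat"
  assumes "finite S" and c: "\<And>i. c i > 0"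
  shows "(\<integral>\<^sup>+w. ennreal ((\<Prod>i\<in>S. (cmod (w $ i))\<^sup>2 ^ \<eta> i) * exp (- (\<Sum>i\<in>UNIV. c i * (cmod (w $ i))\<^sup>2))) \<partial>lborel)
    = ennreal ((\<Prod>i\<in>S. pi * fact (\<eta> i) / c i ^ Suc (\<eta> i)) * (\<Prod>i\<in>-S. pi / c i))"
  using assms
proof (induction S arbitrary: c rule: finite_induct)
  case empty
  then show ?case by (simp add: nn_integral_gaussian)
next
  case (insert j S)
  define g where "g k w = (\<Prod>i\<in>S. (cmod (w $ i))\<^sup>2 ^ \<eta> i) * (cmod (w $ j))\<^sup>2 ^ k * exp (- (\<Sum>i\<in>UNIV. c i * (cmod (w $ i))\<^sup>2))" for k and w :: "complex ^ 'n"
  have g0: "0 \<le> g k w" for k w by (auto simp: g_def intro!: mult_nonneg_nonneg prod_nonneg)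
  have gm: "g k \<in> borel_measurable borel" for k
    unfolding g_def by (intro borel_measurable_continuous_onI continuous_intros)
  define J where "J k = (\<integral>\<^sup>+w. ennreal (g k w) \<partial>lborel)" for k
  define A where "A = (\<Prod>i\<in>S. pi * fact (\<eta> i) / c i ^ Suc (\<eta> i)) * (\<Prod>i\<in>-(insert j S). pi / c i)"
  have A: "A > 0" unfolding A_def using insert.prems by (intro mult_pos_pos prod_pos) auto
  have mS: "-S = insert j (-(insert j S))" "j \<notin> -(insert j S)" using insert.hyps by auto
  have key: "suminf (\<lambda>k. J k * ennreal (t ^ k / fact k)) = ennreal (A * (pi / (c j - t)))" if t: "0 < t" "t < c j" for t
  proof -
    have ex: "ennreal ((\<Prod>i\<in>S. (cmod (w $ i))\<^sup>2 ^ \<eta> i) * exp (- (\<Sum>i\<in>UNIV. (c(j := c j - t)) i * (cmod (w $ i))\<^sup>2)))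
        = suminf (\<lambda>k. ennreal (g k w) * ennreal (t ^ k / fact k))" for w
    proof -
      have "(\<Sum>i\<in>UNIV. (c(j := c j - t)) i * (cmod (w $ i))\<^sup>2) = (\<Sum>i\<in>UNIV. c i * (cmod (w $ i))\<^sup>2) - t * (cmod (w $ j))\<^sup>2"
        by (simp add: sum.remove[of UNIV j] algebra_simps)
      then have "exp (- (\<Sum>i\<in>UNIV. (c(j := c j - t)) i * (cmod (w $ i))\<^sup>2)) = exp (- (\<Sum>i\<in>UNIV. c i * (cmod (w $ i))\<^sup>2)) * exp (t * (cmod (w $ j))\<^sup>2)"
        by (simp add: exp_add[symmetric])
      moreover have "(\<lambda>k. (t * (cmod (w $ j))\<^sup>2) ^ k /\<^sub>R fact k) sums exp (t * (cmod (w $ j))\<^sup>2)" by (rule exp_converges)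
      from sums_mult[OF this, of "(\<Prod>i\<in>S. (cmod (w $ i))\<^sup>2 ^ \<eta> i) * exp (- (\<Sum>i\<in>UNIV. c i * (cmod (w $ i))\<^sup>2))"]
      have "(\<lambda>k. g k w * (t ^ k / fact k)) sums ((\<Prod>i\<in>S. (cmod (w $ i))\<^sup>2 ^ \<eta> i) * exp (- (\<Sum>i\<in>UNIV. c i * (cmod (w $ i))\<^sup>2)) * exp (t * (cmod (w $ j))\<^sup>2))"
        by (simp add: g_def power_mult_distrib field_simps)
      ultimately have "(\<lambda>k. g k w * (t ^ k / fact k)) sums ((\<Prod>i\<in>S. (cmod (w $ i))\<^sup>2 ^ \<eta> i) * exp (- (\<Sum>i\<in>UNIV. (c(j := c j - t)) i * (cmod (w $ i))\<^sup>2)))"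
        by (simp add: mult.assoc)
      then have "suminf (\<lambda>k. ennreal (g k w * (t ^ k / fact k))) = ennreal ((\<Prod>i\<in>S. (cmod (w $ i))\<^sup>2 ^ \<eta> i) * exp (- (\<Sum>i\<in>UNIV. (c(j := c j - t)) i * (cmod (w $ i))\<^sup>2)))"
        using g0 t by (intro suminf_ennreal_eq) auto
      moreover have "ennreal (g k w) * ennreal (t ^ k / fact k) = ennreal (g k w * (t ^ k / fact k))" for k
        using g0 t by (intro ennreal_mult[symmetric]) auto
      ultimately show ?thesis by (simp only:)
    qed
    have "suminf (\<lambda>k. J k * ennreal (t ^ k / fact k)) = suminf (\<lambda>k. \<integral>\<^sup>+w. ennreal (g k w) * ennreal (t ^ k / fact k) \<partial>lborel)"
      unfolding J_def using gm by (subst nn_integral_multc) auto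
    also have "\<dots> = (\<integral>\<^sup>+w. suminf (\<lambda>k. ennreal (g k w) * ennreal (t ^ k / fact k)) \<partial>lborel)"
      using gm by (subst nn_integral_suminf) auto
    also have "\<dots> = ennreal ((\<Prod>i\<in>S. pi * fact (\<eta> i) / (c(j := c j - t)) i ^ Suc (\<eta> i)) * (\<Prod>i\<in>-S. pi / (c(j := c j - t)) i))"
      unfolding ex[symmetric] using insert.prems t by (intro insert.IH) auto
    also have "(\<Prod>i\<in>S. pi * fact (\<eta> i) / (c(j := c j - t)) i ^ Suc (\<eta> i)) = (\<Prod>i\<in>S. pi * fact (\<eta> i) / c i ^ Suc (\<eta> i))"
      using insert.hyps by (intro prod.cong) auto
    also have "(\<Prod>i\<in>-S. pi / (c(j := c j - t)) i) = pi / (c j - t) * (\<Prod>i\<in>-(insert j S). pi / c i)"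
      by (subst mS(1), subst prod.insert) (use mS(2) in \<open>auto intro!: prod.cong\<close>)
    finally show ?thesis by (simp add: A_def mult_ac)
  qed
  \<comment> \<open>One admissible parameter suffices for finiteness: each moment times a positive
    factor is a single term of a finite sum.\<close>
  define t0 where "t0 = c j / 2"
  have t0: "0 < t0" "t0 < c j" using insert.prems[of j] by (auto simp: t0_def)
  have Jfin: "J k < \<infinity>" for k
  proof -
    have "J k * ennreal (t0 ^ k / fact k) \<le> suminf (\<lambda>k. J k * ennreal (t0 ^ k / fact k))"
      using sum_le_suminf[OF summableI, of "{k}" "\<lambda>k. J k * ennreal (t0 ^ k / fact k)"] by simp
    also have "\<dots> < \<infinity>" unfolding key[OF t0] by simp
    finally show ?thesis using t0 by (auto simp: ennreal_mult_less_top)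
  qed
  define r where "r k = enn2real (J k)" for k
  have r: "J k = ennreal (r k)" "r k \<ge> 0" for k using Jfin[of k] by (auto simp: r_def)
  \<comment> \<open>The right-hand side A pi / (c_j - t) is a geometric series in t / c_j.\<close>
  have "r k / fact k - A * pi / c j ^ Suc k = 0" for k
  proof (rule power_series_zero[of "c j" "\<lambda>k. r k / fact k - A * pi / c j ^ Suc k"])
    show "c j > 0" using insert.prems by simp
    fix t assume t: "0 < t" "t < c j"
    have 1: "(\<lambda>k. r k / fact k * t ^ k) sums (A * (pi / (c j - t)))"
    proof -
      have e: "suminf (\<lambda>k. ennreal (r k / fact k * t ^ k)) = ennreal (A * (pi / (c j - t)))"
        using key[OF t] r t by (simp add: ennreal_mult[symmetric])
      have nn: "0 \<le> r k / fact k * t ^ k" for k using r t by simp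
      have sm: "summable (\<lambda>k. r k / fact k * t ^ k)"
        by (rule summable_suminf_not_top[OF nn]) (unfold e, simp)
      have "ennreal (suminf (\<lambda>k. r k / fact k * t ^ k)) = ennreal (A * (pi / (c j - t)))"
        using suminf_ennreal2[OF nn sm, symmetric] e by (rule trans)
      moreover have "0 \<le> A * (pi / (c j - t))" using A t by simp
      ultimately have "suminf (\<lambda>k. r k / fact k * t ^ k) = A * (pi / (c j - t))"
        using suminf_nonneg[OF sm nn] by simp
      then show ?thesis using summable_sums[OF sm] by simp
    qed
    have "(\<lambda>k. (t / c j) ^ k) sums (1 / (1 - t / c j))" using t by (intro geometric_sums) auto
    from sums_mult[OF this, of "A * pi / c j"]
    have 2: "(\<lambda>k. A * pi / c j ^ Suc k * t ^ k) sums (A * (pi / (c j - t)))"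
      using t by (simp add: power_divide field_simps)
    show "(\<lambda>k. (r k / fact k - A * pi / c j ^ Suc k) * t ^ k) sums 0"
      using sums_diff[OF 1 2] by (simp add: left_diff_distrib)
  qed
  from this[of "\<eta> j"] have "r (\<eta> j) = A * (pi * fact (\<eta> j) / c j ^ Suc (\<eta> j))"
    using insert.prems[of j] by (simp add: field_simps)
  then have "J (\<eta> j) = ennreal (A * (pi * fact (\<eta> j) / c j ^ Suc (\<eta> j)))" by (simp add: r)
  moreover have "g (\<eta> j) w = (\<Prod>i\<in>insert j S. (cmod (w $ i))\<^sup>2 ^ \<eta> i) * exp (- (\<Sum>i\<in>UNIV. c i * (cmod (w $ i))\<^sup>2))" for w
    using insert.hyps by (simp add: g_def mult_ac)
  moreover have "A * (pi * fact (\<eta> j) / c j ^ Suc (\<eta> j)) = (\<Prod>i\<in>insert j S. pi * fact (\<eta> i) / c i ^ Suc (\<eta> i)) * (\<Prod>i\<in>-(insert j S). pi / c i)"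
    using insert.hyps by (simp add: A_def)
  ultimately show ?case by (simp add: J_def)
qed

section \<open>Rotation invariance of Lebesgue measure\<close>

text \<open>Integrating over the b1-coordinate first, the shear is a translation by a constant
  determined by the b2-coordinate, which stays fixed because b1 \<noteq> b2.\<close>

lemma lborel_shear:
  fixes b1 b2 :: "'a::euclidean_space"
  assumes b: "b1 \<in> Basis" "b2 \<in> Basis" "b1 \<noteq> b2"
  shows "distr lborel borel (\<lambda>x. x + (c * (x \<bullet> b2)) *\<^sub>R b1) = lborel"
proof (rule measure_eqI)
  let ?S = "\<lambda>x. x + (c * (x \<bullet> b2)) *\<^sub>R b1"
  interpret product_sigma_finite "\<lambda>_::'a. lborel :: real measure" ..
  define I where "I = Basis - {b1}"
  have I: "Basis = insert b1 I" "finite I" "b1 \<notin> I" using b by (auto simp: I_def)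
  have Sm: "?S \<in> borel_measurable borel"
    by (intro borel_measurable_continuous_onI continuous_intros)
  have main: "(\<integral>\<^sup>+x. f (?S x) \<partial>lborel) = (\<integral>\<^sup>+x. f x \<partial>lborel)" if f: "f \<in> borel_measurable borel" for f :: "'a \<Rightarrow> ennreal"
  proof -
    define V where "V x = (\<Sum>b\<in>Basis. x b *\<^sub>R b)" for x :: "'a \<Rightarrow> real"
    have Vm: "V \<in> measurable (\<Pi>\<^sub>M b\<in>Basis. lborel) borel"
      unfolding V_def by measurable
    have red: "(\<integral>\<^sup>+x. g x \<partial>lborel) = (\<integral>\<^sup>+x. \<integral>\<^sup>+y. g (V (x(b1 := y))) \<partial>lborel \<partial>(\<Pi>\<^sub>M b\<in>I. lborel))"
      if g: "g \<in> borel_measurable borel" for g :: "'a \<Rightarrow> ennreal"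
    proof -
      have gV: "(\<lambda>x. g (V x)) \<in> borel_measurable (\<Pi>\<^sub>M b\<in>Basis. lborel)"
        using measurable_compose[OF Vm g] .
      have "(\<integral>\<^sup>+x. g x \<partial>lborel) = (\<integral>\<^sup>+x. g (V x) \<partial>(\<Pi>\<^sub>M b\<in>Basis. lborel))"
        using g Vm by (subst lborel_eq) (simp add: nn_integral_distr V_def)
      also have "\<dots> = (\<integral>\<^sup>+x. \<integral>\<^sup>+y. g (V (x(b1 := y))) \<partial>lborel \<partial>(\<Pi>\<^sub>M b\<in>I. lborel))"
        using gV unfolding I(1) by (rule product_nn_integral_insert[OF I(2,3)])
      finally show ?thesis .
    qed
    have Vu: "V (x(b1 := y)) = y *\<^sub>R b1 + (\<Sum>b\<in>I. x b *\<^sub>R b)" for x y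
    proof -
      have "(\<Sum>b\<in>I. (x(b1 := y)) b *\<^sub>R b) = (\<Sum>b\<in>I. x b *\<^sub>R b)" using I(3) by (intro sum.cong) auto
      then show ?thesis unfolding V_def I(1) using I(2,3) by simp
    qed
    have Vi: "V (x(b1 := y)) \<bullet> b2 = x b2" for x y
      unfolding V_def using b by (simp add: inner_sum_left_Basis)
    have "(\<integral>\<^sup>+x. f (?S x) \<partial>lborel) = (\<integral>\<^sup>+x. \<integral>\<^sup>+y. f (?S (V (x(b1 := y)))) \<partial>lborel \<partial>(\<Pi>\<^sub>M b\<in>I. lborel))"
      by (rule red[OF measurable_compose[OF Sm f]])
    also have "\<dots> = (\<integral>\<^sup>+x. \<integral>\<^sup>+y. f (V (x(b1 := y))) \<partial>lborel \<partial>(\<Pi>\<^sub>M b\<in>I. lborel))"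
    proof (rule nn_integral_cong)
      fix x
      define h where "h y = f (y *\<^sub>R b1 + (\<Sum>b\<in>I. x b *\<^sub>R b))" for y
      have hm: "h \<in> borel_measurable borel"
        unfolding h_def by (rule measurable_compose[OF _ f]) (intro borel_measurable_continuous_onI continuous_intros)
      have "f (?S (V (x(b1 := y)))) = h (c * x b2 + 1 * y)" for y
        unfolding Vi unfolding Vu h_def by (simp add: algebra_simps)
      then have "(\<integral>\<^sup>+y. f (?S (V (x(b1 := y)))) \<partial>lborel) = (\<integral>\<^sup>+y. h (c * x b2 + 1 * y) \<partial>lborel)" by simp
      also have "\<dots> = (\<integral>\<^sup>+y. h y \<partial>lborel)"
        using nn_integral_real_affine[OF hm, of 1 "c * x b2"] by simp
      finally show "(\<integral>\<^sup>+y. f (?S (V (x(b1 := y)))) \<partial>lborel) = (\<integral>\<^sup>+y. f (V (x(b1 := y))) \<partial>lborel)"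
        by (simp add: h_def Vu)
    qed
    also have "\<dots> = (\<integral>\<^sup>+x. f x \<partial>lborel)" by (rule red[OF f, symmetric])
    finally show ?thesis .
  qed
  fix A assume "A \<in> sets (distr lborel borel ?S)"
  then have A: "A \<in> sets borel" by simp
  have "emeasure (distr lborel borel ?S) A = (\<integral>\<^sup>+x. indicator A x \<partial>distr lborel borel ?S)" using A by simp
  also have "\<dots> = (\<integral>\<^sup>+x. indicator A (?S x) \<partial>lborel)" using A Sm by (subst nn_integral_distr) auto
  also have "\<dots> = (\<integral>\<^sup>+x. indicator A x \<partial>lborel)" by (rule main) (use A in auto)
  also have "\<dots> = emeasure lborel A" using A by simp
  finally show "emeasure (distr lborel borel ?S) A = emeasure lborel A" .
qed simp

definition rot :: "'n::finite \<Rightarrow> real \<Rightarrow> complex ^ 'n \<Rightarrow> complex ^ 'n" where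
  "rot j \<theta> w = (\<chi> i. if i = j then cis \<theta> * w $ i else w $ i)"

text \<open>
  A plane rotation is a product of three shears.
\<close>

lemma lborel_rot:
  fixes j :: "'n::finite"
  assumes \<theta>: "\<bar>\<theta>\<bar> < pi"
  shows "distr lborel borel (rot j \<theta>) = lborel"
proof -
  define b1 b2 :: "complex ^ 'n" where "b1 = axis j 1" and "b2 = axis j \<i>"
  have b: "b1 \<in> Basis" "b2 \<in> Basis" "b1 \<noteq> b2"
    by (auto simp: b1_def b2_def Basis_vec_def Basis_complex_def axis_eq_axis)
  \<comment> \<open>The outer shears have coefficient -tan (\<theta>/2) and the middle one sin
    \<theta>; the restriction on \<theta> keeps cos (\<theta>/2) positive.\<close>
  define t where "t = tan (\<theta> / 2)"
  define s where "s = sin \<theta>"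
  have c0: "cos (\<theta> / 2) > 0" using \<theta> by (intro cos_gt_zero_pi) auto
  have st: "1 - t * s = cos \<theta>" "t + t * cos \<theta> = s"
  proof -
    have "sin \<theta> = 2 * sin (\<theta> / 2) * cos (\<theta> / 2)" "cos \<theta> = 1 - 2 * (sin (\<theta> / 2))\<^sup>2" "cos \<theta> = 2 * (cos (\<theta> / 2))\<^sup>2 - 1"
      using sin_double[of "\<theta>/2"] cos_double_sin[of "\<theta>/2"] cos_double_cos[of "\<theta>/2"] by auto
    moreover have tc: "t * cos (\<theta> / 2) = sin (\<theta> / 2)" using c0 by (simp add: t_def tan_def)
    ultimately show "1 - t * s = cos \<theta>"
      unfolding s_def by (simp add: power2_eq_square)
    have "t + t * cos \<theta> = t * (1 + cos \<theta>)" by (simp add: algebra_simps)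
    also have "1 + cos \<theta> = 2 * cos (\<theta> / 2) * cos (\<theta> / 2)" using cos_double_cos[of "\<theta>/2"] by (simp add: power2_eq_square)
    also have "t * (2 * cos (\<theta> / 2) * cos (\<theta> / 2)) = 2 * (t * cos (\<theta> / 2)) * cos (\<theta> / 2)" by simp
    also have "\<dots> = s" unfolding tc s_def using sin_double[of "\<theta>/2"] by simp
    finally show "t + t * cos \<theta> = s" .
  qed
  define S1 where "S1 x = x + (- t * (x \<bullet> b2)) *\<^sub>R b1" for x :: "complex ^ 'n"
  define S2 where "S2 x = x + (s * (x \<bullet> b1)) *\<^sub>R b2" for x :: "complex ^ 'n"
  have D: "distr lborel borel S1 = lborel" "distr lborel borel S2 = lborel"
    unfolding S1_def S2_def using b by (intro lborel_shear; simp)+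
  have m: "S1 \<in> borel_measurable borel" "S2 \<in> borel_measurable borel"
    unfolding S1_def S2_def by (intro borel_measurable_continuous_onI continuous_intros)+
  have r: "rot j \<theta> = S1 \<circ> (S2 \<circ> S1)"
  proof
    fix w :: "complex ^ 'n"
    have ip: "x \<bullet> b1 = Re (x $ j)" "x \<bullet> b2 = Im (x $ j)" for x
      by (simp_all add: b1_def b2_def inner_axis inner_complex_def)
    have "(S1 (S2 (S1 w))) $ i = rot j \<theta> w $ i" for i
    proof (cases "i = j")
      case False
      then show ?thesis by (simp add: S1_def S2_def b1_def b2_def rot_def axis_def)
    next
      case True
      define x y where "x = Re (w $ j)" and "y = Im (w $ j)"
      have cx: "Complex (Re z) (Im z) = z" for z by simp
      have 1: "S1 v $ j = Complex (Re (v $ j) - t * Im (v $ j)) (Im (v $ j))" for v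
        by (simp add: S1_def ip b1_def axis_def complex_eq_iff)
      have 2: "S2 v $ j = Complex (Re (v $ j)) (Im (v $ j) + s * Re (v $ j))" for v
        by (simp add: S2_def ip b2_def axis_def complex_eq_iff)
      have "S1 (S2 (S1 w)) $ j = Complex ((x - t * y) - t * (y + s * (x - t * y))) (y + s * (x - t * y))"
        unfolding 1 2 by (simp add: x_def y_def)
      also have "\<dots> = Complex ((1 - t * s) * x - (t + t * (1 - t * s)) * y) (s * x + (1 - t * s) * y)"
        by (simp add: algebra_simps)
      also have "\<dots> = cis \<theta> * w $ j" unfolding st
        by (simp add: complex_eq_iff x_def y_def s_def)
      finally show ?thesis using True by (simp add: rot_def)
    qed
    then show "rot j \<theta> w = (S1 \<circ> (S2 \<circ> S1)) w" by (simp add: vec_eq_iff)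
  qed
  have "distr lborel borel (rot j \<theta>) = distr (distr (distr lborel borel S1) borel S2) borel S1"
    using m by (simp add: r distr_distr measurable_comp)
  also have "\<dots> = lborel" by (simp only: D)
  finally show ?thesis .
qed

lemma has_sum_diff:
  fixes f g :: "'a \<Rightarrow> 'b::real_normed_algebra_1"
  assumes "(f has_sum a) A" "(g has_sum b) A"
  shows "((\<lambda>x. f x - g x) has_sum (a - b)) A"
  using has_sum_add[OF assms(1) has_sum_cmult_right[OF assms(2), of "-1"]] by simp

section \<open>Orthogonality and the norm identity for the Gaussian measure\<close>

definition gauss_density :: "real ^ 'n::finite \<Rightarrow> complex ^ 'n \<Rightarrow> real" where
  "gauss_density \<alpha> w = (\<Prod>i\<in>UNIV. \<alpha> $ i) / pi ^ CARD('n) * exp (- (\<Sum>i\<in>UNIV. \<alpha> $ i * (cmod (w $ i))\<^sup>2))"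

lemma gauss_measure_eq: "gauss_measure \<alpha> = density lborel (\<lambda>w. ennreal (gauss_density \<alpha> w))"
  by (simp add: gauss_measure_def gauss_density_def)

lemma gauss_density_measurable [measurable]: "gauss_density \<alpha> \<in> borel_measurable borel"
  unfolding gauss_density_def by (intro borel_measurable_continuous_onI continuous_intros)

lemma gauss_density_nonneg: "pos_vec \<alpha> \<Longrightarrow> 0 \<le> gauss_density \<alpha> w"
  by (auto simp: gauss_density_def pos_vec_def less_imp_le intro!: mult_nonneg_nonneg divide_nonneg_nonneg prod_nonneg)

lemma sets_gauss_measure [simp, measurable_cong]: "sets (gauss_measure \<alpha>) = sets borel"
  by (simp add: gauss_measure_eq)

lemma mpow_measurable [measurable]: "(\<lambda>w :: complex ^ 'n::finite. mpow w \<eta>) \<in> borel_measurable borel"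
  unfolding mpow_def by (intro borel_measurable_continuous_onI continuous_intros)

lemma nn_integral_monomial:
  fixes \<alpha> :: "real ^ 'n::finite"
  assumes \<alpha>: "pos_vec \<alpha>"
  shows "(\<integral>\<^sup>+w. ennreal ((cmod (mpow w \<eta>))\<^sup>2) \<partial>gauss_measure \<alpha>) = ennreal (real (mfact \<eta>) / mpow \<alpha> \<eta>)"
proof -
  have p: "\<alpha> $ i > 0" for i using \<alpha> by (simp add: pos_vec_def)
  define C where "C = (\<Prod>i\<in>UNIV. \<alpha> $ i) / pi ^ CARD('n)"
  have C: "C > 0" unfolding C_def using p by (intro divide_pos_pos prod_pos) auto
  define g where "g w = (\<Prod>i\<in>UNIV. (cmod (w $ i))\<^sup>2 ^ \<eta> i) * exp (- (\<Sum>i\<in>UNIV. \<alpha> $ i * (cmod (w $ i))\<^sup>2))" for w :: "complex ^ 'n"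
  have gm: "g \<in> borel_measurable borel"
    unfolding g_def by (intro borel_measurable_continuous_onI continuous_intros)
  have e: "gauss_density \<alpha> w * (cmod (mpow w \<eta>))\<^sup>2 = C * g w" for w
    by (simp add: gauss_density_def C_def g_def norm_mpow prod_power_distrib power_mult[symmetric] mult.commute)
  have "(\<integral>\<^sup>+w. ennreal ((cmod (mpow w \<eta>))\<^sup>2) \<partial>gauss_measure \<alpha>)
     = (\<integral>\<^sup>+w. ennreal (gauss_density \<alpha> w) * ennreal ((cmod (mpow w \<eta>))\<^sup>2) \<partial>lborel)"
    unfolding gauss_measure_eq by (rule nn_integral_density) auto
  also have "\<dots> = (\<integral>\<^sup>+w. ennreal C * ennreal (g w) \<partial>lborel)"
  proof (rule nn_integral_cong)
    fix w
    have "g w \<ge> 0" by (auto simp: g_def intro!: mult_nonneg_nonneg prod_nonneg)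
    then show "ennreal (gauss_density \<alpha> w) * ennreal ((cmod (mpow w \<eta>))\<^sup>2) = ennreal C * ennreal (g w)"
      using C gauss_density_nonneg[OF \<alpha>, of w] by (simp add: ennreal_mult[symmetric] e)
  qed
  also have "\<dots> = ennreal C * (\<integral>\<^sup>+w. ennreal (g w) \<partial>lborel)" by (rule nn_integral_cmult) (use gm in auto)
  also have "(\<integral>\<^sup>+w. ennreal (g w) \<partial>lborel) = ennreal (\<Prod>i\<in>UNIV. pi * fact (\<eta> i) / \<alpha> $ i ^ Suc (\<eta> i))"
    unfolding g_def using nn_integral_gaussian_moments[where S = UNIV and \<eta> = \<eta> and c = "\<lambda>i. \<alpha> $ i", OF finite p] by simp
  also have "ennreal C * ennreal (\<Prod>i\<in>UNIV. pi * fact (\<eta> i) / \<alpha> $ i ^ Suc (\<eta> i)) = ennreal (real (mfact \<eta>) / mpow \<alpha> \<eta>)"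
  proof -
    have "C * (\<Prod>i\<in>UNIV. pi * fact (\<eta> i) / \<alpha> $ i ^ Suc (\<eta> i)) = (\<Prod>i\<in>UNIV. (\<alpha> $ i / pi) * (pi * fact (\<eta> i) / \<alpha> $ i ^ Suc (\<eta> i)))"
      by (simp add: C_def prod.distrib prod_dividef)
    also have "\<dots> = (\<Prod>i\<in>UNIV. fact (\<eta> i) / \<alpha> $ i ^ \<eta> i)"
    proof (rule prod.cong[OF refl])
      fix i show "(\<alpha> $ i / pi) * (pi * fact (\<eta> i) / \<alpha> $ i ^ Suc (\<eta> i)) = fact (\<eta> i) / \<alpha> $ i ^ \<eta> i"
        using p[of i] by simp
    qed
    finally show ?thesis using C by (simp add: ennreal_mult'[symmetric] prod_dividef mfact_def mpow_def)
  qed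
  finally show ?thesis .
qed

lemma integrable_monomial_pair:
  assumes \<alpha>: "pos_vec \<alpha>"
  shows "integrable (gauss_measure \<alpha>) (\<lambda>w. mpow w \<eta> * cnj (mpow w \<theta>))"
proof (rule Bochner_Integration.integrable_bound)
  have i: "integrable (gauss_measure \<alpha>) (\<lambda>w. (cmod (mpow w \<eta>))\<^sup>2)" for \<eta>
    by (rule integrableI_nonneg) (auto simp: nn_integral_monomial[OF \<alpha>])
  show "integrable (gauss_measure \<alpha>) (\<lambda>w. (cmod (mpow w \<eta>))\<^sup>2 + (cmod (mpow w \<theta>))\<^sup>2)"
    by (intro Bochner_Integration.integrable_add i)
  show "AE w in gauss_measure \<alpha>. norm (mpow w \<eta> * cnj (mpow w \<theta>)) \<le> norm ((cmod (mpow w \<eta>))\<^sup>2 + (cmod (mpow w \<theta>))\<^sup>2)"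
    using weighted_am_gm[of 1] by (intro AE_I2) (simp add: norm_mult)
  show "(\<lambda>w. mpow w \<eta> * cnj (mpow w \<theta>)) \<in> borel_measurable (gauss_measure \<alpha>)"
    unfolding measurable_cong_sets[OF sets_gauss_measure refl] mpow_def
    by (intro borel_measurable_continuous_onI continuous_intros)
qed

text \<open>For \<eta> \<noteq> \<theta> a rotation of one coordinate preserves the Gaussian measure
  but multiplies the integrand by \<i>, so the integral equals \<i> times itself.\<close>

lemma integral_monomial_pair:
  assumes \<alpha>: "pos_vec \<alpha>"
  shows "(\<integral>w. mpow w \<eta> * cnj (mpow w \<theta>) \<partial>gauss_measure \<alpha>) = (if \<eta> = \<theta> then of_real (real (mfact \<eta>) / mpow \<alpha> \<eta>) else 0)"
proof (cases "\<eta> = \<theta>")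
  case True
  have "(\<integral>w. (cmod (mpow w \<eta>))\<^sup>2 \<partial>gauss_measure \<alpha>) = real (mfact \<eta>) / mpow \<alpha> \<eta>"
    using weight_pos[OF \<alpha>, of \<eta>] by (subst integral_eq_nn_integral) (auto simp: nn_integral_monomial[OF \<alpha>])
  moreover have "mpow w \<eta> * cnj (mpow w \<eta>) = of_real ((cmod (mpow w \<eta>))\<^sup>2)" for w by (rule complex_norm_square[symmetric])
  ultimately have "(\<integral>w. mpow w \<eta> * cnj (mpow w \<eta>) \<partial>gauss_measure \<alpha>) = of_real (real (mfact \<eta>) / mpow \<alpha> \<eta>)"
    by (simp only: integral_complex_of_real)
  then show ?thesis using True by simp
next
  case False
  then obtain j where j: "\<eta> j \<noteq> \<theta> j" by auto
  define d where "d = real (\<eta> j) - real (\<theta> j)"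
  have d: "d \<noteq> 0" using j by (simp add: d_def)
  \<comment> \<open>The angle for which the rotated pair picks up exactly cis (pi/2). Since |d|
    \<ge> 1 it stays within the range of \<open>lborel_rot\<close>.\<close>
  define t where "t = pi / (2 * d)"
  have d1: "\<bar>d\<bar> \<ge> 1" using j unfolding d_def by linarith
  have "\<bar>t\<bar> = pi / (2 * \<bar>d\<bar>)" by (simp add: t_def abs_mult)
  also have "\<dots> \<le> pi / (2 * 1)" using d1 by (intro divide_left_mono) auto
  also have "\<dots> < pi" by simp
  finally have t: "\<bar>t\<bar> < pi" .
  define F where "F w = gauss_density \<alpha> w *\<^sub>R (mpow w \<eta> * cnj (mpow w \<theta>))" for w
  have mr: "mpow (rot j t w) \<eta> = cis (real (\<eta> j) * t) * mpow w \<eta>" for w \<eta>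
  proof -
    have "mpow (rot j t w) \<eta> = (\<Prod>i\<in>UNIV. (if i = j then cis t ^ \<eta> j else 1) * w $ i ^ \<eta> i)"
      unfolding mpow_def rot_def by (intro prod.cong) (auto simp: power_mult_distrib)
    then show ?thesis by (simp add: prod.distrib mpow_def Complex.DeMoivre)
  qed
  have gr: "gauss_density \<alpha> (rot j t w) = gauss_density \<alpha> w" for w
  proof -
    have "cmod (rot j t w $ i) = cmod (w $ i)" for i by (simp add: rot_def norm_mult)
    then show ?thesis by (simp add: gauss_density_def)
  qed
  have Fr: "F (rot j t w) = \<i> * F w" for w
  proof -
    have "cis (real (\<eta> j) * t) * cnj (cis (real (\<theta> j) * t)) = cis (d * t)"
      by (simp add: cis_cnj cis_mult d_def algebra_simps)
    also have "d * t = pi / 2" using d by (simp add: t_def)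
    finally have "cis (real (\<eta> j) * t) * cnj (cis (real (\<theta> j) * t)) = \<i>" by simp
    then have "(cis (real (\<eta> j) * t) * cnj (cis (real (\<theta> j) * t))) * (mpow w \<eta> * cnj (mpow w \<theta>)) = \<i> * (mpow w \<eta> * cnj (mpow w \<theta>))" by simp
    then show ?thesis unfolding F_def gr mr by (simp add: mult_ac)
  qed
  have Fm: "F \<in> borel_measurable borel" unfolding F_def gauss_density_def mpow_def
    by (intro borel_measurable_continuous_onI continuous_intros)
  have rm: "rot j t \<in> borel_measurable borel"
  proof (rule borel_measurable_continuous_onI)
    show "continuous_on UNIV (rot j t)"
      unfolding rot_def
    proof (rule continuous_on_vec_lambda)
      show "continuous_on UNIV (\<lambda>w. if i = j then cis t * w $ i else w $ i)" for i
        by (cases "i = j") (auto intro!: continuous_intros)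
    qed
  qed
  have "(\<integral>w. F w \<partial>lborel) = (\<integral>w. F w \<partial>distr lborel borel (rot j t))" by (simp only: lborel_rot[OF t])
  also have "\<dots> = (\<integral>w. F (rot j t w) \<partial>lborel)"
    by (rule integral_distr) (use rm Fm in auto)
  also have "\<dots> = \<i> * (\<integral>w. F w \<partial>lborel)" unfolding Fr by simp
  finally have "(1 - \<i>) * (\<integral>w. F w \<partial>lborel) = 0" by (simp add: algebra_simps)
  then have "(\<integral>w. F w \<partial>lborel) = 0" by (auto simp: complex_eq_iff)
  moreover have "(\<integral>w. mpow w \<eta> * cnj (mpow w \<theta>) \<partial>gauss_measure \<alpha>) = (\<integral>w. F w \<partial>lborel)"
    unfolding gauss_measure_eq F_def
  proof (rule integral_density)
    show "(\<lambda>w. mpow w \<eta> * cnj (mpow w \<theta>)) \<in> borel_measurable lborel"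
      unfolding mpow_def measurable_lborel2 by (intro borel_measurable_continuous_onI continuous_intros)
  qed (auto simp: gauss_density_nonneg[OF \<alpha>])
  ultimately show ?thesis using False by simp
qed

lemma finite_sum_norm_integral:
  assumes \<alpha>: "pos_vec \<alpha>" and F: "finite F"
  shows "(\<integral>\<^sup>+w. ennreal ((cmod (\<Sum>\<eta>\<in>F. b \<eta> * mpow w \<eta>))\<^sup>2) \<partial>gauss_measure \<alpha>) = ennreal (\<Sum>\<eta>\<in>F. fock_term \<alpha> b \<eta>)"
proof -
  define s where "s w = (\<Sum>\<eta>\<in>F. b \<eta> * mpow w \<eta>)" for w
  have e: "of_real ((cmod (s w))\<^sup>2) = (\<Sum>\<eta>\<in>F. \<Sum>\<theta>\<in>F. (b \<eta> * cnj (b \<theta>)) * (mpow w \<eta> * cnj (mpow w \<theta>)))" for w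
    unfolding complex_norm_square s_def by (simp add: sum_product cnj_sum mult_ac)
  have i: "integrable (gauss_measure \<alpha>) (\<lambda>w. complex_of_real ((cmod (s w))\<^sup>2))"
    unfolding e by (intro Bochner_Integration.integrable_sum integrable_mult_right integrable_monomial_pair \<alpha>)
  have "(\<integral>w. complex_of_real ((cmod (s w))\<^sup>2) \<partial>gauss_measure \<alpha>)
    = (\<Sum>\<eta>\<in>F. \<Sum>\<theta>\<in>F. (b \<eta> * cnj (b \<theta>)) * (if \<eta> = \<theta> then of_real (real (mfact \<eta>) / mpow \<alpha> \<eta>) else 0))"
    unfolding e by (simp add: Bochner_Integration.integral_sum integrable_monomial_pair[OF \<alpha>] integral_monomial_pair[OF \<alpha>] integrable_mult_right)
  also have "\<dots> = (\<Sum>\<eta>\<in>F. of_real (fock_term \<alpha> b \<eta>))"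
  proof (rule sum.cong[OF refl])
    fix \<eta> assume "\<eta> \<in> F"
    have "(\<Sum>\<theta>\<in>F. (b \<eta> * cnj (b \<theta>)) * (if \<eta> = \<theta> then of_real (real (mfact \<eta>) / mpow \<alpha> \<eta>) else 0))
       = (\<Sum>\<theta>\<in>F. if \<eta> = \<theta> then (b \<theta> * cnj (b \<theta>)) * of_real (real (mfact \<theta>) / mpow \<alpha> \<theta>) else 0)"
      by (intro sum.cong) auto
    also have "\<dots> = (b \<eta> * cnj (b \<eta>)) * of_real (real (mfact \<eta>) / mpow \<alpha> \<eta>)"
      using F \<open>\<eta> \<in> F\<close> by (subst sum.delta') auto
    also have "\<dots> = of_real (fock_term \<alpha> b \<eta>)"
      by (simp add: fock_term_def complex_norm_square[symmetric] mult.commute)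
    finally show "(\<Sum>\<theta>\<in>F. (b \<eta> * cnj (b \<theta>)) * (if \<eta> = \<theta> then of_real (real (mfact \<eta>) / mpow \<alpha> \<eta>) else 0)) = of_real (fock_term \<alpha> b \<eta>)" .
  qed
  finally have "complex_of_real (\<integral>w. (cmod (s w))\<^sup>2 \<partial>gauss_measure \<alpha>) = of_real (\<Sum>\<eta>\<in>F. fock_term \<alpha> b \<eta>)"
    by (simp only: integral_complex_of_real of_real_sum)
  then have v: "(\<integral>w. (cmod (s w))\<^sup>2 \<partial>gauss_measure \<alpha>) = (\<Sum>\<eta>\<in>F. fock_term \<alpha> b \<eta>)" by (simp only: of_real_eq_iff)
  have "integrable (gauss_measure \<alpha>) (\<lambda>w. (cmod (s w))\<^sup>2)"
    using i by (simp only: complex_of_real_integrable_eq)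
  then show ?thesis unfolding s_def[symmetric] v[symmetric] by (rule nn_integral_eq_integral) simp
qed

definition box_trunc :: "nat \<Rightarrow> 'n::finite mseries \<Rightarrow> 'n mseries" where
  "box_trunc N b \<eta> = (if \<forall>i. \<eta> i \<le> N then b \<eta> else 0)"

lemma box_trunc_tendsto: "(\<lambda>N. box_trunc N b \<eta>) \<longlonglongrightarrow> b \<eta>"
proof (rule tendsto_eventually)
  show "\<forall>\<^sub>F N in sequentially. box_trunc N b \<eta> = b \<eta>"
    using eventually_ge_at_top[of "Max (range \<eta>)"]
    by eventually_elim (auto simp: box_trunc_def intro: order_trans[OF Max_ge])
qed

lemma series_fun_box_trunc: "series_fun (box_trunc N b) w = (\<Sum>\<eta>\<in>{\<eta>. \<forall>i. \<eta> i \<le> N}. b \<eta> * mpow w \<eta>)"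
  by (subst series_fun_finite[OF finite_bounded_idx[of N]]) (auto simp: box_trunc_def)

lemma series_measurable: "abs_entire b \<Longrightarrow> series_fun b \<in> borel_measurable borel"
  using entire_series[of b] by (auto simp: entire_def intro: borel_measurable_continuous_onI)

text \<open>Fatou's lemma for the box truncations, whose integrals are partial sums of the Fock norm
  by orthogonality.\<close>

lemma fock_norm_integral_le:
  assumes \<alpha>: "pos_vec \<alpha>" and b: "fock_term \<alpha> b summable_on UNIV"
  shows "(\<integral>\<^sup>+w. ennreal ((cmod (series_fun b w))\<^sup>2) \<partial>gauss_measure \<alpha>) \<le> ennreal (\<Sum>\<^sub>\<infinity>\<eta>. fock_term \<alpha> b \<eta>)"
proof -
  have ae: "abs_entire b" by (rule fock_abs_entire[OF \<alpha> b])
  have aeb: "abs_entire (box_trunc N b)" for N by (rule abs_entire_mono[OF ae]) (simp add: box_trunc_def)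
  have lim: "(\<lambda>N. series_fun (box_trunc N b) w) \<longlonglongrightarrow> series_fun b w" for w
    by (rule tendsto_uniform_limitI[OF series_uniform_limit[OF ae _ box_trunc_tendsto, where K = "{w}"]]) (auto simp: box_trunc_def)
  have "(\<integral>\<^sup>+w. ennreal ((cmod (series_fun b w))\<^sup>2) \<partial>gauss_measure \<alpha>)
     = (\<integral>\<^sup>+w. liminf (\<lambda>N. ennreal ((cmod (series_fun (box_trunc N b) w))\<^sup>2)) \<partial>gauss_measure \<alpha>)"
  proof (rule nn_integral_cong)
    fix w
    have "(\<lambda>N. ennreal ((cmod (series_fun (box_trunc N b) w))\<^sup>2)) \<longlonglongrightarrow> ennreal ((cmod (series_fun b w))\<^sup>2)"
      by (intro tendsto_ennrealI tendsto_intros lim)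
    then show "ennreal ((cmod (series_fun b w))\<^sup>2) = liminf (\<lambda>N. ennreal ((cmod (series_fun (box_trunc N b) w))\<^sup>2))"
      by (rule lim_imp_Liminf[symmetric, rotated]) simp
  qed
  also have "\<dots> \<le> liminf (\<lambda>N. \<integral>\<^sup>+w. ennreal ((cmod (series_fun (box_trunc N b) w))\<^sup>2) \<partial>gauss_measure \<alpha>)"
    by (rule nn_integral_liminf) (use series_measurable[OF aeb] in measurable)
  also have "\<dots> \<le> liminf (\<lambda>N. ennreal (\<Sum>\<^sub>\<infinity>\<eta>. fock_term \<alpha> b \<eta>))"
  proof (rule Liminf_mono, rule always_eventually, rule allI)
    fix N
    show "(\<integral>\<^sup>+w. ennreal ((cmod (series_fun (box_trunc N b) w))\<^sup>2) \<partial>gauss_measure \<alpha>) \<le> ennreal (\<Sum>\<^sub>\<infinity>\<eta>. fock_term \<alpha> b \<eta>)"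
      unfolding series_fun_box_trunc finite_sum_norm_integral[OF \<alpha> finite_bounded_idx]
      by (intro ennreal_leI finite_sum_le_infsum b finite_bounded_idx) (auto intro: fock_term_nonneg[OF \<alpha>])
  qed
  also have "\<dots> = ennreal (\<Sum>\<^sub>\<infinity>\<eta>. fock_term \<alpha> b \<eta>)" by (rule Liminf_const) simp
  finally show ?thesis .
qed

text \<open>The factor of x^2 can be brought as close to 1 as desired, at the price of a large
  factor on y^2, which will multiply a vanishing tail.\<close>

lemma square_sum_le:
  fixes x y :: real
  assumes "\<delta> > 0"
  shows "(x + y)\<^sup>2 \<le> (1 + \<delta>) * x\<^sup>2 + (1 + 1 / \<delta>) * y\<^sup>2"
proof -
  have "0 \<le> (\<delta> * x - y)\<^sup>2 / \<delta>" using assms by simp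
  also have "\<dots> = (1 + \<delta>) * x\<^sup>2 + (1 + 1 / \<delta>) * y\<^sup>2 - (x + y)\<^sup>2"
    using assms by (simp add: power2_eq_square field_simps)
  finally show ?thesis by simp
qed

text \<open>
  Fatou gives one inequality; applied to the tails of \<open>b\<close> it also controls the error in the
  reverse inequality for the truncations.
\<close>

lemma fock_norm_integral:
  assumes \<alpha>: "pos_vec \<alpha>" and b: "fock_term \<alpha> b summable_on UNIV"
  shows "has_bochner_integral (gauss_measure \<alpha>) (\<lambda>w. (cmod (series_fun b w))\<^sup>2) (\<Sum>\<^sub>\<infinity>\<eta>. fock_term \<alpha> b \<eta>)"
proof -
  define Tot where "Tot = (\<Sum>\<^sub>\<infinity>\<eta>. fock_term \<alpha> b \<eta>)"
  have ae: "abs_entire b" by (rule fock_abs_entire[OF \<alpha> b])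
  have aeb: "abs_entire (box_trunc N b)" for N by (rule abs_entire_mono[OF ae]) (simp add: box_trunc_def)
  have mb: "series_fun b \<in> borel_measurable borel" by (rule series_measurable[OF ae])
  have integ: "integrable (gauss_measure \<alpha>) (\<lambda>w. (cmod (series_fun c w))\<^sup>2)" "(\<integral>w. (cmod (series_fun c w))\<^sup>2 \<partial>gauss_measure \<alpha>) \<le> (\<Sum>\<^sub>\<infinity>\<eta>. fock_term \<alpha> c \<eta>)"
    if c: "fock_term \<alpha> c summable_on UNIV" for c
  proof -
    have m: "(\<lambda>w. (cmod (series_fun c w))\<^sup>2) \<in> borel_measurable (gauss_measure \<alpha>)"
      using series_measurable[OF fock_abs_entire[OF \<alpha> c]] by measurable
    show i: "integrable (gauss_measure \<alpha>) (\<lambda>w. (cmod (series_fun c w))\<^sup>2)"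
      using m fock_norm_integral_le[OF \<alpha> c] by (intro integrableI_nonneg) (auto simp: le_less_trans)
    have "ennreal (\<integral>w. (cmod (series_fun c w))\<^sup>2 \<partial>gauss_measure \<alpha>) \<le> ennreal (\<Sum>\<^sub>\<infinity>\<eta>. fock_term \<alpha> c \<eta>)"
      using fock_norm_integral_le[OF \<alpha> c] nn_integral_eq_integral[OF i] by simp
    then show "(\<integral>w. (cmod (series_fun c w))\<^sup>2 \<partial>gauss_measure \<alpha>) \<le> (\<Sum>\<^sub>\<infinity>\<eta>. fock_term \<alpha> c \<eta>)"
      by (simp add: ennreal_le_iff infsum_nonneg fock_term_nonneg[OF \<alpha>])
  qed
  define I where "I = (\<integral>w. (cmod (series_fun b w))\<^sup>2 \<partial>gauss_measure \<alpha>)"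
  define tail where "tail N \<eta> = b \<eta> - box_trunc N b \<eta>" for N \<eta>
  have tt: "fock_term \<alpha> (tail N) \<eta> = (if \<forall>i. \<eta> i \<le> N then 0 else fock_term \<alpha> b \<eta>)" for N \<eta>
    by (simp add: tail_def box_trunc_def fock_term_def)
  have ts: "fock_term \<alpha> (tail N) summable_on UNIV" for N
    by (rule summable_on_comparison_test[OF b]) (auto simp: tt fock_term_nonneg[OF \<alpha>])
  define tl where "tl N = (\<Sum>\<^sub>\<infinity>\<eta>. fock_term \<alpha> (tail N) \<eta>)" for N
  have tl0: "tl \<longlonglongrightarrow> 0"
    unfolding tl_def
  proof (rule infsum_dominated[OF b])
    fix \<eta>
    have "(\<lambda>N. tail N \<eta>) \<longlonglongrightarrow> b \<eta> - b \<eta>" unfolding tail_def by (intro tendsto_intros box_trunc_tendsto)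
    then have "(\<lambda>N. real (mfact \<eta>) / mpow \<alpha> \<eta> * (cmod (tail N \<eta>))\<^sup>2) \<longlonglongrightarrow> real (mfact \<eta>) / mpow \<alpha> \<eta> * (cmod (b \<eta> - b \<eta>))\<^sup>2"
      by (intro tendsto_intros)
    then show "(\<lambda>N. fock_term \<alpha> (tail N) \<eta>) \<longlonglongrightarrow> 0" by (simp add: fock_term_def)
  qed (auto simp: tt fock_term_nonneg[OF \<alpha>])
  have ineq: "Tot - tl N \<le> (1 + \<delta>) * I + (1 + 1 / \<delta>) * tl N" if \<delta>: "\<delta> > 0" for N \<delta>
  proof -
    have bs: "fock_term \<alpha> (box_trunc N b) summable_on UNIV"
      by (rule summable_on_comparison_test[OF b]) (auto simp: box_trunc_def fock_term_def mpow_real_pos[OF \<alpha>] less_imp_le)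
    have "Tot - tl N = (\<Sum>\<^sub>\<infinity>\<eta>. fock_term \<alpha> b \<eta> - fock_term \<alpha> (tail N) \<eta>)"
      unfolding Tot_def tl_def
      by (rule infsumI[symmetric], rule has_sum_diff) (intro has_sum_infsum b ts)+
    also have "\<dots> = (\<Sum>\<eta>\<in>{\<eta>. \<forall>i. \<eta> i \<le> N}. fock_term \<alpha> b \<eta>)"
      by (rule infsumI, rule has_sum_finite_neutralI[OF finite_bounded_idx[of N]]) (auto simp: tt)
    finally have "ennreal (Tot - tl N) = (\<integral>\<^sup>+w. ennreal ((cmod (series_fun (box_trunc N b) w))\<^sup>2) \<partial>gauss_measure \<alpha>)"
      unfolding series_fun_box_trunc finite_sum_norm_integral[OF \<alpha> finite_bounded_idx] by simp
    also have "\<dots> = ennreal (\<integral>w. (cmod (series_fun (box_trunc N b) w))\<^sup>2 \<partial>gauss_measure \<alpha>)"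
      by (rule nn_integral_eq_integral[OF integ(1)[OF bs]]) simp
    finally have eq: "ennreal (Tot - tl N) = ennreal (\<integral>w. (cmod (series_fun (box_trunc N b) w))\<^sup>2 \<partial>gauss_measure \<alpha>)" .
    \<comment> \<open>\<open>ennreal\<close> sends negative reals to 0, so the equation can be read
      over the reals only for a nonnegative left-hand side; otherwise the bound is trivial.\<close>
    have "Tot - tl N \<le> (\<integral>w. (cmod (series_fun (box_trunc N b) w))\<^sup>2 \<partial>gauss_measure \<alpha>)"
    proof (cases "0 \<le> Tot - tl N")
      case True
      then show ?thesis using eq
        by (subst (asm) ennreal_inj) auto
    next
      case False
      moreover have "0 \<le> (\<integral>w. (cmod (series_fun (box_trunc N b) w))\<^sup>2 \<partial>gauss_measure \<alpha>)" by simp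
      ultimately show ?thesis by linarith
    qed
    also have "\<dots> \<le> (\<integral>w. (1 + \<delta>) * (cmod (series_fun b w))\<^sup>2 + (1 + 1 / \<delta>) * (cmod (series_fun (tail N) w))\<^sup>2 \<partial>gauss_measure \<alpha>)"
    proof (rule integral_mono)
      show "integrable (gauss_measure \<alpha>) (\<lambda>w. (cmod (series_fun (box_trunc N b) w))\<^sup>2)" by (rule integ(1)[OF bs])
      show "integrable (gauss_measure \<alpha>) (\<lambda>w. (1 + \<delta>) * (cmod (series_fun b w))\<^sup>2 + (1 + 1 / \<delta>) * (cmod (series_fun (tail N) w))\<^sup>2)"
        by (intro Bochner_Integration.integrable_add integrable_mult_right integ(1) b ts)
      fix w
      have "power_series_of (tail N) (\<lambda>w. series_fun b w - series_fun (box_trunc N b) w)"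
        unfolding tail_def by (intro power_series_diff abs_entire_power_series ae aeb)
      then have "series_fun (tail N) w = series_fun b w - series_fun (box_trunc N b) w"
        using power_series_eq by metis
      then have "cmod (series_fun (box_trunc N b) w) \<le> cmod (series_fun b w) + cmod (series_fun (tail N) w)"
        using norm_triangle_ineq4[of "series_fun b w" "series_fun (tail N) w"] by simp
      then have "(cmod (series_fun (box_trunc N b) w))\<^sup>2 \<le> (cmod (series_fun b w) + cmod (series_fun (tail N) w))\<^sup>2"
        by (rule power_mono) simp
      also have "\<dots> \<le> (1 + \<delta>) * (cmod (series_fun b w))\<^sup>2 + (1 + 1 / \<delta>) * (cmod (series_fun (tail N) w))\<^sup>2"
        by (rule square_sum_le[OF \<delta>])
      finally show "(cmod (series_fun (box_trunc N b) w))\<^sup>2 \<le> (1 + \<delta>) * (cmod (series_fun b w))\<^sup>2 + (1 + 1 / \<delta>) * (cmod (series_fun (tail N) w))\<^sup>2" .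
    qed
    also have "\<dots> = (1 + \<delta>) * I + (1 + 1 / \<delta>) * (\<integral>w. (cmod (series_fun (tail N) w))\<^sup>2 \<partial>gauss_measure \<alpha>)"
      unfolding I_def using integ(1)[OF b] integ(1)[OF ts]
      by (subst Bochner_Integration.integral_add) auto
    also have "\<dots> \<le> (1 + \<delta>) * I + (1 + 1 / \<delta>) * tl N"
      unfolding tl_def using \<delta> by (intro add_left_mono mult_left_mono integ(2) ts) auto
    finally show ?thesis .
  qed
  \<comment> \<open>The order of limits matters: N tends to infinity for fixed \<delta>, removing
    the term with 1/\<delta>, and only then does \<delta> tend to 0.\<close>
  have "Tot \<le> (1 + \<delta>) * I" if \<delta>: "\<delta> > 0" for \<delta>
  proof -
    have "Tot - 0 \<le> (1 + \<delta>) * I + (1 + 1 / \<delta>) * 0"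
    proof (rule LIMSEQ_le)
      show "(\<lambda>N. Tot - tl N) \<longlonglongrightarrow> Tot - 0" by (intro tendsto_intros tl0)
      show "(\<lambda>N. (1 + \<delta>) * I + (1 + 1 / \<delta>) * tl N) \<longlonglongrightarrow> (1 + \<delta>) * I + (1 + 1 / \<delta>) * 0" by (intro tendsto_intros tl0)
    qed (use ineq[OF \<delta>] in blast)
    then show ?thesis by simp
  qed
  have "Tot \<le> (1 + 0) * I"
  proof (rule tendsto_lowerbound[of "\<lambda>\<delta>. (1 + \<delta>) * I" _ "at_right 0"])
    show "((\<lambda>\<delta>. (1 + \<delta>) * I) \<longlongrightarrow> (1 + 0) * I) (at_right 0)" by (intro tendsto_intros)
    show "\<forall>\<^sub>F \<delta> in at_right 0. Tot \<le> (1 + \<delta>) * I"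
      using \<open>\<And>\<delta>. \<delta> > 0 \<Longrightarrow> Tot \<le> (1 + \<delta>) * I\<close> by (auto simp: eventually_at_right_field intro!: exI[of _ 1])
  qed simp
  then have "I = Tot" using integ(2)[OF b] by (simp add: I_def Tot_def)
  then show ?thesis using integ(1)[OF b] by (simp add: has_bochner_integral_iff I_def Tot_def)
qed

lemma fock_term_add_summable:
  assumes \<alpha>: "pos_vec \<alpha>" and b: "fock_term \<alpha> b summable_on UNIV" and k: "fock_term \<alpha> k summable_on UNIV"
  shows "fock_term \<alpha> (\<lambda>\<eta>. b \<eta> + c * k \<eta>) summable_on UNIV"
proof (rule summable_on_comparison_test)
  show "(\<lambda>\<eta>. 2 * fock_term \<alpha> b \<eta> + (2 * (cmod c)\<^sup>2) * fock_term \<alpha> k \<eta>) summable_on UNIV"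
    by (intro summable_on_add summable_on_cmult_right b k)
  fix \<eta>
  have "(cmod (b \<eta> + c * k \<eta>))\<^sup>2 \<le> (cmod (b \<eta>) + cmod (c * k \<eta>))\<^sup>2" by (intro power_mono norm_triangle_ineq) auto
  also have "\<dots> \<le> 2 * (cmod (b \<eta>))\<^sup>2 + 2 * (cmod c * cmod (k \<eta>))\<^sup>2" using square_sum_le[of 1 "cmod (b \<eta>)" "cmod (c * k \<eta>)"] by (simp add: norm_mult)
  finally have "real (mfact \<eta>) / mpow \<alpha> \<eta> * (cmod (b \<eta> + c * k \<eta>))\<^sup>2 \<le> real (mfact \<eta>) / mpow \<alpha> \<eta> * (2 * (cmod (b \<eta>))\<^sup>2 + 2 * (cmod c * cmod (k \<eta>))\<^sup>2)"
    using weight_pos[OF \<alpha>, of \<eta>] by (intro mult_left_mono) auto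
  then show "fock_term \<alpha> (\<lambda>\<eta>. b \<eta> + c * k \<eta>) \<eta> \<le> 2 * fock_term \<alpha> b \<eta> + (2 * (cmod c)\<^sup>2) * fock_term \<alpha> k \<eta>"
    by (simp add: fock_term_def power_mult_distrib algebra_simps)
qed (rule fock_term_nonneg[OF \<alpha>])

lemma polarization:
  fixes u v :: complex
  shows "4 * (u * cnj v) = of_real ((cmod (u + 1 * v))\<^sup>2) - of_real ((cmod (u + (-1) * v))\<^sup>2)
      + \<i> * of_real ((cmod (u + \<i> * v))\<^sup>2) - \<i> * of_real ((cmod (u + (-\<i>) * v))\<^sup>2)"
  unfolding complex_norm_square by (simp add: algebra_simps)

text \<open>Polarization is applied twice, pointwise to the integrand and termwise to the
  coefficient sum, so both reduce to the norm identity for the same four series. Conjugating the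
  coefficients of k turns its value at the conjugate point into the conjugate of a series in
  w.\<close>

lemma fock_pairing_integral:
  assumes \<alpha>: "pos_vec \<alpha>" and b: "fock_term \<alpha> b summable_on UNIV" and k: "fock_term \<alpha> k summable_on UNIV"
    and S: "((\<lambda>\<eta>. b \<eta> * k \<eta> * of_real (real (mfact \<eta>) / mpow \<alpha> \<eta>)) has_sum S) UNIV"
  shows "has_bochner_integral (gauss_measure \<alpha>) (\<lambda>w. series_fun b w * series_fun k (cnj_vec w)) S"
proof -
  define k' where "k' \<eta> = cnj (k \<eta>)" for \<eta>
  have k's: "fock_term \<alpha> k' summable_on UNIV" using k by (simp add: fock_term_def[abs_def] k'_def)
  have aeb: "abs_entire b" and aek: "abs_entire k" and aek': "abs_entire k'"
    using fock_abs_entire[OF \<alpha>] b k k's by blast+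
  have ck: "series_fun k (cnj_vec w) = cnj (series_fun k' w)" for w
  proof -
    have "((\<lambda>\<eta>. cnj (k' \<eta> * mpow w \<eta>)) has_sum cnj (series_fun k' w)) UNIV"
      by (rule has_sum_cnj_iff[THEN iffD2, OF abs_entire_has_sum[OF aek']])
    moreover have "cnj (k' \<eta> * mpow w \<eta>) = k \<eta> * mpow (cnj_vec w) \<eta>" for \<eta>
      by (simp add: k'_def mpow_def cnj_vec_def)
    ultimately show ?thesis unfolding series_fun_def[of k] by (simp add: infsumI)
  qed
  define c where "c z = (\<lambda>\<eta>. b \<eta> + z * k' \<eta>)" for z
  have cs: "fock_term \<alpha> (c z) summable_on UNIV" for z
    unfolding c_def by (rule fock_term_add_summable[OF \<alpha> b k's])
  have fc: "series_fun (c z) w = series_fun b w + z * series_fun k' w" for z w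
  proof -
    have "power_series_of (c z) (\<lambda>w. series_fun b w + z * series_fun k' w)"
      unfolding c_def by (intro power_series_add power_series_scale abs_entire_power_series aeb aek')
    from fun_cong[OF power_series_eq[OF this], of w] show ?thesis by simp
  qed
  define N where "N z = (\<Sum>\<^sub>\<infinity>\<eta>. fock_term \<alpha> (c z) \<eta>)" for z
  have Nint: "has_bochner_integral (gauss_measure \<alpha>) (\<lambda>w. complex_of_real ((cmod (series_fun b w + z * series_fun k' w))\<^sup>2)) (of_real (N z))" for z
    using fock_norm_integral[OF \<alpha> cs[of z]] unfolding fc N_def[symmetric] by (rule has_bochner_integral_bounded_linear[OF bounded_linear_of_real])
  have Nsum: "((\<lambda>\<eta>. complex_of_real (fock_term \<alpha> (c z) \<eta>)) has_sum of_real (N z)) UNIV" for z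
    unfolding N_def by (intro has_sum_of_real has_sum_infsum cs)
  define V where "V = of_real (N 1) - of_real (N (-1)) + \<i> * of_real (N \<i>) - \<i> * of_real (N (-\<i>))"
  have "has_bochner_integral (gauss_measure \<alpha>) (\<lambda>w. 4 * (series_fun b w * cnj (series_fun k' w))) V"
    unfolding polarization V_def
    by (intro has_bochner_integral_diff has_bochner_integral_add has_bochner_integral_mult_right Nint)
  then have I: "has_bochner_integral (gauss_measure \<alpha>) (\<lambda>w. (1/4) * (4 * (series_fun b w * cnj (series_fun k' w)))) ((1/4) * V)"
    by (rule has_bochner_integral_mult_right)
  have "((\<lambda>\<eta>. complex_of_real (fock_term \<alpha> (c 1) \<eta>) - of_real (fock_term \<alpha> (c (-1)) \<eta>)
      + \<i> * of_real (fock_term \<alpha> (c \<i>) \<eta>) - \<i> * of_real (fock_term \<alpha> (c (-\<i>)) \<eta>)) has_sum V) UNIV"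
    unfolding V_def by (intro has_sum_diff has_sum_add has_sum_cmult_right Nsum)
  moreover have "complex_of_real (fock_term \<alpha> (c 1) \<eta>) - of_real (fock_term \<alpha> (c (-1)) \<eta>)
      + \<i> * of_real (fock_term \<alpha> (c \<i>) \<eta>) - \<i> * of_real (fock_term \<alpha> (c (-\<i>)) \<eta>)
      = 4 * (b \<eta> * k \<eta> * of_real (real (mfact \<eta>) / mpow \<alpha> \<eta>))" for \<eta>
  proof -
    define r where "r = complex_of_real (real (mfact \<eta>) / mpow \<alpha> \<eta>)"
    have "complex_of_real (fock_term \<alpha> (c z) \<eta>) = r * of_real ((cmod (b \<eta> + z * k' \<eta>))\<^sup>2)" for z
      by (simp add: fock_term_def c_def r_def)
    then have "complex_of_real (fock_term \<alpha> (c 1) \<eta>) - of_real (fock_term \<alpha> (c (-1)) \<eta>)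
      + \<i> * of_real (fock_term \<alpha> (c \<i>) \<eta>) - \<i> * of_real (fock_term \<alpha> (c (-\<i>)) \<eta>)
      = r * (of_real ((cmod (b \<eta> + 1 * k' \<eta>))\<^sup>2) - of_real ((cmod (b \<eta> + (-1) * k' \<eta>))\<^sup>2)
      + \<i> * of_real ((cmod (b \<eta> + \<i> * k' \<eta>))\<^sup>2) - \<i> * of_real ((cmod (b \<eta> + (-\<i>) * k' \<eta>))\<^sup>2))"
      by (simp only: algebra_simps)
    also have "\<dots> = r * (4 * (b \<eta> * cnj (k' \<eta>)))" unfolding polarization ..
    finally show ?thesis by (simp add: r_def k'_def mult_ac)
  qed
  ultimately have "((\<lambda>\<eta>. 4 * (b \<eta> * k \<eta> * of_real (real (mfact \<eta>) / mpow \<alpha> \<eta>))) has_sum V) UNIV" by simp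
  with has_sum_cmult_right[OF S, of 4] have "V = 4 * S" using has_sum_unique by blast
  then show ?thesis using I by (simp add: ck)
qed

section \<open>The main theorem\<close>

lemma symbol_fock_imp_extension:
  fixes T :: "'n::finite mpolynomial \<Rightarrow> 'm::finite mseries"
  assumes T: "linear_operator T" and \<beta>: "pos_vec \<beta>" and \<alpha>: "pos_vec \<alpha>"
    and pres: "LP_preserver T"
    and ker: "fock_term (\<beta> \<oplus>\<^sub>v \<alpha>) (kernel_coeffs T \<alpha>) summable_on UNIV"
  shows "\<exists>S. fock_bounded_linear \<alpha> \<beta> S \<and> extends_operator T S \<and>
     (\<forall>f\<in>fock \<alpha>.
        fock_norm \<beta> (S f) \<le> fock_norm (\<beta> \<oplus>\<^sub>v \<alpha>) (series_fun (kernel_coeffs T \<alpha>)) * fock_norm \<alpha> f \<and>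
        (\<forall>z. has_bochner_integral (gauss_measure \<alpha>)
            (\<lambda>w. f w * series_fun (kernel_coeffs T \<alpha>) (z \<oplus>\<^sub>v cnj_vec w)) (S f z))) \<and>
     (\<forall>f\<in>LP_fock \<alpha>. S f \<in> LP_fock \<beta>)"
proof -
  \<comment> \<open>Defined through Taylor coefficients, hence meaningful for f in the Fock space;
    all claims about S concern such f, polynomials included.\<close>
  define S where "S f = series_fun (ext_coeffs T (taylor_coeffs f))" for f :: "complex ^ 'n \<Rightarrow> complex"
  note fc = fock_coeffs[where \<beta> = \<alpha>]
  have Sf: "S f \<in> fock \<beta>" "taylor_coeffs (S f) = ext_coeffs T (taylor_coeffs f)" if "f \<in> fock \<alpha>" for f
    unfolding S_def using fockI[OF \<beta> ext_fock(1)[OF \<alpha> \<beta> ker fc(2)[OF that]]] by auto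
  have pse: "power_series_of (ext_coeffs T (taylor_coeffs f)) (S f)" if "f \<in> fock \<alpha>" for f
    unfolding S_def by (rule fockI(3)[OF \<beta> ext_fock(1)[OF \<alpha> \<beta> ker fc(2)[OF that]]])
  have bound: "fock_norm \<beta> (S f) \<le> fock_norm (\<beta> \<oplus>\<^sub>v \<alpha>) (series_fun (kernel_coeffs T \<alpha>)) * fock_norm \<alpha> f" if f: "f \<in> fock \<alpha>" for f
  proof -
    have "(fock_norm \<beta> (S f))\<^sup>2 = (\<Sum>\<^sub>\<infinity>\<kappa>. fock_term \<beta> (ext_coeffs T (taylor_coeffs f)) \<kappa>)"
      by (simp add: fock_norm_def Sf[OF f] infsum_nonneg fock_term_nonneg[OF \<beta>])
    also have "\<dots> \<le> (\<Sum>\<^sub>\<infinity>\<eta>. fock_term \<alpha> (taylor_coeffs f) \<eta>) * (fock_norm (\<beta> \<oplus>\<^sub>v \<alpha>) (series_fun (kernel_coeffs T \<alpha>)))\<^sup>2"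
      unfolding kernel_norm[OF \<alpha> \<beta> ker] by (rule ext_fock(2)[OF \<alpha> \<beta> ker fc(2)[OF f]])
    also have "(\<Sum>\<^sub>\<infinity>\<eta>. fock_term \<alpha> (taylor_coeffs f) \<eta>) = (fock_norm \<alpha> f)\<^sup>2"
      by (simp add: fock_norm_def infsum_nonneg fock_term_nonneg[OF \<alpha>])
    finally have "(fock_norm \<beta> (S f))\<^sup>2 \<le> (fock_norm (\<beta> \<oplus>\<^sub>v \<alpha>) (series_fun (kernel_coeffs T \<alpha>)) * fock_norm \<alpha> f)\<^sup>2"
      by (simp add: power_mult_distrib mult.commute)
    then show ?thesis
      by (rule power2_le_imp_le)
        (auto simp: fock_norm_def infsum_nonneg fock_term_nonneg[OF \<alpha>] fock_term_nonneg[OF pos_vec_vconcat[OF \<beta> \<alpha>]] intro!: mult_nonneg_nonneg)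
  qed
  have lin: "S (\<lambda>w. f w + g w) = (\<lambda>z. S f z + S g z)" if f: "f \<in> fock \<alpha>" and g: "g \<in> fock \<alpha>" for f g
  proof -
    have t: "taylor_coeffs (\<lambda>w. f w + g w) = (\<lambda>\<eta>. taylor_coeffs f \<eta> + taylor_coeffs g \<eta>)"
      by (rule taylor_coeffs_eq[OF power_series_add[OF fc(1)[OF f] fc(1)[OF g]]])
    have "ext_coeffs T (taylor_coeffs (\<lambda>w. f w + g w)) = (\<lambda>\<kappa>. ext_coeffs T (taylor_coeffs f) \<kappa> + ext_coeffs T (taylor_coeffs g) \<kappa>)"
      unfolding t ext_coeffs_def distrib_right
      by (intro ext infsum_add ext_row_summable[OF \<alpha> \<beta> ker] fc(2) f g)
    then show ?thesis
      using power_series_eq[OF power_series_add[OF pse[OF f] pse[OF g]]] by (simp add: S_def)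
  qed
  have hom: "S (\<lambda>w. c * f w) = (\<lambda>z. c * S f z)" if f: "f \<in> fock \<alpha>" for c f
  proof -
    have t: "taylor_coeffs (\<lambda>w. c * f w) = (\<lambda>\<eta>. c * taylor_coeffs f \<eta>)"
      by (rule taylor_coeffs_eq[OF power_series_scale[OF fc(1)[OF f]]])
    have "ext_coeffs T (taylor_coeffs (\<lambda>w. c * f w)) = (\<lambda>\<kappa>. c * ext_coeffs T (taylor_coeffs f) \<kappa>)"
      unfolding t ext_coeffs_def mult.assoc by (intro ext infsum_cmult_right')
    then show ?thesis
      using power_series_eq[OF power_series_scale[OF pse[OF f]]] by (simp add: S_def)
  qed
  have "fock_bounded_linear \<alpha> \<beta> S"
    unfolding fock_bounded_linear_def using Sf(1) lin hom bound by blast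
  moreover have "extends_operator T S"
    unfolding extends_operator_def
  proof
    fix P :: "'n mpolynomial"
    have t: "taylor_coeffs (poly_fun P) = Poly_Mapping.lookup P" by (rule taylor_coeffs_eq[OF power_series_poly])
    have "fock_term \<beta> (ext_coeffs T (Poly_Mapping.lookup P)) summable_on UNIV"
      by (rule ext_fock(1)[OF \<alpha> \<beta> ker fock_term_poly])
    from fockI(3)[OF \<beta> this] show "power_series_of (T P) (S (poly_fun P))"
      unfolding S_def t ext_poly[OF T] .
  qed
  moreover have "has_bochner_integral (gauss_measure \<alpha>)
      (\<lambda>w. f w * series_fun (kernel_coeffs T \<alpha>) (z \<oplus>\<^sub>v cnj_vec w)) (S f z)" if f: "f \<in> fock \<alpha>" for f z
  proof -
    have "series_fun (kernel_coeffs T \<alpha>) (z \<oplus>\<^sub>v w) = series_fun (row_coeffs T \<alpha> z) w" for w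
      using fun_cong[OF power_series_eq[OF row_power_series[OF \<alpha> \<beta> ker]]] .
    moreover have "f = series_fun (taylor_coeffs f)" by (rule power_series_eq[OF fc(1)[OF f]])
    ultimately show ?thesis
      using fock_pairing_integral[OF \<alpha> fc(2)[OF f] row_fock[OF \<alpha> \<beta> ker] ext_as_pairing[OF \<alpha> \<beta> ker fc(2)[OF f]], of z]
      by (simp add: S_def)
  qed
  moreover have "S f \<in> LP_fock \<beta>" if f: "f \<in> LP_fock \<alpha>" for f
  proof -
    have f': "f \<in> LP" "f \<in> fock \<alpha>" using f by (auto simp: LP_fock_def)
    have "S f \<in> LP" unfolding S_def
      by (rule ext_LP[OF \<alpha> \<beta> ker T pres f'(1) fc(1)[OF f'(2)] fc(2)[OF f'(2)]])
    then show ?thesis using Sf(1)[OF f'(2)] by (simp add: LP_fock_def)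
  qed
  ultimately show ?thesis using bound by blast
qed

theorem theorem3p1:
  fixes T :: "'n::finite mpolynomial \<Rightarrow> 'm::finite mseries"
  assumes "linear_operator T"
    and "rank_at_least 2 T"
  shows "(LP_preserver T \<longleftrightarrow>
            (\<exists>\<beta> \<gamma>. pos_vec \<beta> \<and> pos_vec \<gamma> \<and>
               rescale (1 \<oplus>\<^sub>v (- 1)) (symbol T) \<in> series_in (LP_fock (\<beta> \<oplus>\<^sub>v \<gamma>)))) \<and>
         (\<forall>\<beta> \<gamma>. pos_vec \<beta> \<and> pos_vec \<gamma> \<and>
               rescale (1 \<oplus>\<^sub>v (- 1)) (symbol T) \<in> series_in (LP_fock (\<beta> \<oplus>\<^sub>v \<gamma>)) \<longrightarrow>
            (\<forall>\<alpha>. pos_vec \<alpha> \<and> (\<forall>i. \<alpha> $ i \<le> inverse (\<gamma> $ i)) \<longrightarrow>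
               rescale (1 \<oplus>\<^sub>v cvec \<alpha>) (symbol T) \<in> series_in (fock (\<beta> \<oplus>\<^sub>v \<alpha>)) \<and>
               (\<exists>S. fock_bounded_linear \<alpha> \<beta> S \<and> extends_operator T S \<and>
                  (\<forall>f\<in>fock \<alpha>.
                     fock_norm \<beta> (S f)
                       \<le> fock_norm (\<beta> \<oplus>\<^sub>v \<alpha>) (series_fun (rescale (1 \<oplus>\<^sub>v cvec \<alpha>) (symbol T)))
                          * fock_norm \<alpha> f \<and>
                     (\<forall>z. has_bochner_integral (gauss_measure \<alpha>)
                        (\<lambda>w. f w * series_fun (rescale (1 \<oplus>\<^sub>v cvec \<alpha>) (symbol T)) (z \<oplus>\<^sub>v cnj_vec w))
                        (S f z))) \<and>
                  (\<forall>f\<in>LP_fock \<alpha>. S f \<in> LP_fock \<beta>))))"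
proof -
  \<comment> \<open>Serves the equivalence and also supplies the preserver property that the
    extension needs for mapping Laguerre-Polya functions to such functions.\<close>
  have symbol_pres: "LP_preserver T" if "signed_symbol T \<in> series_in (LP_fock \<delta>)" for \<delta>
    by (rule symbol_LP_imp_preserver[OF assms(1)]) (use that in \<open>auto simp: series_in_def LP_fock_def\<close>)
  have ext: "kernel_coeffs T \<alpha> \<in> series_in (fock (\<beta> \<oplus>\<^sub>v \<alpha>)) \<and>
     (\<exists>S. fock_bounded_linear \<alpha> \<beta> S \<and> extends_operator T S \<and>
       (\<forall>f\<in>fock \<alpha>.
          fock_norm \<beta> (S f) \<le> fock_norm (\<beta> \<oplus>\<^sub>v \<alpha>) (series_fun (kernel_coeffs T \<alpha>)) * fock_norm \<alpha> f \<and>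
          (\<forall>z. has_bochner_integral (gauss_measure \<alpha>)
              (\<lambda>w. f w * series_fun (kernel_coeffs T \<alpha>) (z \<oplus>\<^sub>v cnj_vec w)) (S f z))) \<and>
       (\<forall>f\<in>LP_fock \<alpha>. S f \<in> LP_fock \<beta>))"
    if \<beta>: "pos_vec \<beta>" and \<gamma>: "pos_vec \<gamma>" and G: "signed_symbol T \<in> series_in (LP_fock (\<beta> \<oplus>\<^sub>v \<gamma>))"
      and \<alpha>: "pos_vec \<alpha>" "\<forall>i. \<alpha> $ i \<le> inverse (\<gamma> $ i)" for \<alpha> \<beta> \<gamma>
  proof -
    obtain g where g: "g \<in> fock (\<beta> \<oplus>\<^sub>v \<gamma>)" "power_series_of (signed_symbol T) g"
      using G by (auto simp: series_in_def LP_fock_def)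
    have "fock_term (\<beta> \<oplus>\<^sub>v \<gamma>) (signed_symbol T) summable_on UNIV"
      using fock_coeffs(2)[OF g(1)] taylor_coeffs_eq[OF g(2)] by simp
    from kernel_fock_summable[OF \<beta> \<gamma> \<alpha> this]
    have ker: "fock_term (\<beta> \<oplus>\<^sub>v \<alpha>) (kernel_coeffs T \<alpha>) summable_on UNIV" .
    have "kernel_coeffs T \<alpha> \<in> series_in (fock (\<beta> \<oplus>\<^sub>v \<alpha>))"
      using fockI[OF pos_vec_vconcat[OF \<beta> \<alpha>(1)] ker] by (auto simp: series_in_def)
    then show ?thesis
      using symbol_fock_imp_extension[OF assms(1) \<beta> \<alpha>(1) symbol_pres[OF G] ker] by blast
  qed
  show ?thesis
    using preserver_imp_symbol_fock[OF assms] symbol_pres ext unfolding kernel_coeffs_def by blast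
qed

end
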